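(* Let $n\ge 3$. There exist positive constants $\sigma_n$ and $C_n$ depending only on $n$ with the following property. Let $\Omega\subset\mathbb{R}^n$ be a bounded domain with $0\in\partial\Omega$ satisfying the exterior ball condition $B_\rho(-\rho e_n)\subset\mathbb{R}^n\setminus\overline{\Omega}$ for some $\rho>0$, and let $D=\sup_{x\in\Omega}|x|$. If $\rho\ge D/\sigma_n$, then $$\int_\Omega|\nabla u|^2dx\ \ge\ \frac{n^2}{4}\int_\Omega\frac{u^2}{|x|^2}dx+C_n\Big(\int_\Omega X_1^{\frac{2n-2}{n-2}}|u|^{\frac{2n}{n-2}}dx\Big)^{\frac{n-2}{n}}\qquad\text{for all }u\in C_c^\infty(\Omega),$$ where $X_1=X_1(|x|/(3D))$. If in addition $\Omega$ satisfies an interior ball condition at $0$, then the exponent $\frac{2n-2}{n-2}$ of $X_1$ is sharp, i.e. for no $p<\frac{2n-2}{n-2}$ is there a constant $C>0$ such that the inequality with $X_1^{p}$ in place of $X_1^{\frac{2n-2}{n-2}}$ and $C$ in place of $C_n$ holds for all $u\in C_c^\infty(\Omega)$.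
   Context: $B_r(x_0)$ is the open ball of radius $r$ centered at $x_0$; $e_n$ is the unit vector in the $x_n$ direction. Interior ball condition at $0$: there exists an open ball $B\subset\Omega$ with $0\in\partial B$. $X_1(t)=\frac{1}{1-\ln t}$ for $t\in(0,1)$. *)

theory Defs
  imports "HOL-Analysis.Analysis"
begin

fun Ck :: "nat \<Rightarrow> ('a::real_normed_vector \<Rightarrow> 'b::real_normed_vector) \<Rightarrow> bool" where
  "Ck 0 f \<longleftrightarrow> continuous_on UNIV f"
| "Ck (Suc k) f \<longleftrightarrow> (\<forall>x. f differentiable (at x)) \<and>
     (\<forall>v. Ck k (\<lambda>x. frechet_derivative f (at x) v))"

(* Elements of C_c^infinity(\<Omega>) are represented by their extension by zero to the whole space. *)
definition Cc_infty :: "'a::real_normed_vector set \<Rightarrow> ('a \<Rightarrow> real) set" where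
  "Cc_infty \<Omega> = {u. (\<forall>k. Ck k u) \<and> compact (closure {x. u x \<noteq> 0}) \<and> closure {x. u x \<noteq> 0} \<subseteq> \<Omega>}"

definition gradient :: "(real ^ 'n \<Rightarrow> real) \<Rightarrow> real ^ 'n \<Rightarrow> real ^ 'n" where
  "gradient u x = (\<chi> i. frechet_derivative u (at x) (axis i 1))"

definition bounded_domain :: "'a::real_normed_vector set \<Rightarrow> bool" where
  "bounded_domain \<Omega> \<longleftrightarrow> open \<Omega> \<and> connected \<Omega> \<and> \<Omega> \<noteq> {} \<and> bounded \<Omega>"

definition interior_ball_at_0 :: "'a::real_normed_vector set \<Rightarrow> bool" where
  "interior_ball_at_0 \<Omega> \<longleftrightarrow> (\<exists>c r. 0 < r \<and> ball c r \<subseteq> \<Omega> \<and> 0 \<in> frontier (ball c r))"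

definition sup_norm_on :: "'a::real_normed_vector set \<Rightarrow> real" where
  "sup_norm_on \<Omega> = (SUP x\<in>\<Omega>. norm x)"

definition X1 :: "real \<Rightarrow> real" where
  "X1 t = 1 / (1 - ln t)"

(* The integrands below are bounded with compact support inside \<Omega> whenever \<Omega> is open,
   0 \<notin> \<Omega> and u \<in> Cc_infty \<Omega>, so the Bochner integrals are never the default value 0
   of a non-integrable function. *)
definition hardy_sobolev_ineq ::
    "(real ^ 'n) set \<Rightarrow> real \<Rightarrow> real \<Rightarrow> (real ^ 'n \<Rightarrow> real) \<Rightarrow> bool" where
  "hardy_sobolev_ineq \<Omega> p C u \<longleftrightarrow>
     (let n = real CARD('n); D = sup_norm_on \<Omega> in
       (LINT x:\<Omega>|lborel. (norm (gradient u x))\<^sup>2) \<ge>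
         n\<^sup>2 / 4 * (LINT x:\<Omega>|lborel. (u x)\<^sup>2 / (norm x)\<^sup>2) +
         C * (LINT x:\<Omega>|lborel. X1 (norm x / (3 * D)) powr p * \<bar>u x\<bar> powr (2 * n / (n - 2)))
               powr ((n - 2) / n))"

end

theory Submission
  imports Defs
begin

text \<open>
  The constant $n^2/4$ comes from the half space: there $(x \cdot e)\,|x|^{-n/2}$ is a positive
  solution of $-\Delta\varphi = \frac{n^2}{4}\varphi/|x|^2$.  Outside a ball of radius $1/\kappa$ that
  touches the origin from the side $-e$, the linear factor is replaced by a polynomial $F$ in the
  defining function $d(x) = x \cdot e + \frac\kappa2|x|^2$ of the ball.  The right polynomial is
  $F = d - \frac n4\kappa d^2$: for it the error terms in the equation are again multiples of $F$,
  so that $\varphi = F\,|x|^{-n/2}$ satisfies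
  $-\Delta\varphi = (\frac{n^2}{4} + O(\kappa|x|))\,\varphi/|x|^2$.  Dividing by $\varphi$
  (\<open>ground_state_identity\<close>) turns the Dirichlet integral of $u$ into
  \<open>energy\<close>, the integral of $|\nabla u - u\,\nabla\varphi/\varphi|^2$, plus a potential term,
  and the claim becomes a lower bound for the energy.

  Radial vector fields give one-dimensional Hardy inequalities for the energy with a free weight
  (\<open>weighted_hardy\<close>), and two weights suffice.  Let $l(r) = 1 - \ln(r/3D)$, so that $X_1 = 1/l$.
  The weight $1/l$ yields a Hardy inequality with the weight $l^{-2}|x|^{-2}$ (\<open>log_hardy\<close>);
  it absorbs the curvature error $O(\kappa/|x|)$ as soon as $\kappa D$ is small, which is the
  hypothesis on $\rho = 1/\kappa$.  A weight that switches at the radius $R$ yields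
  $\int_{|x| \sim R} u^2/|x|^2 \le C\,l(R)\cdot\mathrm{energy}$ (\<open>annulus_hardy\<close>), the
  counterpart of $v(t)^2 \le t\int_0^t |v'|^2$ on the half line.

  The Sobolev exponent $q = 2n/(n-2)$ enters one dyadic annulus at a time.  With $e_k$ the energy
  content of the annulus of radius $R_k = D/2^k$, and $l_k = l(R_k)$, the Sobolev inequality for a
  cut-off copy of $u$ gives $\int |u|^q \le C e_k^{q/2}$ there.  Estimating all but one of
  the powers of $e_k$ by $e_k \le C\,l_k\cdot\mathrm{energy}$ leaves
  $\sum_k l_k^{-p}\,l_k^{q/2-1}\,e_k$ with $p = q/2 + 1 = (2n-2)/(n-2)$, that is $\sum_k l_k^{-2}e_k$, which
  \<open>log_hardy\<close> bounds by the energy.  The Sobolev inequality itself is proved by the method of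
  Gagliardo and Nirenberg from a Loomis--Whitney inequality for product measures.

  For sharpness, the same $\varphi$ with $\kappa = -1/r$ vanishes on the boundary of an interior ball of
  radius $r$.  The functions $\varphi(x)\,B(|x|^{1/L})$ with a fixed bump $B$ live on about $L$ dyadic
  scales, where $l$ is comparable to $L$.  Their Hardy deficit is $O(1/L)$
  (\<open>deficit_upper\<close>), while their weighted $L^q$ integral is at least $c\,L^{1-p}$
  (\<open>sobolev_mass_lower\<close>).  For $p < q/2 + 1$ the quantity $L^{(1-p)\,2/q}$ is not $O(1/L)$.  A cut-off near the
  sphere makes the functions admissible at an arbitrarily small cost, because $\varphi$ vanishes there.
\<close>

section \<open>Compactly supported functions and integration by parts\<close>

text \<open>
  The gradient is carried along as an explicit function, so that the calculus rules below produce
  the gradient of a product or a composition together with the function.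
\<close>
definition C1_on :: "'a::euclidean_space set \<Rightarrow> ('a \<Rightarrow> real) \<Rightarrow> ('a \<Rightarrow> 'a) \<Rightarrow> bool" where
  "C1_on U f g \<longleftrightarrow> (\<forall>x\<in>U. (f has_derivative (\<lambda>h. g x \<bullet> h)) (at x)) \<and> continuous_on U g"

text \<open>
  Functions are extended by zero to the whole space. Both the function and its gradient are required to vanish off a
  compact subset of \<open>U\<close>; coefficients that are singular outside \<open>U\<close> may then multiply them.
\<close>
definition C1c_on :: "'a::euclidean_space set \<Rightarrow> ('a \<Rightarrow> real) \<Rightarrow> ('a \<Rightarrow> 'a) \<Rightarrow> bool" where
  "C1c_on U f g \<longleftrightarrow> C1_on UNIV f g \<and>
     (\<exists>K. compact K \<and> K \<subseteq> U \<and> (\<forall>x. x \<notin> K \<longrightarrow> f x = 0 \<and> g x = 0))"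

lemma C1_on_subset: "C1_on U f g \<Longrightarrow> V \<subseteq> U \<Longrightarrow> C1_on V f g"
  unfolding C1_on_def by (auto intro: continuous_on_subset)

lemma C1_on_continuous: "C1_on U f g \<Longrightarrow> continuous_on U f"
  unfolding C1_on_def by (meson continuous_at_imp_continuous_on has_derivative_continuous)

lemma C1_on_continuous_grad: "C1_on U f g \<Longrightarrow> continuous_on U g"
  by (simp add: C1_on_def)

lemma C1_on_has_derivative: "C1_on U f g \<Longrightarrow> x \<in> U \<Longrightarrow> (f has_derivative (\<lambda>h. g x \<bullet> h)) (at x)"
  by (simp add: C1_on_def)

lemma C1_on_const: "C1_on U (\<lambda>_. c) (\<lambda>_. 0)"
  by (simp add: C1_on_def)

lemma C1_on_add:
  assumes "C1_on U f f'" "C1_on U g g'"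
  shows "C1_on U (\<lambda>x. f x + g x) (\<lambda>x. f' x + g' x)"
  using assms unfolding C1_on_def
  by (auto intro!: derivative_eq_intros continuous_intros simp: inner_add_left)

lemma C1_on_mult:
  assumes "C1_on U f f'" "C1_on U g g'"
  shows "C1_on U (\<lambda>x. f x * g x) (\<lambda>x. f x *\<^sub>R g' x + g x *\<^sub>R f' x)"
  using assms C1_on_continuous[OF assms(1)] C1_on_continuous[OF assms(2)] unfolding C1_on_def
  by (auto intro!: derivative_eq_intros continuous_intros ext simp: inner_add_left)

lemma C1_on_inner: "C1_on U (\<lambda>x. x \<bullet> v) (\<lambda>_. v)"
  unfolding C1_on_def by (auto intro!: derivative_eq_intros simp: inner_commute)

lemma C1_on_sqnorm: "C1_on U (\<lambda>x. x \<bullet> x) (\<lambda>x. 2 *\<^sub>R x)"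
  unfolding C1_on_def by (auto intro!: derivative_eq_intros continuous_intros ext simp: inner_commute)

lemma C1_on_comp:
  assumes "C1_on U f g" "\<And>x. x \<in> U \<Longrightarrow> (\<Phi> has_real_derivative \<phi> (f x)) (at (f x))"
    "continuous_on (f ` U) \<phi>"
  shows "C1_on U (\<lambda>x. \<Phi> (f x)) (\<lambda>x. \<phi> (f x) *\<^sub>R g x)"
proof -
  have "((\<lambda>x. \<Phi> (f x)) has_derivative (\<lambda>h. (\<phi> (f x) *\<^sub>R g x) \<bullet> h)) (at x)" if "x \<in> U" for x
    using has_derivative_compose[OF C1_on_has_derivative[OF assms(1) that]
        assms(2)[OF that, unfolded has_field_derivative_def]] by simp
  moreover have "continuous_on U (\<lambda>x. \<phi> (f x) *\<^sub>R g x)"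
    using C1_on_continuous[OF assms(1)] assms(3) C1_on_continuous_grad[OF assms(1)]
    by (intro continuous_intros) (auto intro: continuous_on_compose2)
  ultimately show ?thesis unfolding C1_on_def by blast
qed

lemma C1_on_cong:
  assumes "C1_on U f g" "\<And>x. f x = f' x" "\<And>x. x \<in> U \<Longrightarrow> g x = g' x"
  shows "C1_on U f' g'"
proof -
  have "f = f'" using assms(2) by auto
  with assms show ?thesis unfolding C1_on_def by (auto cong: continuous_on_cong)
qed

lemma C1c_on_C1: "C1c_on U f g \<Longrightarrow> C1_on V f g"
  unfolding C1c_on_def using C1_on_subset by blast

lemma C1c_on_outside: "C1c_on U f g \<Longrightarrow> x \<notin> U \<Longrightarrow> f x = 0 \<and> g x = 0"
  unfolding C1c_on_def by blast

text \<open>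
  Off the compact set the function is locally zero, so its behaviour on \<open>U\<close> determines it everywhere.
\<close>
lemma C1c_onI:
  assumes U: "open U" and K: "compact K" "K \<subseteq> U" "\<And>x. x \<notin> K \<Longrightarrow> f x = 0" "\<And>x. x \<notin> K \<Longrightarrow> g x = 0"
    and f: "C1_on U f g"
  shows "C1c_on U f g"
proof -
  have op: "open (- K)" using K compact_imp_closed by blast
  have "(f has_derivative (\<lambda>h. g x \<bullet> h)) (at x)" for x
  proof (cases "x \<in> U")
    case False
    then have x: "x \<in> - K" using K by auto
    have "((\<lambda>_. 0) has_derivative (\<lambda>h. g x \<bullet> h)) (at x)" using K(4)[of x] x by simp
    then show ?thesis
      by (rule has_derivative_transform_within_open[OF _ op x]) (use K in auto)
  qed (use f in \<open>auto simp: C1_on_def\<close>)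
  moreover have "continuous_on (U \<union> (- K)) g"
  proof (rule continuous_on_open_Un[OF U op])
    have "continuous_on (- K) (\<lambda>_. 0 :: 'a)" by simp
    then show "continuous_on (- K) g"
      by (rule continuous_on_eq) (use K(4) in auto)
  qed (use f in \<open>auto simp: C1_on_def\<close>)
  moreover have "U \<union> (- K) = UNIV" using K by auto
  ultimately show ?thesis using K unfolding C1c_on_def C1_on_def by auto
qed

lemma C1c_on_mult:
  assumes U: "open U" and f: "C1c_on U f f'" and a: "C1_on U a a'"
  shows "C1c_on U (\<lambda>x. a x * f x) (\<lambda>x. a x *\<^sub>R f' x + f x *\<^sub>R a' x)"
proof -
  obtain K where K: "compact K" "K \<subseteq> U" "\<And>x. x \<notin> K \<Longrightarrow> f x = 0" "\<And>x. x \<notin> K \<Longrightarrow> f' x = 0"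
    using f unfolding C1c_on_def by blast
  show ?thesis
    by (rule C1c_onI[OF U K(1,2)]) (auto simp: K intro!: C1_on_mult a C1c_on_C1[OF f])
qed

lemma C1c_on_square:
  assumes U: "open U" and f: "C1c_on U f f'"
  shows "C1c_on U (\<lambda>x. (f x)\<^sup>2) (\<lambda>x. (2 * f x) *\<^sub>R f' x)"
proof -
  have "(2 * f x) *\<^sub>R f' x = f x *\<^sub>R f' x + f x *\<^sub>R f' x" for x
    by (simp only: mult_2 scaleR_left_distrib)
  then show ?thesis
    unfolding power2_eq_square using C1c_on_mult[OF U f C1c_on_C1[OF f]] by simp
qed

lemma integrable_compact_support:
  fixes h :: "'a::euclidean_space \<Rightarrow> real"
  assumes "compact K" "K \<subseteq> U" "continuous_on U h" "\<And>x. x \<notin> K \<Longrightarrow> h x = 0"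
  shows "integrable lborel h"
proof -
  have "integrable lborel (\<lambda>x. indicator K x *\<^sub>R h x)"
    using assms by (intro borel_integrable_compact) (auto intro: continuous_on_subset)
  moreover have "(\<lambda>x. indicator K x *\<^sub>R h x) = h"
    using assms(4) by (auto simp: indicator_def fun_eq_iff of_bool_def)
  ultimately show ?thesis by simp
qed

text \<open>
  This is how integrability is checked throughout: the integrand is continuous on \<open>U\<close> and vanishes with
  the function and its gradient.
\<close>
lemma integrable_C1c_on:
  fixes h :: "'a::euclidean_space \<Rightarrow> real"
  assumes "C1c_on U f g" "continuous_on U h" "\<And>x. f x = 0 \<Longrightarrow> g x = 0 \<Longrightarrow> h x = 0"
  shows "integrable lborel h"
proof -
  obtain K where K: "compact K" "K \<subseteq> U" "\<And>x. x \<notin> K \<Longrightarrow> f x = 0 \<and> g x = 0"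
    using assms(1) unfolding C1c_on_def by blast
  show ?thesis
    by (rule integrable_compact_support[OF K(1,2) assms(2)]) (use K(3) assms(3) in blast)
qed

lemma lborel_integral_translate:
  fixes f :: "'a::euclidean_space \<Rightarrow> real"
  assumes "integrable lborel f"
  shows "integrable lborel (\<lambda>x. f (x + c))" "(\<integral>x. f (x + c) \<partial>lborel) = (\<integral>x. f x \<partial>lborel)"
proof -
  have eq: "distr lborel borel ((+) c) = (lborel :: 'a measure)" by (rule lborel_distr_plus)
  have [measurable]: "f \<in> borel_measurable borel" using assms by auto
  have "integrable (distr lborel borel ((+) c)) f" unfolding eq by (rule assms)
  then show "integrable lborel (\<lambda>x. f (x + c))"
    by (subst (asm) integrable_distr_eq) (auto simp: add.commute)
  have "(\<integral>x. f x \<partial>distr lborel borel ((+) c)) = (\<integral>x. f (c + x) \<partial>lborel)"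
    by (rule integral_distr) auto
  then show "(\<integral>x. f (x + c) \<partial>lborel) = (\<integral>x. f x \<partial>lborel)"
    unfolding eq by (simp add: add.commute)
qed

text \<open>
  Difference quotients of \<open>f\<close> integrate to zero because Lebesgue measure is translation invariant, and they
  converge boundedly to the directional derivative.
\<close>
lemma integral_directional_derivative_zero:
  assumes "C1c_on U f g"
  shows "(\<integral>x. g x \<bullet> v \<partial>lborel) = 0"
proof -
  obtain K where K: "compact K" "\<And>x. x \<notin> K \<Longrightarrow> f x = 0" "\<And>x. x \<notin> K \<Longrightarrow> g x = 0"
    using assms unfolding C1c_on_def by blast
  have f: "C1_on UNIV f g" using assms by (rule C1c_on_C1)
  obtain M where M: "\<And>x. x \<in> K \<Longrightarrow> norm x \<le> M" using compact_imp_bounded[OF K(1)] bounded_iff by blast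
  have "compact (g ` K)"
    using K f by (intro compact_continuous_image) (auto simp: C1_on_def intro: continuous_on_subset)
  then obtain B0 where B0: "\<And>x. x \<in> K \<Longrightarrow> norm (g x) \<le> B0"
    using compact_imp_bounded[of "g ` K"] by (auto simp: bounded_iff)
  define B where "B = max 0 B0"
  have B: "norm (g x) \<le> B" for x using B0[of x] K(3)[of x] unfolding B_def by (cases "x \<in> K") auto
  have intf: "integrable lborel f"
    by (rule integrable_compact_support[OF K(1) _ C1_on_continuous[OF f]]) (use K in auto)
  define s where "s m x = (f (x + inverse (real (Suc m)) *\<^sub>R v) - f x) * real (Suc m)" for m x
  have int: "integrable lborel (s m)" for m
    unfolding s_def using lborel_integral_translate(1)[OF intf] intf by auto
  have int0: "(\<integral>x. s m x \<partial>lborel) = 0" for m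
    unfolding s_def using lborel_integral_translate[OF intf] intf by simp
  have lip: "\<bar>f y - f x\<bar> \<le> B * norm (y - x)" for x y
  proof -
    have "norm (f y - f x) \<le> B * norm (y - x)"
    proof (rule differentiable_bound[of UNIV f "\<lambda>x h. g x \<bullet> h" B])
      show "(f has_derivative (\<lambda>h. g x \<bullet> h)) (at x within UNIV)" for x
        using f by (simp add: C1_on_def)
      show "onorm (\<lambda>h. g x \<bullet> h) \<le> B" for x
        by (rule onorm_le) (metis B Cauchy_Schwarz_ineq2 mult_right_mono norm_ge_zero order_trans real_norm_def)
    qed auto
    then show ?thesis by simp
  qed
  have bnd: "\<bar>s m x\<bar> \<le> indicator (cball 0 (M + norm v)) x * (B * norm v)" for m x
  proof (cases "x \<in> cball 0 (M + norm v)")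
    case True
    have "\<bar>s m x\<bar> \<le> B * norm (inverse (real (Suc m)) *\<^sub>R v) * real (Suc m)"
      unfolding s_def abs_mult using lip[of "x + inverse (real (Suc m)) *\<^sub>R v" x]
      by (intro mult_mono) auto
    also have "\<dots> = B * norm v" by simp
    finally show ?thesis using True by simp
  next
    case False
    then have x: "norm x > M + norm v" by simp
    have le: "norm (inverse (real (Suc m)) *\<^sub>R v) \<le> norm v"
      by (simp add: mult_left_le_one_le inverse_le_1_iff)
    have "norm x \<le> norm (x + inverse (real (Suc m)) *\<^sub>R v) + norm (inverse (real (Suc m)) *\<^sub>R v)"
      by (metis add_diff_cancel_right' norm_triangle_ineq4)
    then have "norm (x + inverse (real (Suc m)) *\<^sub>R v) > M" using x le by linarith
    then have "x + inverse (real (Suc m)) *\<^sub>R v \<notin> K" using M by force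
    moreover have "x \<notin> K" using M[of x] x norm_ge_zero[of v] by force
    ultimately show ?thesis using False K by (simp add: s_def)
  qed
  have lim: "(\<lambda>m. s m x) \<longlonglongrightarrow> g x \<bullet> v" for x
  proof -
    have "((\<lambda>t. f (x + t *\<^sub>R v)) has_derivative (\<lambda>t. g x \<bullet> (t *\<^sub>R v))) (at 0)"
      by (rule has_derivative_compose[where g=f and f="\<lambda>t. x + t *\<^sub>R v"])
        (use f in \<open>auto simp: C1_on_def intro!: derivative_eq_intros\<close>)
    then have "((\<lambda>t. f (x + t *\<^sub>R v)) has_real_derivative g x \<bullet> v) (at 0)"
      by (simp add: has_field_derivative_def mult.commute[of _ "g x \<bullet> v"])
    then have "((\<lambda>h. (f (x + h *\<^sub>R v) - f x) / h) \<longlongrightarrow> g x \<bullet> v) (at 0)"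
      by (simp add: DERIV_def)
    then have "(\<lambda>m. (f (x + inverse (real (Suc m)) *\<^sub>R v) - f x) / inverse (real (Suc m))) \<longlonglongrightarrow> g x \<bullet> v"
      by (rule filterlim_compose)
        (use LIMSEQ_inverse_real_of_nat in \<open>auto simp: filterlim_at simp del: of_nat_Suc\<close>)
    then show ?thesis unfolding s_def by (simp add: divide_inverse)
  qed
  have "(\<lambda>m. \<integral>x. s m x \<partial>lborel) \<longlonglongrightarrow> (\<integral>x. g x \<bullet> v \<partial>lborel)"
  proof (rule integral_dominated_convergence[where w="\<lambda>x. indicator (cball 0 (M + norm v)) x * (B * norm v)"])
    show "(\<lambda>x. g x \<bullet> v) \<in> borel_measurable lborel"
      using f by (auto simp: C1_on_def intro!: borel_measurable_continuous_onI continuous_intros)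
    show "integrable lborel (\<lambda>x::'a. indicator (cball 0 (M + norm v)) x * (B * norm v))"
      using borel_integrable_compact[OF compact_cball continuous_on_const, of 0 "M + norm v" "B * norm v"]
      by simp
  qed (use lim bnd int in auto)
  then show ?thesis unfolding int0 by (simp add: LIMSEQ_const_iff)
qed

text \<open>
  The divergence theorem for the field $f(x)\,x$: apply the previous lemma to $(x \cdot b)\,f$ for every basis vector $b$.
\<close>
lemma integral_radial_derivative:
  fixes f :: "'a::euclidean_space \<Rightarrow> real"
  assumes U: "open U" and f: "C1c_on U f g"
  shows "(\<integral>x. g x \<bullet> x + DIM('a) * f x \<partial>lborel) = 0"
proof -
  have c: "continuous_on U f" "continuous_on U g"
    using C1c_on_C1[OF f] C1_on_continuous C1_on_continuous_grad by blast+
  have *: "(\<integral>x. (x \<bullet> b) * (g x \<bullet> b) + f x \<partial>lborel) = 0" if "b \<in> Basis" for b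
    using integral_directional_derivative_zero[OF C1c_on_mult[OF U f C1_on_inner[of _ b]], of b] that
    by (simp add: inner_add_left)
  have int: "integrable lborel (\<lambda>x. (x \<bullet> b) * (g x \<bullet> b) + f x)" for b
    by (rule integrable_C1c_on[OF f]) (auto intro!: continuous_intros c)
  have "0 = (\<Sum>b\<in>Basis. \<integral>x. (x \<bullet> b) * (g x \<bullet> b) + f x \<partial>lborel)" using * by simp
  also have "\<dots> = (\<integral>x. (\<Sum>b\<in>Basis. (x \<bullet> b) * (g x \<bullet> b) + f x) \<partial>lborel)"
    using int by (simp add: Bochner_Integration.integral_sum)
  also have "\<dots> = (\<integral>x. g x \<bullet> x + DIM('a) * f x \<partial>lborel)"
  proof (rule Bochner_Integration.integral_cong[OF refl])
    fix x
    have "g x \<bullet> x = (\<Sum>b\<in>Basis. (g x \<bullet> b) * (x \<bullet> b))" by (rule euclidean_inner)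
    then show "(\<Sum>b\<in>Basis. (x \<bullet> b) * (g x \<bullet> b) + f x) = g x \<bullet> x + DIM('a) * f x"
      by (simp add: sum.distrib mult.commute)
  qed
  finally show ?thesis by simp
qed

section \<open>A Loomis--Whitney inequality\<close>

text \<open>
  Hoelder's inequality for \<open>card S\<close> factors with equal exponents, stated with integer powers: the
  function \<open>h\<close> plays the role of the geometric mean of the \<open>c i\<close>, so no roots of extended reals are needed.
\<close>
lemma nn_integral_power_le_prod:
  fixes h :: "'a \<Rightarrow> ennreal" and c :: "'i \<Rightarrow> 'a \<Rightarrow> ennreal"
  assumes S: "finite S" "S \<noteq> {}"
    and h[measurable]: "h \<in> borel_measurable M"
    and c[measurable]: "\<And>i. i \<in> S \<Longrightarrow> c i \<in> borel_measurable M"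
    and le: "\<And>x. x \<in> space M \<Longrightarrow> h x ^ card S \<le> (\<Prod>i\<in>S. c i x)"
  shows "(\<integral>\<^sup>+x. h x \<partial>M) ^ card S \<le> (\<Prod>i\<in>S. \<integral>\<^sup>+x. c i x \<partial>M)"
proof -
  define N where "N = card S"
  have N: "N > 0" using S by (auto simp: N_def card_gt_0_iff)
  consider (zero) i where "i \<in> S" "(\<integral>\<^sup>+x. c i x \<partial>M) = 0"
    | (top) i where "i \<in> S" "(\<integral>\<^sup>+x. c i x \<partial>M) = top" "\<And>j. j \<in> S \<Longrightarrow> (\<integral>\<^sup>+x. c j x \<partial>M) \<noteq> 0"
    | (fin) "\<And>j. j \<in> S \<Longrightarrow> (\<integral>\<^sup>+x. c j x \<partial>M) \<noteq> 0 \<and> (\<integral>\<^sup>+x. c j x \<partial>M) \<noteq> top"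
    by blast
  then show ?thesis
  proof cases
    case zero
    then have "AE x in M. c i x = 0" by (subst (asm) nn_integral_0_iff_AE) auto
    then have "AE x in M. h x = 0"
    proof (rule AE_mp, intro AE_I2 impI)
      fix x assume x: "x \<in> space M" and "c i x = 0"
      then have "(\<Prod>i\<in>S. c i x) = 0" using zero S by (intro prod_zero) auto
      then have "h x ^ N = 0" using le[OF x] unfolding N_def by (metis le_zero_eq)
      then show "h x = 0" using N by simp
    qed
    then have "(\<integral>\<^sup>+x. h x \<partial>M) = 0" by (subst nn_integral_0_iff_AE) auto
    then have "(\<integral>\<^sup>+x. h x \<partial>M) ^ N = 0" using N by simp
    then show ?thesis unfolding N_def by (metis zero_le)
  next
    case top
    have "(\<Prod>i\<in>S. \<integral>\<^sup>+x. c i x \<partial>M) = (\<integral>\<^sup>+x. c i x \<partial>M) * (\<Prod>i\<in>S - {i}. \<integral>\<^sup>+x. c i x \<partial>M)"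
      using S(1) top(1) by (rule prod.remove)
    also have "\<dots> = top"
    proof -
      have "(\<Prod>i\<in>S - {i}. \<integral>\<^sup>+x. c i x \<partial>M) \<noteq> 0"
        using top(3) by (simp add: S(1))
      then show ?thesis using top(2) by (simp add: ennreal_top_mult)
    qed
    finally show ?thesis by simp
  next
    case fin
    define C where "C i = enn2real (\<integral>\<^sup>+x. c i x \<partial>M)" for i
    have C: "(\<integral>\<^sup>+x. c i x \<partial>M) = ennreal (C i)" "C i > 0" if "i \<in> S" for i
      using fin[OF that] by (auto simp: C_def enn2real_positive_iff less_top zero_less_iff_neq_zero)
    (* B is the geometric mean of the integrals. Once each c i is divided by its integral, the inequality of
       arithmetic and geometric means bounds h / B by an average of integral one. *)
    define B where "B = (\<Prod>i\<in>S. C i) powr (1 / N)"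
    have prodC: "(\<Prod>i\<in>S. C i) > 0" using C by (intro prod_pos) auto
    then have B: "B > 0" by (simp add: B_def)
    have pw: "h x \<le> (\<Sum>i\<in>S. ennreal (B / (N * C i)) * c i x)" if x: "x \<in> space M" for x
    proof (cases "\<exists>i\<in>S. c i x = top")
      case True
      then obtain i where i: "i \<in> S" "c i x = top" by blast
      have "(\<Sum>i\<in>S. ennreal (B / (N * C i)) * c i x) = top"
        using S i B C(2)[OF i(1)] N by (subst sum.remove[of S i]) (auto simp: ennreal_mult_top)
      then show ?thesis by simp
    next
      case False
      define r where "r i = enn2real (c i x)" for i
      have r: "c i x = ennreal (r i)" "r i \<ge> 0" if "i \<in> S" for i
        using False that by (auto simp: r_def less_top)
      have le': "h x ^ N \<le> ennreal (\<Prod>i\<in>S. r i)"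
        using le[OF x] r by (simp add: N_def prod_ennreal)
      then have "h x ^ N < top" by (rule order.strict_trans1) simp
      then have "h x < top" using N by (auto simp: power_less_top_ennreal)
      then obtain s where s: "h x = ennreal s" "s \<ge> 0" by (metis ennreal_cases less_irrefl infinity_ennreal_def)
      have "s ^ N \<le> (\<Prod>i\<in>S. r i)"
        using le' s r by (simp add: ennreal_power prod_nonneg)
      then have "(s ^ N) powr (1 / N) \<le> (\<Prod>i\<in>S. r i) powr (1 / N)"
        using s by (intro powr_mono2) auto
      moreover have "(s ^ N) powr (1 / N) = s"
      proof (cases "s = 0")
        case False
        then show ?thesis using s N by (simp add: powr_realpow[symmetric] powr_powr)
      qed (use N in simp)
      ultimately have "s \<le> (\<Prod>i\<in>S. r i) powr (1 / N)" by simp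
      also have "(\<Prod>i\<in>S. r i) = (\<Prod>i\<in>S. C i) * (\<Prod>i\<in>S. r i / C i)"
        using C(2) by (simp add: prod.distrib[symmetric] less_imp_neq[symmetric] cong: prod.cong)
      also have "\<dots> powr (1 / N) = B * (\<Prod>i\<in>S. r i / C i) powr (1 / N)"
        using prodC r C(2) by (subst powr_mult) (auto simp: B_def intro!: prod_nonneg divide_nonneg_pos)
      also have "\<dots> \<le> B * (\<Sum>i\<in>S. (r i / C i) / N)"
        using arith_geom_mean[OF S, of "\<lambda>i. r i / C i"] r C(2) B
        by (intro mult_left_mono) (auto simp: N_def less_imp_le)
      also have "\<dots> = (\<Sum>i\<in>S. B / (N * C i) * r i)" by (simp add: sum_distrib_left mult.commute)
      finally have "ennreal s \<le> ennreal (\<Sum>i\<in>S. B / (N * C i) * r i)" by (rule ennreal_leI)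
      also have "\<dots> = (\<Sum>i\<in>S. ennreal (B / (N * C i) * r i))"
        using B C(2) r N by (subst sum_ennreal) (auto intro!: mult_nonneg_nonneg divide_nonneg_pos simp: less_imp_le)
      also have "\<dots> = (\<Sum>i\<in>S. ennreal (B / (N * C i)) * c i x)"
      proof (intro sum.cong refl)
        fix i assume i: "i \<in> S"
        have "0 \<le> B / (N * C i)" using B C(2)[OF i] by simp
        then show "ennreal (B / (N * C i) * r i) = ennreal (B / (N * C i)) * c i x"
          using r[OF i] ennreal_mult[of "B / (N * C i)" "r i"] by simp
      qed
      finally show ?thesis using s by simp
    qed
    have "(\<integral>\<^sup>+x. h x \<partial>M) \<le> (\<integral>\<^sup>+x. (\<Sum>i\<in>S. ennreal (B / (N * C i)) * c i x) \<partial>M)"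
      by (rule nn_integral_mono) (rule pw)
    also have "\<dots> = (\<Sum>i\<in>S. ennreal (B / (N * C i)) * (\<integral>\<^sup>+x. c i x \<partial>M))"
      by (subst nn_integral_sum) (auto simp: nn_integral_cmult)
    also have "\<dots> = (\<Sum>i\<in>S. ennreal (B / N))"
    proof (intro sum.cong refl)
      fix i assume i: "i \<in> S"
      show "ennreal (B / (N * C i)) * (\<integral>\<^sup>+x. c i x \<partial>M) = ennreal (B / N)"
        using C[OF i] B N by (simp add: ennreal_mult[symmetric])
    qed
    also have "\<dots> = ennreal B"
      using N B by (subst sum_ennreal) (auto simp: N_def)
    finally have "(\<integral>\<^sup>+x. h x \<partial>M) ^ N \<le> ennreal B ^ N" by (rule power_mono) simp
    also have "\<dots> = ennreal (\<Prod>i\<in>S. C i)"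
    proof -
      have "B ^ N = (\<Prod>i\<in>S. C i)"
        unfolding B_def using prodC N by (simp add: powr_realpow[symmetric] powr_powr)
      then show ?thesis using B by (simp add: ennreal_power)
    qed
    also have "\<dots> = (\<Prod>i\<in>S. \<integral>\<^sup>+x. c i x \<partial>M)"
      using C by (subst prod_ennreal[symmetric]) (auto simp: less_imp_le)
    finally show ?thesis by (simp add: N_def)
  qed
qed

text \<open>
  A constant factor can be absorbed into one of the \<open>c i\<close>, even when it is infinite.
\<close>
lemma nn_integral_power_le_const_prod:
  fixes h :: "'a \<Rightarrow> ennreal" and c :: "'i \<Rightarrow> 'a \<Rightarrow> ennreal"
  assumes S: "finite S" "S \<noteq> {}"
    and h[measurable]: "h \<in> borel_measurable M"
    and c[measurable]: "\<And>i. i \<in> S \<Longrightarrow> c i \<in> borel_measurable M"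
    and le: "\<And>x. x \<in> space M \<Longrightarrow> h x ^ card S \<le> a * (\<Prod>i\<in>S. c i x)"
  shows "(\<integral>\<^sup>+x. h x \<partial>M) ^ card S \<le> a * (\<Prod>i\<in>S. \<integral>\<^sup>+x. c i x \<partial>M)"
proof -
  obtain j where j: "j \<in> S" using S by blast
  define c' where "c' i x = (if i = j then a * c i x else c i x)" for i x
  have m: "c' i \<in> borel_measurable M" if "i \<in> S" for i
    using c[OF that] unfolding c'_def by (cases "i = j") auto
  have "(\<integral>\<^sup>+x. h x \<partial>M) ^ card S \<le> (\<Prod>i\<in>S. \<integral>\<^sup>+x. c' i x \<partial>M)"
  proof (rule nn_integral_power_le_prod[OF S h m])
    fix x assume "x \<in> space M"
    have "(\<Prod>i\<in>S. c' i x) = a * (\<Prod>i\<in>S. c i x)"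
      using S j by (simp add: prod.remove[of S j] c'_def mult.assoc)
    then show "h x ^ card S \<le> (\<Prod>i\<in>S. c' i x)" using le \<open>x \<in> space M\<close> by simp
  qed
  also have "(\<Prod>i\<in>S. \<integral>\<^sup>+x. c' i x \<partial>M) = a * (\<Prod>i\<in>S. \<integral>\<^sup>+x. c i x \<partial>M)"
    using S j c[OF j] by (simp add: prod.remove[of S j] c'_def mult.assoc nn_integral_cmult)
  finally show ?thesis .
qed

text \<open>
  For \<open>K = {}\<close> this is the Loomis--Whitney inequality: each \<open>g i\<close> is integrated over all coordinates but the
  one it does not depend on. The induction integrates one coordinate after the other; \<open>K\<close> collects the factors
  whose free coordinate lies outside \<open>J\<close>, which are integrated over all of \<open>J\<close>.
\<close>
lemma (in product_sigma_finite) loomis_whitney: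
  fixes h :: "('i \<Rightarrow> 'a) \<Rightarrow> ennreal" and g :: "'i \<Rightarrow> ('i \<Rightarrow> 'a) \<Rightarrow> ennreal"
  assumes "finite J" "finite K" "J \<inter> K = {}" "card (J \<union> K) = Suc N" "N > 0"
    and "h \<in> borel_measurable (Pi\<^sub>M J M)"
    and "\<And>i. i \<in> J \<union> K \<Longrightarrow> g i \<in> borel_measurable (Pi\<^sub>M J M)"
    and "\<And>i x y. i \<in> J \<Longrightarrow> g i (x(i := y)) = g i x"
    and "\<And>i. i \<in> J \<Longrightarrow> space (M i) \<noteq> {}"
    and "\<And>x. x \<in> space (Pi\<^sub>M J M) \<Longrightarrow> h x ^ N \<le> (\<Prod>i\<in>J \<union> K. g i x)"
  shows "(\<integral>\<^sup>+x. h x \<partial>Pi\<^sub>M J M) ^ N \<le>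
     (\<Prod>i\<in>K. \<integral>\<^sup>+x. g i x \<partial>Pi\<^sub>M J M) * (\<Prod>i\<in>J. \<integral>\<^sup>+x. g i x \<partial>Pi\<^sub>M (J - {i}) M)"
  using assms
proof (induction J arbitrary: K g h rule: finite_induct)
  case empty
  then show ?case by (simp add: nn_integral_empty space_PiM)
next
  case (insert j J)
  note hm[measurable] = insert.prems(5)
  have gm: "g i \<in> borel_measurable (Pi\<^sub>M (insert j J) M)" if "i \<in> insert j J \<union> K" for i
    using insert.prems(6) that by blast
  have indep: "g i (x(i := y)) = g i x" if "i \<in> insert j J" for i x y
    using insert.prems(7) that by blast
  have upd: "(\<lambda>x. x(j := y)) \<in> measurable (Pi\<^sub>M I M) (Pi\<^sub>M (insert j I) M)"
    if "y \<in> space (M j)" for I y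
    by (rule measurable_fun_upd[of _ I]) (use that in auto)
  (* With the coordinate j frozen at y, the function g j does not depend on y, so j moves from J to K. *)
  have step: "(\<integral>\<^sup>+x. h (x(j := y)) \<partial>Pi\<^sub>M J M) ^ N \<le>
     (\<integral>\<^sup>+x. g j x \<partial>Pi\<^sub>M J M) * ((\<Prod>i\<in>K. \<integral>\<^sup>+x. g i (x(j := y)) \<partial>Pi\<^sub>M J M) *
     (\<Prod>i\<in>J. \<integral>\<^sup>+x. g i (x(j := y)) \<partial>Pi\<^sub>M (J - {i}) M))" if y: "y \<in> space (M j)" for y
  proof -
    have "(\<integral>\<^sup>+x. h (x(j := y)) \<partial>Pi\<^sub>M J M) ^ N \<le>
     (\<Prod>i\<in>insert j K. \<integral>\<^sup>+x. g i (x(j := y)) \<partial>Pi\<^sub>M J M) *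
     (\<Prod>i\<in>J. \<integral>\<^sup>+x. g i (x(j := y)) \<partial>Pi\<^sub>M (J - {i}) M)"
    proof (rule insert.IH)
      show "finite (insert j K)" "J \<inter> insert j K = {}" "card (J \<union> insert j K) = Suc N" "N > 0"
        using insert by auto
      show "(\<lambda>x. h (x(j := y))) \<in> borel_measurable (Pi\<^sub>M J M)"
        by (rule measurable_compose[OF upd[OF y] hm])
      show "(\<lambda>x. g i (x(j := y))) \<in> borel_measurable (Pi\<^sub>M J M)" if "i \<in> J \<union> insert j K" for i
        by (rule measurable_compose[OF upd[OF y] gm]) (use that in auto)
      show "g i (x(i := z, j := y)) = g i (x(j := y))" if "i \<in> J" for i x z
      proof -
        have "i \<noteq> j" using that insert.hyps by auto
        then show ?thesis using indep[of i "x(j := y)" z] that by (simp add: fun_upd_twist)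
      qed
      show "space (M i) \<noteq> {}" if "i \<in> J" for i using insert.prems(8) that by blast
      show "h (x(j := y)) ^ N \<le> (\<Prod>i\<in>J \<union> insert j K. g i (x(j := y)))" if "x \<in> space (Pi\<^sub>M J M)" for x
      proof -
        have "x(j := y) \<in> space (Pi\<^sub>M (insert j J) M)"
          by (rule measurable_space[OF upd[OF y] that])
        moreover have "J \<union> insert j K = insert j J \<union> K" by auto
        ultimately show ?thesis using insert.prems(9) by metis
      qed
    qed
    also have "(\<integral>\<^sup>+x. g j (x(j := y)) \<partial>Pi\<^sub>M J M) = (\<integral>\<^sup>+x. g j x \<partial>Pi\<^sub>M J M)"
      using indep by simp
    then have "(\<Prod>i\<in>insert j K. \<integral>\<^sup>+x. g i (x(j := y)) \<partial>Pi\<^sub>M J M) =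
        (\<integral>\<^sup>+x. g j x \<partial>Pi\<^sub>M J M) * (\<Prod>i\<in>K. \<integral>\<^sup>+x. g i (x(j := y)) \<partial>Pi\<^sub>M J M)"
      using insert.prems(1,2) by (subst prod.insert) auto
    finally show ?thesis by (simp add: mult.assoc fun_upd_def)
  qed
  define c where "c i y = (if i \<in> J then \<integral>\<^sup>+x. g i (x(j := y)) \<partial>Pi\<^sub>M (J - {i}) M
     else \<integral>\<^sup>+x. g i (x(j := y)) \<partial>Pi\<^sub>M J M)" for i y
  have split: "(\<Prod>i\<in>J \<union> K. F i) = (\<Prod>i\<in>K. F i) * (\<Prod>i\<in>J. F i)" for F :: "'i \<Rightarrow> ennreal"
    using insert by (subst prod.union_disjoint) (auto simp: mult.commute)
  have cprod: "(\<Prod>i\<in>J \<union> K. c i y) = (\<Prod>i\<in>K. \<integral>\<^sup>+x. g i (x(j := y)) \<partial>Pi\<^sub>M J M) *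
     (\<Prod>i\<in>J. \<integral>\<^sup>+x. g i (x(j := y)) \<partial>Pi\<^sub>M (J - {i}) M)" for y
    unfolding split c_def using insert.prems(2)
    by (intro arg_cong2[where f="(*)"] prod.cong refl) auto
  have gm': "g i \<in> borel_measurable (Pi\<^sub>M (insert j (J - {i})) M)" if "i \<in> J" for i
  proof -
    have "space (M i) \<noteq> {}" using insert.prems(8)[of i] that by simp
    then obtain z where z: "z \<in> space (M i)" by (meson ex_in_conv)
    have "(\<lambda>x. x(i := z)) \<in> measurable (Pi\<^sub>M (insert j (J - {i})) M) (Pi\<^sub>M (insert j J) M)"
    proof (rule measurable_fun_upd[of _ "insert j (J - {i})"])
      show "insert j J = insert j (J - {i}) \<union> {i}" using that by blast
    qed (simp_all add: z)
    from measurable_compose[OF this gm[of i]] show ?thesis using that indep by simp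
  qed
  have joint: "(\<lambda>y. \<integral>\<^sup>+x. F (x(j := y)) \<partial>Pi\<^sub>M I M) \<in> borel_measurable (M j)"
    if F: "F \<in> borel_measurable (Pi\<^sub>M (insert j I) M)" and I: "finite I" for F :: "_ \<Rightarrow> ennreal" and I
  proof -
    interpret I: finite_product_sigma_finite M I by standard (rule I)
    have "(\<lambda>(y, x). F (x(j := y))) \<in> borel_measurable (M j \<Otimes>\<^sub>M Pi\<^sub>M I M)"
    proof -
      have "(\<lambda>z. (snd z)(j := fst z)) \<in> measurable (M j \<Otimes>\<^sub>M Pi\<^sub>M I M) (Pi\<^sub>M (insert j I) M)"
        by (rule measurable_fun_upd[of _ I]) auto
      from measurable_compose[OF this F] show ?thesis by (simp add: case_prod_unfold)
    qed
    then show ?thesis by (rule I.borel_measurable_nn_integral)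
  qed
  have cm: "c i \<in> borel_measurable (M j)" if "i \<in> J \<union> K" for i
  proof (cases "i \<in> J")
    case True
    then show ?thesis using joint[OF gm'[OF True]] insert.hyps(1) by (simp add: c_def[abs_def])
  next
    case False
    then show ?thesis using joint[OF gm[of i]] that insert.hyps(1) by (simp add: c_def[abs_def])
  qed
  have card: "card (J \<union> K) = N"
  proof -
    have "card (insert j (J \<union> K)) = Suc (card (J \<union> K))"
      using insert by (intro card_insert_disjoint) auto
    then show ?thesis using insert.prems(3) by simp
  qed
  have "(\<integral>\<^sup>+x. h x \<partial>Pi\<^sub>M (insert j J) M) ^ N = (\<integral>\<^sup>+y. \<integral>\<^sup>+x. h (x(j := y)) \<partial>Pi\<^sub>M J M \<partial>M j) ^ card (J \<union> K)"
    using insert.hyps card by (subst product_nn_integral_insert_rev) auto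
  also have "\<dots> \<le> (\<integral>\<^sup>+x. g j x \<partial>Pi\<^sub>M J M) * (\<Prod>i\<in>J \<union> K. \<integral>\<^sup>+y. c i y \<partial>M j)"
  proof (rule nn_integral_power_le_const_prod)
    show "finite (J \<union> K)" using insert by simp
    show "J \<union> K \<noteq> {}" using card insert.prems(4) by auto
    show "(\<lambda>y. \<integral>\<^sup>+x. h (x(j := y)) \<partial>Pi\<^sub>M J M) \<in> borel_measurable (M j)"
      by (rule joint[OF hm insert.hyps(1)])
  qed (use cm step in \<open>auto simp: card cprod\<close>)
  also have "(\<Prod>i\<in>J \<union> K. \<integral>\<^sup>+y. c i y \<partial>M j) = (\<Prod>i\<in>K. \<integral>\<^sup>+x. g i x \<partial>Pi\<^sub>M (insert j J) M) *
      (\<Prod>i\<in>J. \<integral>\<^sup>+x. g i x \<partial>Pi\<^sub>M (insert j J - {i}) M)"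
    unfolding split
  proof (intro arg_cong2[where f="(*)"] prod.cong refl)
    fix i assume i: "i \<in> K"
    then show "(\<integral>\<^sup>+y. c i y \<partial>M j) = (\<integral>\<^sup>+x. g i x \<partial>Pi\<^sub>M (insert j J) M)"
      using insert.hyps insert.prems(2) gm[of i]
      by (subst product_nn_integral_insert_rev) (auto simp: c_def intro!: nn_integral_cong)
  next
    fix i assume i: "i \<in> J"
    then have eq: "insert j J - {i} = insert j (J - {i})" using insert.hyps by auto
    show "(\<integral>\<^sup>+y. c i y \<partial>M j) = (\<integral>\<^sup>+x. g i x \<partial>Pi\<^sub>M (insert j J - {i}) M)"
      unfolding eq by (subst product_nn_integral_insert_rev[OF _ _ gm'[OF i]])
        (use insert.hyps i in \<open>simp_all add: c_def[abs_def]\<close>)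
  qed
  also have "(\<integral>\<^sup>+x. g j x \<partial>Pi\<^sub>M J M) = (\<integral>\<^sup>+x. g j x \<partial>Pi\<^sub>M (insert j J - {j}) M)"
    using insert.hyps by simp
  finally show ?case
    using insert.hyps by (simp add: mult_ac)
qed

section \<open>The Sobolev inequality\<close>

text \<open>
  The parameter \<open>s\<close> is the coordinate of \<open>x\<close> in the direction \<open>v\<close>, so that the integral runs over the whole line through
  \<open>x\<close> and has a value that does not depend on that coordinate.
\<close>
lemma abs_le_nn_integral_partial:
  fixes f :: "'a::euclidean_space \<Rightarrow> real"
  assumes f: "C1c_on U f g" and v: "norm v = 1"
  shows "ennreal \<bar>f x\<bar> \<le> (\<integral>\<^sup>+t. ennreal \<bar>g (x + (t - s) *\<^sub>R v) \<bullet> v\<bar> \<partial>lborel)"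
proof -
  obtain K where K: "compact K" "\<And>x. x \<notin> K \<Longrightarrow> f x = 0"
    using f unfolding C1c_on_def by blast
  obtain M where M: "\<And>x. x \<in> K \<Longrightarrow> norm x \<le> M" using compact_imp_bounded[OF K(1)] bounded_iff by blast
  define T where "T = \<bar>M\<bar> + norm x + 1"
  have f1: "C1_on UNIV f g" by (rule C1c_on_C1[OF f])
  have gc: "continuous_on UNIV g" by (rule C1_on_continuous_grad[OF f1])
  have cont: "continuous_on A (\<lambda>t. g (x + (t - s) *\<^sub>R v) \<bullet> v)" for A
    by (intro continuous_intros continuous_on_compose2[OF gc]) auto
  have T0: "f (x + (s - T - s) *\<^sub>R v) = 0"
  proof (rule K(2))
    have "norm (T *\<^sub>R v) \<le> norm (x + (s - T - s) *\<^sub>R v) + norm x"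
      using norm_triangle_ineq4[of x "x + (s - T - s) *\<^sub>R v"] by (simp add: add.commute)
    moreover have "T \<ge> 0" unfolding T_def by (smt (verit) abs_ge_zero norm_ge_zero)
    ultimately have "T \<le> norm (x + (s - T - s) *\<^sub>R v) + norm x" using v by simp
    then have "M < norm (x + (s - T - s) *\<^sub>R v)" unfolding T_def by linarith
    then show "x + (s - T - s) *\<^sub>R v \<notin> K" using M by force
  qed
  have T_nonneg: "T \<ge> 0" unfolding T_def by (intro add_nonneg_nonneg) auto
  have "(\<integral>t. indicator {s - T .. s} t *\<^sub>R (g (x + (t - s) *\<^sub>R v) \<bullet> v) \<partial>lborel)
     = f (x + (s - s) *\<^sub>R v) - f (x + (s - T - s) *\<^sub>R v)"
  proof (rule integral_FTC_atLeastAtMost)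
    show "s - T \<le> s" using T_nonneg by simp
    fix t
    have "((\<lambda>t. f (x + (t - s) *\<^sub>R v)) has_derivative (\<lambda>h. g (x + (t - s) *\<^sub>R v) \<bullet> (h *\<^sub>R v))) (at t)"
      by (rule has_derivative_compose[where g=f and f="\<lambda>t. x + (t - s) *\<^sub>R v"])
        (use f1 in \<open>auto simp: C1_on_def intro!: derivative_eq_intros\<close>)
    then show "((\<lambda>t. f (x + (t - s) *\<^sub>R v)) has_vector_derivative g (x + (t - s) *\<^sub>R v) \<bullet> v) (at t within {s - T .. s})"
      by (simp add: has_vector_derivative_def has_derivative_at_withinI)
  qed (rule cont)
  then have "f x = (\<integral>t. indicator {s - T .. s} t *\<^sub>R (g (x + (t - s) *\<^sub>R v) \<bullet> v) \<partial>lborel)"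
    using T0 by simp
  also have "ennreal \<bar>\<dots>\<bar> \<le> (\<integral>\<^sup>+t. ennreal (norm (indicator {s - T .. s} t *\<^sub>R (g (x + (t - s) *\<^sub>R v) \<bullet> v))) \<partial>lborel)"
    using integral_norm_bound_ennreal[OF borel_integrable_compact[OF compact_Icc cont]] by simp
  also have "\<dots> \<le> (\<integral>\<^sup>+t. ennreal \<bar>g (x + (t - s) *\<^sub>R v) \<bullet> v\<bar> \<partial>lborel)"
    by (rule nn_integral_mono) (auto simp: indicator_def intro!: ennreal_leI)
  finally show ?thesis .
qed



text \<open>
  Each $|f|$ is bounded by the integral of $|\partial_b f|$ along a line, which does not depend on the coordinate $b$; the
  Loomis--Whitney inequality multiplies these bounds.
\<close>
lemma gagliardo_nirenberg_L1:
  fixes f :: "'a::euclidean_space \<Rightarrow> real"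
  assumes f: "C1c_on U f g" and N: "DIM('a) = Suc N" "N > 0"
  shows "(\<integral>\<^sup>+x. ennreal (\<bar>f x\<bar> powr (Suc N / N)) \<partial>lborel) ^ N
     \<le> (\<integral>\<^sup>+x. ennreal (norm (g x)) \<partial>lborel) ^ Suc N"
proof -
  interpret product_sigma_finite "\<lambda>_::'a. lborel :: real measure" by standard
  let ?B = "Basis :: 'a set"
  let ?P = "\<lambda>I. Pi\<^sub>M I (\<lambda>_::'a. lborel :: real measure)"
  define \<Phi> :: "('a \<Rightarrow> real) \<Rightarrow> 'a" where "\<Phi> x = (\<Sum>b\<in>?B. x b *\<^sub>R b)" for x
  define h where "h x = ennreal (\<bar>f (\<Phi> x)\<bar> powr (Suc N / N))" for x
  define G where "G b x = (\<integral>\<^sup>+t. ennreal \<bar>g (\<Phi> (x(b := t))) \<bullet> b\<bar> \<partial>lborel)" for b x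
  have f1: "C1_on UNIV f g" by (rule C1c_on_C1[OF f])
  have [measurable]: "f \<in> borel_measurable borel" "g \<in> borel_measurable borel"
    using C1_on_continuous[OF f1] C1_on_continuous_grad[OF f1] by (auto intro: borel_measurable_continuous_onI)
  have \<Phi>m[measurable]: "\<Phi> \<in> borel_measurable (?P ?B)" unfolding \<Phi>_def by measurable
  have upd: "\<Phi> (x(b := t)) = \<Phi> x + (t - x b) *\<^sub>R b" if "b \<in> ?B" for x b t
  proof -
    have "\<Phi> (x(b := t)) = t *\<^sub>R b + (\<Sum>i\<in>?B - {b}. x i *\<^sub>R i)"
      unfolding \<Phi>_def using that by (subst sum.remove[of _ b]) auto
    moreover have "\<Phi> x = x b *\<^sub>R b + (\<Sum>i\<in>?B - {b}. x i *\<^sub>R i)"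
      unfolding \<Phi>_def using that by (subst sum.remove[of _ b]) auto
    ultimately show ?thesis by (simp add: algebra_simps)
  qed
  have ptw: "ennreal \<bar>f (\<Phi> x)\<bar> \<le> G b x" if "b \<in> ?B" for b x
    using abs_le_nn_integral_partial[OF f, of b "\<Phi> x" "x b"] that by (simp add: G_def upd)
  have fub: "(\<integral>\<^sup>+x. G b x \<partial>?P (?B - {b})) = (\<integral>\<^sup>+x. ennreal \<bar>g x \<bullet> b\<bar> \<partial>lborel)" if b: "b \<in> ?B" for b
  proof -
    have ins: "insert b (?B - {b}) = ?B" using b by auto
    have m: "(\<lambda>x. ennreal \<bar>g (\<Phi> x) \<bullet> b\<bar>) \<in> borel_measurable (?P (insert b (?B - {b})))"
      unfolding ins by measurable
    have "(\<integral>\<^sup>+x. G b x \<partial>?P (?B - {b})) = (\<integral>\<^sup>+x. ennreal \<bar>g (\<Phi> x) \<bullet> b\<bar> \<partial>?P (insert b (?B - {b})))"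
      unfolding G_def by (rule product_nn_integral_insert[OF _ _ m, symmetric]) simp_all
    also have "\<dots> = (\<integral>\<^sup>+x. ennreal \<bar>g x \<bullet> b\<bar> \<partial>lborel)"
      unfolding ins by (subst lborel_eq, subst nn_integral_distr) (simp_all add: \<Phi>_def[symmetric])
    finally show ?thesis .
  qed
  have "(\<integral>\<^sup>+x. h x \<partial>?P ?B) ^ N \<le>
     (\<Prod>i\<in>{}. \<integral>\<^sup>+x. G i x \<partial>?P ?B) * (\<Prod>i\<in>?B. \<integral>\<^sup>+x. G i x \<partial>?P (?B - {i}))"
  proof (rule loomis_whitney)
    show "h \<in> borel_measurable (?P ?B)" unfolding h_def by measurable
    show "G i \<in> borel_measurable (?P ?B)" if "i \<in> ?B \<union> {}" for i
    proof -
      have i: "i \<in> ?B" using that by simp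
      have "(\<lambda>z. \<Phi> ((fst z)(i := snd z))) \<in> borel_measurable (?P ?B \<Otimes>\<^sub>M lborel)"
        unfolding upd[OF i] using i by measurable
      then have "(\<lambda>(x, t). ennreal \<bar>g (\<Phi> (x(i := t))) \<bullet> i\<bar>) \<in> borel_measurable (?P ?B \<Otimes>\<^sub>M lborel)"
        unfolding case_prod_unfold by measurable
      then show ?thesis unfolding G_def by (rule lborel.borel_measurable_nn_integral)
    qed
    show "h x ^ N \<le> (\<Prod>i\<in>?B \<union> {}. G i x)" for x
    proof -
      have "h x ^ N = ennreal ((\<bar>f (\<Phi> x)\<bar> powr (Suc N / N)) ^ N)" unfolding h_def by (simp add: ennreal_power)
      also have "(\<bar>f (\<Phi> x)\<bar> powr (Suc N / N)) ^ N = \<bar>f (\<Phi> x)\<bar> ^ Suc N"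
      proof (cases "f (\<Phi> x) = 0")
        case False
        then have "(\<bar>f (\<Phi> x)\<bar> powr (Suc N / N)) ^ N = \<bar>f (\<Phi> x)\<bar> powr (Suc N / N * N)"
          by (simp add: powr_realpow[symmetric] powr_powr)
        also have "Suc N / N * N = real (Suc N)" using N by simp
        also have "\<bar>f (\<Phi> x)\<bar> powr real (Suc N) = \<bar>f (\<Phi> x)\<bar> ^ Suc N"
          by (rule powr_realpow) (use False in simp)
        finally show ?thesis .
      qed (use N in \<open>simp add: power_0_left\<close>)
      also have "ennreal (\<bar>f (\<Phi> x)\<bar> ^ Suc N) = (\<Prod>i\<in>?B. ennreal \<bar>f (\<Phi> x)\<bar>)"
        unfolding prod_constant N(1) by (simp only: ennreal_power abs_ge_zero)
      also have "\<dots> \<le> (\<Prod>i\<in>?B. G i x)" by (intro prod_mono_ennreal ptw)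
      finally show ?thesis by simp
    qed
  qed (use N in \<open>auto simp: G_def\<close>)
  also have "\<dots> = (\<Prod>i\<in>?B. \<integral>\<^sup>+x. ennreal \<bar>g x \<bullet> i\<bar> \<partial>lborel)" using fub by simp
  also have "\<dots> \<le> (\<Prod>i\<in>?B. \<integral>\<^sup>+x. ennreal (norm (g x)) \<partial>lborel)"
    by (intro prod_mono_ennreal nn_integral_mono ennreal_leI Basis_le_norm)
  also have "\<dots> = (\<integral>\<^sup>+x. ennreal (norm (g x)) \<partial>lborel) ^ Suc N" using N by simp
  also have "(\<integral>\<^sup>+x. h x \<partial>?P ?B) = (\<integral>\<^sup>+x. ennreal (\<bar>f x\<bar> powr (Suc N / N)) \<partial>lborel)"
    unfolding h_def by (subst lborel_eq, subst nn_integral_distr) (simp_all add: \<Phi>_def[symmetric])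
  finally show ?thesis .
qed

text \<open>
  Exponents above $1$ make the power of the absolute value differentiable at zero as well.
\<close>
lemma DERIV_abs_powr:
  fixes a :: real
  assumes "a > 1"
  shows "((\<lambda>t. \<bar>t\<bar> powr a) has_real_derivative a * \<bar>t\<bar> powr (a - 1) * sgn t) (at t)"
proof (cases "t = 0")
  case True
  have "((\<lambda>h. \<bar>h\<bar> powr (a - 1)) \<longlongrightarrow> \<bar>0\<bar> powr (a - 1)) (at (0::real))"
    by (intro tendsto_powr' tendsto_intros) (use assms in auto)
  then have *: "((\<lambda>h. \<bar>h\<bar> powr (a - 1)) \<longlongrightarrow> 0) (at (0::real))" by simp
  have "((\<lambda>h. \<bar>h\<bar> powr a / h) \<longlongrightarrow> 0) (at 0)"
  proof (rule tendsto_rabs_zero_cancel, rule Lim_transform_eventually[OF *])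
    show "\<forall>\<^sub>F h in at 0. \<bar>h\<bar> powr (a - 1) = \<bar>\<bar>h\<bar> powr a / h\<bar>"
      by (auto simp: eventually_at powr_diff intro!: exI[of _ 1])
  qed
  then show ?thesis using True by (simp add: DERIV_def)
next
  case False
  then consider "t > 0" | "t < 0" by linarith
  then show ?thesis
  proof cases
    case 1
    have "((\<lambda>t. t powr a) has_real_derivative a * \<bar>t\<bar> powr (a - 1) * sgn t) (at t)"
      using 1 by (auto intro!: derivative_eq_intros)
    then show ?thesis
      by (rule has_field_derivative_transform_within_open[of _ _ _ "{0<..}"]) (use 1 in auto)
  next
    case 2
    have "((\<lambda>t. (-t) powr a) has_real_derivative a * \<bar>t\<bar> powr (a - 1) * sgn t) (at t)"
      using 2 by (auto intro!: derivative_eq_intros)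
    then show ?thesis
      by (rule has_field_derivative_transform_within_open[of _ _ _ "{..<0}"]) (use 2 in auto)
  qed
qed

lemma continuous_abs_powr_sgn:
  fixes a :: real
  assumes "a > 1"
  shows "continuous_on A (\<lambda>t. a * \<bar>t\<bar> powr (a - 1) * sgn t)"
proof -
  have "isCont (\<lambda>t. a * \<bar>t\<bar> powr (a - 1) * sgn t) t" for t :: real
  proof (cases "t = 0")
    case True
    have "((\<lambda>h. \<bar>h\<bar> powr (a - 1)) \<longlongrightarrow> \<bar>0\<bar> powr (a - 1)) (at (0::real))"
      by (intro tendsto_powr' tendsto_intros) (use assms in auto)
    then have *: "((\<lambda>h. a * \<bar>h\<bar> powr (a - 1)) \<longlongrightarrow> 0) (at (0::real))"
      by (auto intro: tendsto_eq_intros)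
    have "((\<lambda>t. a * \<bar>t\<bar> powr (a - 1) * sgn t) \<longlongrightarrow> 0) (at 0)"
    proof (rule tendsto_rabs_zero_cancel, rule Lim_transform_eventually[OF *])
      show "\<forall>\<^sub>F h in at 0. a * \<bar>h\<bar> powr (a - 1) = \<bar>a * \<bar>h\<bar> powr (a - 1) * sgn h\<bar>"
        using assms by (auto simp: eventually_at abs_mult abs_sgn_eq intro!: exI[of _ 1])
    qed
    then show ?thesis using True by (simp add: isCont_def)
  next
    case False
    then show ?thesis
      unfolding isCont_def by (intro tendsto_intros tendsto_powr) auto
  qed
  then show ?thesis by (auto intro: continuous_at_imp_continuous_on)
qed

lemma C1c_on_abs_powr:
  assumes f: "C1c_on U f g" and U: "open U" and a: "a > 1"
  shows "C1c_on U (\<lambda>x. \<bar>f x\<bar> powr a) (\<lambda>x. (a * \<bar>f x\<bar> powr (a - 1) * sgn (f x)) *\<^sub>R g x)"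
proof -
  obtain K where K: "compact K" "K \<subseteq> U" "\<And>x. x \<notin> K \<Longrightarrow> f x = 0" "\<And>x. x \<notin> K \<Longrightarrow> g x = 0"
    using f unfolding C1c_on_def by blast
  show ?thesis
    by (rule C1c_onI[OF U K(1,2)])
      (auto simp: K intro!: C1_on_comp[OF C1c_on_C1[OF f], where \<Phi>="\<lambda>t. \<bar>t\<bar> powr a" and \<phi>="\<lambda>t. a * \<bar>t\<bar> powr (a - 1) * sgn t"]
        DERIV_abs_powr[OF a] continuous_abs_powr_sgn[OF a])
qed

text \<open>
  Apply the $L^1$ inequality to $|f|^c$ with $c = 2(n-1)/(n-2)$, chosen such that $c\,n/(n-1) = 2n/(n-2) = q$ and
  $c - 1 = q/2$; the Cauchy--Schwarz inequality then separates $\int |f|^q$ from the Dirichlet integral.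
\<close>
theorem sobolev_inequality:
  fixes f :: "'a::euclidean_space \<Rightarrow> real"
  defines "n \<equiv> real DIM('a)"
  assumes f: "C1c_on U f g" and U: "open U" and n: "DIM('a) \<ge> 3"
  shows "(\<integral>x. \<bar>f x\<bar> powr (2 * n / (n - 2)) \<partial>lborel)
    \<le> ((2 * (n - 1) / (n - 2))\<^sup>2 * (\<integral>x. (norm (g x))\<^sup>2 \<partial>lborel)) powr (n / (n - 2))"
proof -
  define N where "N = DIM('a) - 1"
  have N: "DIM('a) = Suc N" "N > 0" using n by (auto simp: N_def)
  have nN: "n = real N + 1" "n \<ge> 3" using N n unfolding n_def by auto
  define c where "c = 2 * (n - 1) / (n - 2)"
  have c: "c > 1" using nN by (simp add: c_def field_simps)
  define q where "q = 2 * n / (n - 2)"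
  have c1: "c - 1 = q / 2" "c * (Suc N / N) = q" "q > 0"
    using nN by (auto simp: c_def q_def field_simps)
  have f1: "C1_on UNIV f g" by (rule C1c_on_C1[OF f])
  have cf: "continuous_on UNIV f" "continuous_on UNIV g"
    using C1_on_continuous[OF f1] C1_on_continuous_grad[OF f1] by auto
  then have [measurable]: "f \<in> borel_measurable borel" "g \<in> borel_measurable borel"
    by (auto intro: borel_measurable_continuous_onI)
  define A where "A = (\<integral>x. \<bar>f x\<bar> powr q \<partial>lborel)"
  define E where "E = (\<integral>x. (norm (g x))\<^sup>2 \<partial>lborel)"
  have AE: "A \<ge> 0" "E \<ge> 0" by (auto simp: A_def E_def)
  have "q > 1" using nN by (simp add: q_def field_simps)
  have intA: "integrable lborel (\<lambda>x. \<bar>f x\<bar> powr q)"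
    using C1_on_continuous[OF C1c_on_C1[OF C1c_on_abs_powr[OF f U \<open>q > 1\<close>]]] c1
    by (intro integrable_C1c_on[OF f]) auto
  have intE: "integrable lborel (\<lambda>x. (norm (g x))\<^sup>2)"
    by (rule integrable_C1c_on[OF f])
      (use cf in \<open>auto intro!: continuous_intros intro: continuous_on_subset\<close>)
  have nnA: "(\<integral>\<^sup>+x. ennreal (\<bar>f x\<bar> powr q) \<partial>lborel) = ennreal A"
    unfolding A_def by (rule nn_integral_eq_integral[OF intA]) auto
  have nnE: "(\<integral>\<^sup>+x. ennreal ((norm (g x))\<^sup>2) \<partial>lborel) = ennreal E"
    unfolding E_def by (rule nn_integral_eq_integral[OF intE]) auto
  have "(\<integral>\<^sup>+x. ennreal (\<bar>\<bar>f x\<bar> powr c\<bar> powr (Suc N / N)) \<partial>lborel) ^ N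
     \<le> (\<integral>\<^sup>+x. ennreal (norm ((c * \<bar>f x\<bar> powr (c - 1) * sgn (f x)) *\<^sub>R g x)) \<partial>lborel) ^ Suc N"
    by (rule gagliardo_nirenberg_L1[OF C1c_on_abs_powr[OF f U c] N])
  also have "(\<lambda>x. ennreal (\<bar>\<bar>f x\<bar> powr c\<bar> powr (Suc N / N))) = (\<lambda>x. ennreal (\<bar>f x\<bar> powr q))"
    using c1 by (simp add: powr_powr del: of_nat_Suc)
  finally have gn: "ennreal A ^ N
     \<le> (\<integral>\<^sup>+x. ennreal (norm ((c * \<bar>f x\<bar> powr (c - 1) * sgn (f x)) *\<^sub>R g x)) \<partial>lborel) ^ Suc N"
    unfolding nnA .
  have "(\<integral>\<^sup>+x. ennreal (norm ((c * \<bar>f x\<bar> powr (c - 1) * sgn (f x)) *\<^sub>R g x)) \<partial>lborel)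
     \<le> (\<integral>\<^sup>+x. ennreal c * (ennreal (\<bar>f x\<bar> powr (q / 2)) * ennreal (norm (g x))) \<partial>lborel)"
  proof (intro nn_integral_mono)
    fix x
    have "norm ((c * \<bar>f x\<bar> powr (c - 1) * sgn (f x)) *\<^sub>R g x) \<le> c * (\<bar>f x\<bar> powr (q / 2) * norm (g x))"
      using c unfolding c1(1) by (simp add: abs_mult abs_sgn_eq)
    also have "ennreal \<dots> = ennreal c * (ennreal (\<bar>f x\<bar> powr (q / 2)) * ennreal (norm (g x)))"
      using c by (simp add: ennreal_mult)
    finally show "ennreal (norm ((c * \<bar>f x\<bar> powr (c - 1) * sgn (f x)) *\<^sub>R g x))
      \<le> ennreal c * (ennreal (\<bar>f x\<bar> powr (q / 2)) * ennreal (norm (g x)))"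
      by (simp add: ennreal_leI)
  qed
  also have "\<dots> = ennreal c * (\<integral>\<^sup>+x. ennreal (\<bar>f x\<bar> powr (q / 2)) * ennreal (norm (g x)) \<partial>lborel)"
    by (rule nn_integral_cmult) measurable
  finally have grad_le: "(\<integral>\<^sup>+x. ennreal (norm ((c * \<bar>f x\<bar> powr (c - 1) * sgn (f x)) *\<^sub>R g x)) \<partial>lborel)
     \<le> ennreal c * (\<integral>\<^sup>+x. ennreal (\<bar>f x\<bar> powr (q / 2)) * ennreal (norm (g x)) \<partial>lborel)" .
  have 1: "ennreal A ^ N \<le> (ennreal c * (\<integral>\<^sup>+x. ennreal (\<bar>f x\<bar> powr (q / 2)) * ennreal (norm (g x)) \<partial>lborel)) ^ Suc N"
    by (rule order_trans[OF gn power_mono[OF grad_le]]) simp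
  have "(\<integral>\<^sup>+x. ennreal (\<bar>f x\<bar> powr (q / 2)) * ennreal (norm (g x)) \<partial>lborel)\<^sup>2
    \<le> (\<integral>\<^sup>+x. (ennreal (\<bar>f x\<bar> powr (q / 2)))\<^sup>2 \<partial>lborel) * (\<integral>\<^sup>+x. (ennreal (norm (g x)))\<^sup>2 \<partial>lborel)"
    by (rule Cauchy_Schwarz_nn_integral) measurable
  also have "(\<lambda>x. (ennreal (\<bar>f x\<bar> powr (q / 2)))\<^sup>2) = (\<lambda>x. ennreal (\<bar>f x\<bar> powr q))"
  proof (rule ext)
    fix x
    have "(\<bar>f x\<bar> powr (q / 2))\<^sup>2 = \<bar>f x\<bar> powr q"
      by (simp add: power2_eq_square powr_add[symmetric])
    then show "(ennreal (\<bar>f x\<bar> powr (q / 2)))\<^sup>2 = ennreal (\<bar>f x\<bar> powr q)"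
      by (simp add: ennreal_power)
  qed
  also have "(\<lambda>x. (ennreal (norm (g x)))\<^sup>2) = (\<lambda>x. ennreal ((norm (g x))\<^sup>2))"
    by (simp add: ennreal_power)
  finally have 2: "(\<integral>\<^sup>+x. ennreal (\<bar>f x\<bar> powr (q / 2)) * ennreal (norm (g x)) \<partial>lborel)\<^sup>2 \<le> ennreal (A * E)"
    unfolding nnA nnE using AE by (simp add: ennreal_mult)
  obtain Z where Z: "(\<integral>\<^sup>+x. ennreal (\<bar>f x\<bar> powr (q / 2)) * ennreal (norm (g x)) \<partial>lborel) = ennreal Z" "Z \<ge> 0"
  proof (cases "(\<integral>\<^sup>+x. ennreal (\<bar>f x\<bar> powr (q / 2)) * ennreal (norm (g x)) \<partial>lborel)")
    case top
    then show ?thesis using 2 by (simp add: top_unique)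
  qed (use that in blast)
  have Z2: "Z\<^sup>2 \<le> A * E" using 2 AE unfolding Z(1) by (simp add: ennreal_power Z(2))
  have AN: "A ^ N \<le> (c * Z) ^ Suc N"
    using 1 AE Z(2) c unfolding Z(1) by (simp add: ennreal_power ennreal_mult[symmetric] del: power_Suc)
  have main: "A \<le> (c\<^sup>2 * E) powr (n / (n - 2))"
  proof (cases "A = 0")
    case False
    then have A: "A > 0" using AE by simp
    have "(A ^ N)\<^sup>2 \<le> ((c * Z) ^ Suc N)\<^sup>2" using AN A by (intro power_mono) auto
    also have "\<dots> = (c\<^sup>2 * Z\<^sup>2) ^ Suc N" by (simp only: power_mult_distrib[symmetric] power_mult[symmetric] mult.commute)
    also have "\<dots> \<le> (c\<^sup>2 * (A * E)) ^ Suc N" using Z2 c by (intro power_mono mult_left_mono) auto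
    also have "\<dots> = A ^ Suc N * (c\<^sup>2 * E) ^ Suc N" by (simp only: power_mult_distrib[symmetric] mult_ac)
    finally have "A ^ (N + N) \<le> A ^ Suc N * (c\<^sup>2 * E) ^ Suc N" by (simp add: power2_eq_square power_add)
    moreover have "A ^ (N + N) = A ^ Suc N * A ^ (N - 1)"
      using N(2) by (simp add: power_add[symmetric] del: power_Suc) 
    ultimately have le: "A ^ (N - 1) \<le> (c\<^sup>2 * E) ^ Suc N" using A by simp
    moreover have "A ^ (N - 1) > 0" using A by simp
    ultimately have "(c\<^sup>2 * E) ^ Suc N > 0" by linarith
    then have "c\<^sup>2 * E \<noteq> 0" by force
    then have cE: "c\<^sup>2 * E > 0" using AE by (simp add: less_le)
    have "A powr (n - 2) \<le> (c\<^sup>2 * E) powr n"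
    proof -
      have "A powr (n - 2) = A ^ (N - 1)"
        using powr_realpow[OF A, of "N - 1"] N nN by (simp add: of_nat_diff)
      moreover have "(c\<^sup>2 * E) powr n = (c\<^sup>2 * E) ^ Suc N"
        using powr_realpow[OF cE, of "Suc N"] nN by (simp add: add.commute del: power_Suc)
      ultimately show ?thesis using le by simp
    qed
    then have "(A powr (n - 2)) powr (1 / (n - 2)) \<le> ((c\<^sup>2 * E) powr n) powr (1 / (n - 2))"
      using nN by (intro powr_mono2) auto
    then show ?thesis using nN A by (simp add: powr_powr)
  qed simp
  then show ?thesis unfolding A_def E_def q_def c_def .
qed

section \<open>The ground state of a curved half space\<close>

text \<open>
  The pointwise identity behind the choice $F = d - \frac n4\kappa d^2$, with $D = d(x)$ and $S = |x|^2$. All terms without a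
  factor $D$ other than $N^2/4S$ cancel, which keeps the potential bounded by a multiple of $1/|x|^2$ up to the boundary $d = 0$.
\<close>
lemma ground_state_potential_algebra:
  fixes N k D S F F1 :: real
  assumes F: "F = D - N / 4 * k * D\<^sup>2" "F1 = 1 - N / 2 * k * D" and nz: "F \<noteq> 0" "S \<noteq> 0"
  shows "N\<^sup>2 / 4 / S - N\<^sup>2 / 4 * k * D\<^sup>2 / (F * S) + N * (1 + N / 4) * k\<^sup>2 * D / F =
    - (((- (N / 2) * k) / F - (F1 / F)\<^sup>2) * (1 + 2 * k * D) + N / S + N * k * (F1 / F) - N\<^sup>2 / (2 * S)
      + ((F1 / F)\<^sup>2 * (1 + 2 * k * D) - 2 * (F1 / F) * (N / 2 / S) * (D + k * S / 2) + N\<^sup>2 / 4 / S))"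
proof -
  have 1: "F1 / F * D = 1 - N / 4 * k * D\<^sup>2 / F"
  proof -
    have "F1 * D = F - N / 4 * k * D\<^sup>2" unfolding F by (simp add: algebra_simps power2_eq_square)
    then have "F1 * D / F = (F - N / 4 * k * D\<^sup>2) / F" by simp
    then show ?thesis using nz by (simp add: diff_divide_distrib)
  qed
  have 2: "N / 2 * k * (1 + 2 * k * D - F1) / F = N * (1 + N / 4) * k\<^sup>2 * D / F"
    unfolding F(2) by (simp add: algebra_simps power2_eq_square)
  have "- (((- (N / 2) * k) / F - (F1 / F)\<^sup>2) * (1 + 2 * k * D) + N / S + N * k * (F1 / F) - N\<^sup>2 / (2 * S)
      + ((F1 / F)\<^sup>2 * (1 + 2 * k * D) - 2 * (F1 / F) * (N / 2 / S) * (D + k * S / 2) + N\<^sup>2 / 4 / S))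
    = N\<^sup>2 / 4 / S - N / S + N * (F1 / F * D) / S + N / 2 * k * (1 + 2 * k * D - F1) / F"
    using nz by (simp add: field_simps power2_eq_square)
  also have "\<dots> = N\<^sup>2 / 4 / S - N\<^sup>2 / 4 * k * D\<^sup>2 / (F * S) + N * (1 + N / 4) * k\<^sup>2 * D / F"
    unfolding 1 2 using nz by (simp add: field_simps power2_eq_square)
  finally show ?thesis by simp
qed

text \<open>
  The set where \<open>d\<close> is positive is the complement of a closed ball of radius $1/\kappa$ if $\kappa > 0$, a half space if
  $\kappa = 0$, and a ball of radius $-1/\kappa$ if $\kappa < 0$; the origin lies on its boundary with inner normal \<open>e\<close>. The
  radius bound \<open>D\<close> keeps the curvature small on the scale considered.
\<close>
locale curved_half_space =
  fixes e :: "'a::euclidean_space" and \<kappa> n D :: real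
  assumes norm_e: "norm e = 1" and n_eq: "n = real DIM('a)"
    and D_pos: "D > 0" and D_small: "n * \<bar>\<kappa>\<bar> * D \<le> 1"
begin

definition d :: "'a \<Rightarrow> real" where "d x = x \<bullet> e + \<kappa> / 2 * (x \<bullet> x)"
text \<open>
  The ground state is $F(x)\,|x|^{-n/2}$; \<open>F1\<close> is the derivative of \<open>F\<close> with respect to \<open>d\<close>.
\<close>
definition F :: "'a \<Rightarrow> real" where "F x = d x - n / 4 * \<kappa> * (d x)\<^sup>2"
definition F1 :: "'a \<Rightarrow> real" where "F1 x = 1 - n / 2 * \<kappa> * d x"
definition U :: "'a set" where "U = {x. x \<noteq> 0 \<and> 0 < d x \<and> norm x < D}"
text \<open>
  The logarithmic gradient $\nabla\varphi/\varphi$ of the ground state $\varphi$.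
\<close>
definition drift :: "'a \<Rightarrow> 'a" where
  "drift x = (F1 x / F x) *\<^sub>R (e + \<kappa> *\<^sub>R x) - (n / 2 / (x \<bullet> x)) *\<^sub>R x"
text \<open>
  This is $-\Delta\varphi/\varphi$.
\<close>
definition potential :: "'a \<Rightarrow> real" where
  "potential x = n\<^sup>2 / 4 / (x \<bullet> x) - n\<^sup>2 / 4 * \<kappa> * (d x)\<^sup>2 / (F x * (x \<bullet> x)) + n * (1 + n / 4) * \<kappa>\<^sup>2 * d x / F x"
text \<open>
  With $u = \varphi v$ the integrand is $\varphi^2|\nabla v|^2$.
\<close>
definition energy :: "('a \<Rightarrow> real) \<Rightarrow> ('a \<Rightarrow> 'a) \<Rightarrow> real" where
  "energy u g = (\<integral>x. (norm (g x - u x *\<^sub>R drift x))\<^sup>2 \<partial>lborel)"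

lemma n_ge1: "n \<ge> 1" using DIM_positive[where 'a='a] n_eq by linarith

lemma C1_on_d: "C1_on A d (\<lambda>x. e + \<kappa> *\<^sub>R x)"
proof -
  have "C1_on A (\<lambda>x. x \<bullet> e + \<kappa> / 2 * (x \<bullet> x)) (\<lambda>x. e + ((\<kappa> / 2) *\<^sub>R (2 *\<^sub>R x) + (x \<bullet> x) *\<^sub>R 0))"
    by (intro C1_on_add C1_on_mult C1_on_inner C1_on_sqnorm C1_on_const)
  then show ?thesis by (rule C1_on_cong) (auto simp: d_def)
qed

lemma continuous_on_d: "continuous_on A d"
  by (rule C1_on_continuous[OF C1_on_d])

lemma open_U: "open U"
proof -
  have "U = - {0} \<inter> {x. 0 < d x} \<inter> {x. norm x < D}" by (auto simp: U_def)
  moreover have "open {x. 0 < d x}" "open {x::'a. norm x < D}"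
    by (auto intro!: open_Collect_less continuous_intros continuous_on_d)
  ultimately show ?thesis by auto
qed

lemma U_D:
  assumes "x \<in> U"
  shows "x \<noteq> 0" "0 < d x" "n * \<bar>\<kappa>\<bar> * norm x \<le> 1" "norm x < D"
proof -
  show "x \<noteq> 0" "0 < d x" "norm x < D" using assms by (auto simp: U_def)
  then have "n * \<bar>\<kappa>\<bar> * norm x \<le> n * \<bar>\<kappa>\<bar> * D" using n_ge1 by (intro mult_left_mono) auto
  then show "n * \<bar>\<kappa>\<bar> * norm x \<le> 1" using D_small by simp
qed

text \<open>
  The radius bound makes the curvature correction in \<open>F\<close> a bounded fraction of \<open>d\<close>.
\<close>
lemma d_le: assumes "x \<in> U" shows "d x \<le> 2 * norm x" "n * \<bar>\<kappa>\<bar> * d x \<le> 2"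
proof -
  have r: "norm x > 0" "n * \<bar>\<kappa>\<bar> * norm x \<le> 1" using U_D[OF assms] by auto
  have "1 * (\<bar>\<kappa>\<bar> * norm x) \<le> n * (\<bar>\<kappa>\<bar> * norm x)" by (intro mult_right_mono n_ge1) auto
  then have kr: "\<bar>\<kappa>\<bar> * norm x \<le> 1" using r by (simp add: mult.assoc)
  have "x \<bullet> e \<le> norm x" using norm_cauchy_schwarz[of x e] norm_e by simp
  moreover have "\<kappa> / 2 * (x \<bullet> x) \<le> (\<bar>\<kappa>\<bar> * norm x) / 2 * norm x"
  proof -
    have "\<kappa> * (norm x * norm x) \<le> \<bar>\<kappa>\<bar> * (norm x * norm x)" by (intro mult_right_mono) auto
    then show ?thesis unfolding dot_square_norm power2_eq_square by simp
  qed
  moreover have "(\<bar>\<kappa>\<bar> * norm x) / 2 * norm x \<le> 1 / 2 * norm x" using kr by (intro mult_right_mono) auto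
  ultimately have d: "d x \<le> 3 / 2 * norm x" unfolding d_def by linarith
  then show "d x \<le> 2 * norm x" using r by linarith
  have "n * \<bar>\<kappa>\<bar> * d x \<le> n * \<bar>\<kappa>\<bar> * (3 / 2 * norm x)" using d n_ge1 by (intro mult_left_mono) auto
  also have "\<dots> \<le> 3 / 2" using r by simp
  finally show "n * \<bar>\<kappa>\<bar> * d x \<le> 2" by simp
qed

lemma F_bounds:
  assumes "x \<in> U" shows "F x \<ge> d x / 2" "F x > 0" "F1 x \<ge> 0" "F1 x \<le> 2"
proof -
  have d: "d x > 0" "n * \<bar>\<kappa>\<bar> * d x \<le> 2" using U_D[OF assms] d_le[OF assms] by auto
  have "\<bar>n * \<kappa> * d x\<bar> \<le> 2" using d n_ge1 by (simp add: abs_mult)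
  then have k: "n * \<kappa> * d x \<le> 2" "n * \<kappa> * d x \<ge> -2" by linarith+
  moreover have "F1 x = 1 - n * \<kappa> * d x / 2" by (simp add: F1_def)
  ultimately show "F1 x \<ge> 0" "F1 x \<le> 2" by linarith+
  have "F x = d x * (1 - n * \<kappa> * d x / 4)" by (simp add: F_def power2_eq_square algebra_simps)
  moreover have "d x * (1 - n * \<kappa> * d x / 4) \<ge> d x * (1 / 2)" using k d by (intro mult_left_mono; linarith)
  ultimately show "F x \<ge> d x / 2" by simp
  then show "F x > 0" using d by simp
qed

lemma xx_pos: "x \<in> U \<Longrightarrow> x \<bullet> x > 0" using U_D(1) by auto

lemma continuous_on_U:
  "continuous_on U F" "continuous_on U F1" "continuous_on U drift" "continuous_on U potential"
proof -
  show F: "continuous_on U F" "continuous_on U F1" unfolding F_def F1_def by (intro continuous_intros continuous_on_d)+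
  have nz: "\<forall>x\<in>U. F x \<noteq> 0" "\<forall>x\<in>U. x \<bullet> x \<noteq> 0" "\<forall>x\<in>U. F x * (x \<bullet> x) \<noteq> 0" using F_bounds xx_pos by fastforce+
  show "continuous_on U drift" "continuous_on U potential"
    unfolding drift_def potential_def by (intro continuous_intros continuous_on_d F nz)+
qed

lemma C1_on_log_slope:
  "C1_on U (\<lambda>x. F1 x / F x) (\<lambda>x. ((- (n / 2) * \<kappa>) / F x - (F1 x / F x)\<^sup>2) *\<^sub>R (e + \<kappa> *\<^sub>R x))"
proof -
  let ?F = "\<lambda>t. t - n / 4 * \<kappa> * t\<^sup>2" and ?F1 = "\<lambda>t. 1 - n / 2 * \<kappa> * t"
  have nz: "?F (d x) \<noteq> 0" if "x \<in> U" for x using F_bounds(2)[OF that] by (simp add: F_def)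
  have "C1_on U (\<lambda>x. (\<lambda>t. ?F1 t / ?F t) (d x)) (\<lambda>x. (\<lambda>t. (- (n / 2) * \<kappa>) / ?F t - (?F1 t / ?F t)\<^sup>2) (d x) *\<^sub>R (e + \<kappa> *\<^sub>R x))"
  proof (rule C1_on_comp[OF C1_on_d])
    fix x assume x: "x \<in> U"
    have quot: "(c * A - B * B) / (A * A) = c / A - (B / A)\<^sup>2" if "A \<noteq> 0" for A B c :: real
      using that by (simp add: field_simps power2_eq_square)
    have "(?F has_real_derivative ?F1 (d x)) (at (d x))"
      by (auto intro!: derivative_eq_intros)
    moreover have "(?F1 has_real_derivative (- (n / 2) * \<kappa>)) (at (d x))"
      by (auto intro!: derivative_eq_intros)
    ultimately have "((\<lambda>t. ?F1 t / ?F t) has_real_derivative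
      ((- (n / 2) * \<kappa>) * ?F (d x) - ?F1 (d x) * ?F1 (d x)) / (?F (d x) * ?F (d x))) (at (d x))"
      using nz[OF x] by (intro DERIV_divide)
    then show "((\<lambda>t. ?F1 t / ?F t) has_real_derivative
      (\<lambda>t. (- (n / 2) * \<kappa>) / ?F t - (?F1 t / ?F t)\<^sup>2) (d x)) (at (d x))"
      unfolding quot[OF nz[OF x]] .
  next
    show "continuous_on (d ` U) (\<lambda>t. (- (n / 2) * \<kappa>) / ?F t - (?F1 t / ?F t)\<^sup>2)"
      by (intro continuous_intros) (use nz in auto)
  qed
  then show ?thesis by (rule C1_on_cong) (auto simp: F_def F1_def)
qed

lemma C1_on_inverse_square: "C1_on U (\<lambda>x. c / (x \<bullet> x)) (\<lambda>x. (- (2 * c) / (x \<bullet> x)\<^sup>2) *\<^sub>R x)"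
proof -
  have "C1_on U (\<lambda>x. (\<lambda>t. c / t) (x \<bullet> x)) (\<lambda>x. (\<lambda>t. - c / t\<^sup>2) (x \<bullet> x) *\<^sub>R (2 *\<^sub>R x))"
  proof (rule C1_on_comp[OF C1_on_sqnorm])
    fix x assume "x \<in> U"
    from xx_pos[OF this] show "((\<lambda>t. c / t) has_real_derivative - c / (x \<bullet> x)\<^sup>2) (at (x \<bullet> x))"
      by (auto intro!: derivative_eq_intros simp: power2_eq_square)
  next
    show "continuous_on ((\<lambda>x. x \<bullet> x) ` U) (\<lambda>t. - c / t\<^sup>2)"
      by (intro continuous_intros) (use xx_pos in force)
  qed
  then show ?thesis by (rule C1_on_cong) auto
qed

lemma grad_d: "(e + \<kappa> *\<^sub>R x) \<bullet> (e + \<kappa> *\<^sub>R x) = 1 + 2 * \<kappa> * d x" "x \<bullet> (e + \<kappa> *\<^sub>R x) = d x + \<kappa> * (x \<bullet> x) / 2"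
proof -
  have "e \<bullet> e = 1" using norm_e by (simp add: norm_eq_1)
  then show "(e + \<kappa> *\<^sub>R x) \<bullet> (e + \<kappa> *\<^sub>R x) = 1 + 2 * \<kappa> * d x"
    by (simp add: d_def algebra_simps inner_commute)
  show "x \<bullet> (e + \<kappa> *\<^sub>R x) = d x + \<kappa> * (x \<bullet> x) / 2"
    by (simp add: d_def algebra_simps)
qed

definition div_drift :: "'a \<Rightarrow> real" where
  "div_drift x = ((- (n / 2) * \<kappa>) / F x - (F1 x / F x)\<^sup>2) * (1 + 2 * \<kappa> * d x) + n / (x \<bullet> x)
     + n * \<kappa> * (F1 x / F x) - n\<^sup>2 / (2 * (x \<bullet> x))"

lemma norm_drift:
  assumes "x \<in> U"
  shows "drift x \<bullet> drift x = (F1 x / F x)\<^sup>2 * (1 + 2 * \<kappa> * d x)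
    - 2 * (F1 x / F x) * (n / 2 / (x \<bullet> x)) * (d x + \<kappa> * (x \<bullet> x) / 2) + n\<^sup>2 / 4 / (x \<bullet> x)"
proof -
  define y where "y = e + \<kappa> *\<^sub>R x"
  have y: "y \<bullet> y = 1 + 2 * \<kappa> * d x" "x \<bullet> y = d x + \<kappa> * (x \<bullet> x) / 2"
    using grad_d unfolding y_def by auto
  have "drift x \<bullet> drift x = (F1 x / F x)\<^sup>2 * (y \<bullet> y) - 2 * (F1 x / F x) * (n / 2 / (x \<bullet> x)) * (x \<bullet> y)
    + (n / 2 / (x \<bullet> x))\<^sup>2 * (x \<bullet> x)"
    unfolding drift_def y_def[symmetric] power2_eq_square
    by (simp add: inner_diff_left inner_diff_right inner_commute[of y x] algebra_simps)
  also have "(n / 2 / (x \<bullet> x))\<^sup>2 * (x \<bullet> x) = n\<^sup>2 / 4 / (x \<bullet> x)"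
    using xx_pos[OF assms] by (simp add: power2_eq_square)
  finally show ?thesis unfolding y .
qed

lemma potential_eq: "x \<in> U \<Longrightarrow> potential x = - (div_drift x + drift x \<bullet> drift x)"
  unfolding norm_drift potential_def div_drift_def
  by (rule ground_state_potential_algebra) (use F_bounds(2)[of x] xx_pos[of x] in \<open>auto simp: F_def F1_def\<close>)

text \<open>
  Curvature perturbs the Hardy potential only by a term that is less singular at the origin and bounded up to $d = 0$.
\<close>
lemma potential_bound:
  assumes "x \<in> U"
  shows "\<bar>potential x - n\<^sup>2 / 4 / (x \<bullet> x)\<bar> \<le> 4 * n\<^sup>2 * \<bar>\<kappa>\<bar> / norm x"
proof -
  define r where "r = norm x"
  have r: "r > 0" "x \<bullet> x = r\<^sup>2" "n * \<bar>\<kappa>\<bar> * r \<le> 1" using U_D[OF assms] by (auto simp: r_def dot_square_norm)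
  have d: "d x > 0" "d x \<le> 2 * r" using U_D[OF assms] d_le[OF assms] by (auto simp: r_def)
  have dF: "d x / F x \<le> 2" using F_bounds[OF assms] d by (simp add: field_simps)
  have dF0: "d x / F x \<ge> 0" using F_bounds[OF assms] d by simp
  have "\<bar>n\<^sup>2 / 4 * \<kappa> * (d x)\<^sup>2 / (F x * (x \<bullet> x))\<bar> = n\<^sup>2 / 4 * \<bar>\<kappa>\<bar> * ((d x / F x) * d x) / r\<^sup>2"
    using r d F_bounds[OF assms] by (simp add: abs_mult power2_eq_square)
  also have "\<dots> \<le> n\<^sup>2 / 4 * \<bar>\<kappa>\<bar> * (2 * (2 * r)) / r\<^sup>2"
    using d dF dF0 by (intro divide_right_mono mult_left_mono mult_mono) auto
  also have "\<dots> = n\<^sup>2 * \<bar>\<kappa>\<bar> / r" using r by (simp add: power2_eq_square)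
  finally have 1: "\<bar>n\<^sup>2 / 4 * \<kappa> * (d x)\<^sup>2 / (F x * (x \<bullet> x))\<bar> \<le> n\<^sup>2 * \<bar>\<kappa>\<bar> / r" .
  have "\<bar>n * (1 + n / 4) * \<kappa>\<^sup>2 * d x / F x\<bar> = (1 + n / 4) * (n * \<bar>\<kappa>\<bar> * r) * \<bar>\<kappa>\<bar> / r * (d x / F x)"
    using r d n_ge1 F_bounds[OF assms] by (simp add: abs_mult power2_eq_square)
  also have "\<dots> \<le> (1 + n / 4) * 1 * \<bar>\<kappa>\<bar> / r * 2"
    using dF dF0 r n_ge1 by (intro mult_mono divide_right_mono mult_right_mono mult_left_mono) auto
  also have "\<dots> = (2 + n / 2) * \<bar>\<kappa>\<bar> / r" by (simp add: algebra_simps)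
  finally have 2: "\<bar>n * (1 + n / 4) * \<kappa>\<^sup>2 * d x / F x\<bar> \<le> (2 + n / 2) * \<bar>\<kappa>\<bar> / r" .
  have "n * 1 \<le> n * n" by (rule mult_left_mono) (use n_ge1 in auto)
  then have nn: "n\<^sup>2 + (2 + n / 2) \<le> 4 * n\<^sup>2" using n_ge1 unfolding power2_eq_square by linarith
  have "\<bar>potential x - n\<^sup>2 / 4 / (x \<bullet> x)\<bar> \<le> n\<^sup>2 * \<bar>\<kappa>\<bar> / r + (2 + n / 2) * \<bar>\<kappa>\<bar> / r"
    using 1 2 unfolding potential_def by linarith
  also have "\<dots> = (n\<^sup>2 + (2 + n / 2)) * (\<bar>\<kappa>\<bar> / r)" by (simp add: algebra_simps add_divide_distrib)
  also have "\<dots> \<le> 4 * n\<^sup>2 * (\<bar>\<kappa>\<bar> / r)" using nn r by (intro mult_right_mono) auto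
  finally show ?thesis by (simp add: r_def)
qed

context
  fixes u :: "'a \<Rightarrow> real" and g :: "'a \<Rightarrow> 'a"
  assumes u: "C1c_on U u g"
begin

lemma cont_u: "continuous_on U u" "continuous_on U g"
  using C1c_on_C1[OF u] C1_on_continuous C1_on_continuous_grad by blast+

lemma integrable_weight: "continuous_on U c \<Longrightarrow> integrable lborel (\<lambda>x. c x * (u x)\<^sup>2)"
  by (rule integrable_C1c_on[OF u]) (auto intro!: continuous_intros cont_u)

lemma integrable_energy: "integrable lborel (\<lambda>x. (norm (g x - u x *\<^sub>R drift x))\<^sup>2)"
  by (rule integrable_C1c_on[OF u]) (auto intro!: continuous_intros cont_u continuous_on_U)

text \<open>
  The divergence theorem for $a\,u^2\,x$.
\<close>
lemma radial_flux:
  assumes a: "C1_on U a a'"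
  shows "integrable lborel (\<lambda>x. (2 * a x * u x * (g x \<bullet> x) + (a' x \<bullet> x + n * a x) * (u x)\<^sup>2))"
    "(\<integral>x. (2 * a x * u x * (g x \<bullet> x) + (a' x \<bullet> x + n * a x) * (u x)\<^sup>2) \<partial>lborel) = 0"
proof -
  note [continuous_intros] = cont_u C1_on_continuous[OF a] C1_on_continuous_grad[OF a]
  show "integrable lborel (\<lambda>x. (2 * a x * u x * (g x \<bullet> x) + (a' x \<bullet> x + n * a x) * (u x)\<^sup>2))"
    by (rule integrable_C1c_on[OF u]) (auto intro!: continuous_intros)
  have "(\<integral>x. (a x *\<^sub>R ((2 * u x) *\<^sub>R g x) + (u x)\<^sup>2 *\<^sub>R a' x) \<bullet> x + n * (a x * (u x)\<^sup>2) \<partial>lborel) = 0"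
    unfolding n_eq by (rule integral_radial_derivative[OF open_U C1c_on_mult[OF open_U C1c_on_square[OF open_U u] a]])
  also have "(\<lambda>x. (a x *\<^sub>R ((2 * u x) *\<^sub>R g x) + (u x)\<^sup>2 *\<^sub>R a' x) \<bullet> x + n * (a x * (u x)\<^sup>2))
    = (\<lambda>x. 2 * a x * u x * (g x \<bullet> x) + (a' x \<bullet> x + n * a x) * (u x)\<^sup>2)"
    by (simp add: fun_eq_iff inner_add_left algebra_simps)
  finally show "(\<integral>x. (2 * a x * u x * (g x \<bullet> x) + (a' x \<bullet> x + n * a x) * (u x)\<^sup>2) \<partial>lborel) = 0" .
qed

text \<open>
  The divergence theorem for $a\,u^2\,v$ with a fixed vector $v$.
\<close>
lemma parallel_flux:
  assumes a: "C1_on U a a'"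
  shows "integrable lborel (\<lambda>x. 2 * a x * u x * (g x \<bullet> v) + (a' x \<bullet> v) * (u x)\<^sup>2)"
    "(\<integral>x. (2 * a x * u x * (g x \<bullet> v) + (a' x \<bullet> v) * (u x)\<^sup>2) \<partial>lborel) = 0"
proof -
  note [continuous_intros] = cont_u C1_on_continuous[OF a] C1_on_continuous_grad[OF a]
  show "integrable lborel (\<lambda>x. 2 * a x * u x * (g x \<bullet> v) + (a' x \<bullet> v) * (u x)\<^sup>2)"
    by (rule integrable_C1c_on[OF u]) (auto intro!: continuous_intros)
  have "(\<integral>x. (a x *\<^sub>R ((2 * u x) *\<^sub>R g x) + (u x)\<^sup>2 *\<^sub>R a' x) \<bullet> v \<partial>lborel) = 0"
    by (rule integral_directional_derivative_zero[OF C1c_on_mult[OF open_U C1c_on_square[OF open_U u] a]])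
  also have "(\<lambda>x. (a x *\<^sub>R ((2 * u x) *\<^sub>R g x) + (u x)\<^sup>2 *\<^sub>R a' x) \<bullet> v)
    = (\<lambda>x. 2 * a x * u x * (g x \<bullet> v) + (a' x \<bullet> v) * (u x)\<^sup>2)"
    by (simp add: fun_eq_iff inner_add_left algebra_simps)
  finally show "(\<integral>x. (2 * a x * u x * (g x \<bullet> v) + (a' x \<bullet> v) * (u x)\<^sup>2) \<partial>lborel) = 0" .
qed

text \<open>
  Completing the square in $|\nabla u|^2$ leaves the divergence of $u^2\,\nabla\varphi/\varphi$, which integrates to zero.
\<close>
theorem ground_state_identity:
  "(\<integral>x. (norm (g x))\<^sup>2 \<partial>lborel) = energy u g + (\<integral>x. potential x * (u x)\<^sup>2 \<partial>lborel)"
proof -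
  (* The field u^2 drift splits into a multiple of e (flux A), the part of the gradient of d along x (flux B)
     and the radial factor of the ground state (flux C). *)
  let ?\<beta> = "\<lambda>x. F1 x / F x"
  let ?\<beta>' = "\<lambda>x. ((- (n / 2) * \<kappa>) / F x - (F1 x / F x)\<^sup>2) *\<^sub>R (e + \<kappa> *\<^sub>R x)"
  have kb: "C1_on U (\<lambda>x. \<kappa> * ?\<beta> x) (\<lambda>x. \<kappa> *\<^sub>R ?\<beta>' x + ?\<beta> x *\<^sub>R 0)"
    by (intro C1_on_mult C1_on_const C1_on_log_slope)
  note A = parallel_flux[OF C1_on_log_slope, of e]
  note B = radial_flux[OF kb]
  note C = radial_flux[OF C1_on_inverse_square[of "n / 2"]]
  let ?A = "\<lambda>x. 2 * ?\<beta> x * u x * (g x \<bullet> e) + (?\<beta>' x \<bullet> e) * (u x)\<^sup>2"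
  let ?B = "\<lambda>x. 2 * (\<kappa> * ?\<beta> x) * u x * (g x \<bullet> x) + ((\<kappa> *\<^sub>R ?\<beta>' x + ?\<beta> x *\<^sub>R 0) \<bullet> x + n * (\<kappa> * ?\<beta> x)) * (u x)\<^sup>2"
  let ?C = "\<lambda>x. 2 * (n / 2 / (x \<bullet> x)) * u x * (g x \<bullet> x) + (((- (2 * (n / 2)) / (x \<bullet> x)\<^sup>2) *\<^sub>R x) \<bullet> x + n * (n / 2 / (x \<bullet> x))) * (u x)\<^sup>2"
  have pw: "(norm (g x))\<^sup>2 = (norm (g x - u x *\<^sub>R drift x))\<^sup>2 + potential x * (u x)\<^sup>2 + (?A x + ?B x - ?C x)" for x
  proof (cases "x \<in> U")
    case False
    then show ?thesis using C1c_on_outside[OF u False] by simp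
  next
    case True
    define y where "y = e + \<kappa> *\<^sub>R x"
    define c where "c = (- (n / 2) * \<kappa>) / F x - (F1 x / F x)\<^sup>2"
    have y: "y \<bullet> y = 1 + 2 * \<kappa> * d x" using grad_d unfolding y_def by auto
    have xx: "x \<bullet> x > 0" by (rule xx_pos[OF True])
    have vy: "v \<bullet> y = v \<bullet> e + \<kappa> * (v \<bullet> x)" for v by (simp add: y_def inner_add_right)
    have "?A x + ?B x - ?C x = 2 * u x * (?\<beta> x * (g x \<bullet> (e + \<kappa> *\<^sub>R x)) - n / 2 / (x \<bullet> x) * (g x \<bullet> x))
      + (c * (y \<bullet> (e + \<kappa> *\<^sub>R x)) + n / (x \<bullet> x) + n * \<kappa> * ?\<beta> x - n\<^sup>2 / (2 * (x \<bullet> x))) * (u x)\<^sup>2"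
      unfolding y_def[symmetric] c_def[symmetric]
      using xx by (simp add: vy power2_eq_square algebra_simps add_divide_distrib)
    also have "\<dots> = 2 * u x * (g x \<bullet> drift x) + div_drift x * (u x)\<^sup>2"
      unfolding drift_def div_drift_def y_def[symmetric] c_def[symmetric] y
      by (simp add: inner_diff_right)
    finally have S: "?A x + ?B x - ?C x = 2 * u x * (g x \<bullet> drift x) + div_drift x * (u x)\<^sup>2" .
    show ?thesis
      unfolding S potential_eq[OF True] power2_norm_eq_inner
      by (simp add: inner_diff_left inner_diff_right inner_commute algebra_simps power2_eq_square)
  qed
  have "(\<integral>x. (norm (g x))\<^sup>2 \<partial>lborel) =
    (\<integral>x. ((norm (g x - u x *\<^sub>R drift x))\<^sup>2 + potential x * (u x)\<^sup>2 + (?A x + ?B x - ?C x)) \<partial>lborel)"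
    by (simp only: pw[symmetric])
  also have "\<dots> = energy u g + (\<integral>x. potential x * (u x)\<^sup>2 \<partial>lborel) +
     ((\<integral>x. ?A x \<partial>lborel) + (\<integral>x. ?B x \<partial>lborel) - (\<integral>x. ?C x \<partial>lborel))"
    unfolding energy_def
    by (subst Bochner_Integration.integral_add Bochner_Integration.integral_diff,
      (intro Bochner_Integration.integrable_add Bochner_Integration.integrable_diff
        integrable_energy integrable_weight continuous_on_U A(1) B(1) C(1))+)+ (rule refl)
  finally show ?thesis using A(2) B(2) C(2) by simp
qed

text \<open>
  Integrate the divergence of $\gamma\,u^2\,x/|x|^2$. With respect to the measure $\varphi^2dx$ the field $x/|x|^2$ is divergence
  free up to curvature, so only the radial derivative \<open>h\<close> of $\gamma$ remains; Young's inequality splits the cross term, for which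
  $\gamma^2 \le M h$ is what is needed. For $\kappa \ge 0$ the only curvature term of the wrong sign has the relative size
  $\kappa d = O(\kappa|x|)$.
\<close>
lemma weighted_hardy:
  assumes \<kappa>: "\<kappa> \<ge> 0" and M: "M > 0"
    and \<gamma>: "C1_on U \<gamma> \<gamma>'" and h: "continuous_on U h" "\<And>x. x \<in> U \<Longrightarrow> \<gamma>' x \<bullet> x = h x"
    and pos: "\<And>x. x \<in> U \<Longrightarrow> \<gamma> x \<ge> 0" and le: "\<And>x. x \<in> U \<Longrightarrow> (\<gamma> x)\<^sup>2 \<le> M * h x"
  shows "(\<integral>x. h x / (x \<bullet> x) * (u x)\<^sup>2 \<partial>lborel)
    \<le> 4 * n * \<kappa> * (\<integral>x. \<gamma> x / norm x * (u x)\<^sup>2 \<partial>lborel) + 4 * M * energy u g"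
proof -
  have G: "C1_on U (\<lambda>x. \<gamma> x * (1 / (x \<bullet> x))) (\<lambda>x. \<gamma> x *\<^sub>R ((- (2 * 1) / (x \<bullet> x)\<^sup>2) *\<^sub>R x) + (1 / (x \<bullet> x)) *\<^sub>R \<gamma>' x)"
    by (intro C1_on_mult \<gamma> C1_on_inverse_square)
  note Z = radial_flux[OF G]
  let ?Z = "\<lambda>x. 2 * (\<gamma> x * (1 / (x \<bullet> x))) * u x * (g x \<bullet> x) +
    ((\<gamma> x *\<^sub>R ((- (2 * 1) / (x \<bullet> x)\<^sup>2) *\<^sub>R x) + (1 / (x \<bullet> x)) *\<^sub>R \<gamma>' x) \<bullet> x + n * (\<gamma> x * (1 / (x \<bullet> x)))) * (u x)\<^sup>2"
  let ?L = "\<lambda>x. h x / (x \<bullet> x) * (u x)\<^sup>2" and ?R = "\<lambda>x. \<gamma> x / norm x * (u x)\<^sup>2"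
  let ?P = "\<lambda>x. (norm (g x - u x *\<^sub>R drift x))\<^sup>2"
  have nz: "\<forall>x\<in>U. x \<bullet> x \<noteq> 0" "\<forall>x\<in>U. norm x \<noteq> 0" using U_D(1) by auto
  have iL: "integrable lborel ?L"
    by (rule integrable_weight) (intro continuous_intros h nz)
  have iR: "integrable lborel ?R"
    by (rule integrable_weight) (intro continuous_intros C1_on_continuous[OF \<gamma>] nz)
  have pw: "1 / 2 * ?L x - (2 * n * \<kappa>) * ?R x - (2 * M) * ?P x \<le> ?Z x" for x
  proof (cases "x \<in> U")
    case False
    then show ?thesis using C1c_on_outside[OF u False] by simp
  next
    case True
    define r where "r = norm x"
    define p where "p = g x - u x *\<^sub>R drift x"
    define \<beta> where "\<beta> = F1 x / F x"
    have r: "r > 0" "x \<bullet> x = r\<^sup>2" using U_D(1)[OF True] by (auto simp: r_def dot_square_norm)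
    have \<gamma>0: "\<gamma> x \<ge> 0" by (rule pos[OF True])
    have \<beta>: "\<beta> \<ge> 0" using F_bounds[OF True] by (simp add: \<beta>_def)
    have dr: "drift x \<bullet> x = \<beta> * (d x + \<kappa> * r\<^sup>2 / 2) - n / 2"
    proof -
      have "drift x \<bullet> x = \<beta> * (x \<bullet> (e + \<kappa> *\<^sub>R x)) - n / 2 / (x \<bullet> x) * (x \<bullet> x)"
        unfolding drift_def \<beta>_def
        by (simp only: inner_diff_left inner_scaleR_left inner_commute[of "e + \<kappa> *\<^sub>R x" x])
      then show ?thesis using grad_d(2)[of x] r by simp
    qed
    have "\<beta> * d x = 1 - n / 4 * \<kappa> * (d x)\<^sup>2 / F x"
    proof -
      have "F1 x * d x = F x - n / 4 * \<kappa> * (d x)\<^sup>2"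
        unfolding F_def F1_def by (simp add: algebra_simps power2_eq_square)
      then have "F1 x * d x / F x = (F x - n / 4 * \<kappa> * (d x)\<^sup>2) / F x" by simp
      then show ?thesis using F_bounds(2)[OF True] by (simp add: \<beta>_def diff_divide_distrib)
    qed
    moreover have "n / 4 * \<kappa> * (d x)\<^sup>2 / F x \<le> n * \<kappa> * r"
    proof -
      have "(d x)\<^sup>2 / F x = (d x / F x) * d x" by (simp add: power2_eq_square)
      also have "\<dots> \<le> 2 * (2 * r)"
        using F_bounds[OF True] U_D(2)[OF True] d_le[OF True] by (intro mult_mono) (auto simp: r_def field_simps)
      finally have "n / 4 * \<kappa> * ((d x)\<^sup>2 / F x) \<le> n / 4 * \<kappa> * (2 * (2 * r))"
        using \<kappa> n_ge1 by (intro mult_left_mono) auto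
      then show ?thesis by simp
    qed
    ultimately have bd: "\<beta> * d x - 1 \<ge> - (n * \<kappa> * r)" by linarith
    have "\<beta> * (\<kappa> * r\<^sup>2 / 2) \<ge> 0" using \<beta> \<kappa> by simp
    then have bd': "\<beta> * (d x + \<kappa> * r\<^sup>2 / 2) - 1 \<ge> - (n * \<kappa> * r)"
      using bd by (simp add: distrib_left)
    have Zx: "?Z x = 2 * \<gamma> x / r\<^sup>2 * u x * (p \<bullet> x)
        + (h x / r\<^sup>2 + 2 * \<gamma> x / r\<^sup>2 * (\<beta> * (d x + \<kappa> * r\<^sup>2 / 2) - 1)) * (u x)\<^sup>2"
    proof -
      have gx: "g x \<bullet> x = p \<bullet> x + u x * (drift x \<bullet> x)" by (simp add: p_def inner_diff_left)
      show ?thesis unfolding gx dr inner_add_left inner_scaleR_left h(2)[OF True] r(2)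
        using r(1) by (simp add: field_simps power2_eq_square)
    qed
    have "(2 * \<gamma> x / r\<^sup>2 * (\<beta> * (d x + \<kappa> * r\<^sup>2 / 2) - 1)) * (u x)\<^sup>2
      \<ge> (2 * \<gamma> x / r\<^sup>2 * (- (n * \<kappa> * r))) * (u x)\<^sup>2"
      using bd' \<gamma>0 by (intro mult_right_mono mult_left_mono) auto
    moreover have "(2 * \<gamma> x / r\<^sup>2 * (- (n * \<kappa> * r))) * (u x)\<^sup>2 = - ((2 * n * \<kappa>) * ?R x)"
      using r by (simp add: r_def[symmetric] power2_eq_square)
    ultimately have 1: "(2 * \<gamma> x / r\<^sup>2 * (\<beta> * (d x + \<kappa> * r\<^sup>2 / 2) - 1)) * (u x)\<^sup>2 \<ge> - ((2 * n * \<kappa>) * ?R x)" by simp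
    have 2: "2 * \<gamma> x / r\<^sup>2 * u x * (p \<bullet> x) \<ge> - (1 / 2 * ?L x + 2 * M * (norm p)\<^sup>2)"
    proof -
      define A where "A = \<gamma> x * \<bar>u x\<bar> / r"
      have A0: "A \<ge> 0" using \<gamma>0 r by (simp add: A_def)
      have "\<bar>2 * \<gamma> x / r\<^sup>2 * u x * (p \<bullet> x)\<bar> = 2 * \<gamma> x / r\<^sup>2 * \<bar>u x\<bar> * \<bar>p \<bullet> x\<bar>"
        using \<gamma>0 by (simp add: abs_mult)
      also have "\<dots> \<le> 2 * \<gamma> x / r\<^sup>2 * \<bar>u x\<bar> * (norm p * r)"
        using \<gamma>0 Cauchy_Schwarz_ineq2[of p x] by (intro mult_left_mono) (auto simp: r_def)
      also have "\<dots> = 2 * A * norm p" using r by (simp add: A_def power2_eq_square)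
      also have "\<dots> \<le> A\<^sup>2 / (2 * M) + 2 * M * (norm p)\<^sup>2"
      proof -
        have "0 \<le> (A - 2 * M * norm p)\<^sup>2 / (2 * M)" using M by simp
        also have "\<dots> = A\<^sup>2 / (2 * M) + 2 * M * (norm p)\<^sup>2 - 2 * A * norm p"
          using M by (simp add: power2_eq_square field_simps)
        finally show ?thesis by simp
      qed
      also have "A\<^sup>2 / (2 * M) = (\<gamma> x)\<^sup>2 * ((u x)\<^sup>2 / (2 * M * r\<^sup>2))"
        by (simp add: A_def power_mult_distrib power_divide)
      also have "\<dots> \<le> (M * h x) * ((u x)\<^sup>2 / (2 * M * r\<^sup>2))"
        using le[OF True] M by (intro mult_right_mono) auto
      also have "\<dots> = 1 / 2 * ?L x" using M r by simp
      finally show ?thesis by linarith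
    qed
    have L: "?L x = h x / r\<^sup>2 * (u x)\<^sup>2" using r by simp
    have "?Z x = 2 * \<gamma> x / r\<^sup>2 * u x * (p \<bullet> x)
        + (?L x + (2 * \<gamma> x / r\<^sup>2 * (\<beta> * (d x + \<kappa> * r\<^sup>2 / 2) - 1)) * (u x)\<^sup>2)"
      unfolding Zx L by (simp only: distrib_right)
    moreover have "1 / 2 * L - b - c \<le> Z" if "Z = A + (L + B)" "- b \<le> B" "- (1 / 2 * L + c) \<le> A"
      for A B L Z b c :: real using that by linarith
    ultimately show ?thesis using 1 2 unfolding p_def[symmetric] by blast
  qed
  have "(\<integral>x. (1 / 2 * ?L x - (2 * n * \<kappa>) * ?R x - (2 * M) * ?P x) \<partial>lborel) \<le> (\<integral>x. ?Z x \<partial>lborel)"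
    by (rule integral_mono[OF _ Z(1) pw])
      (intro Bochner_Integration.integrable_diff integrable_mult_right iL iR integrable_energy)
  also have "\<dots> = 0" by (rule Z(2))
  also have "(\<integral>x. (1 / 2 * ?L x - (2 * n * \<kappa>) * ?R x - (2 * M) * ?P x) \<partial>lborel) =
    1 / 2 * (\<integral>x. ?L x \<partial>lborel) - (2 * n * \<kappa>) * (\<integral>x. ?R x \<partial>lborel) - (2 * M) * energy u g"
  proof -
    have "(\<integral>x. (a1 * f1 x - a2 * f2 x - a3 * f3 x) \<partial>lborel) =
      a1 * (\<integral>x. f1 x \<partial>lborel) - a2 * (\<integral>x. f2 x \<partial>lborel) - a3 * (\<integral>x. f3 x \<partial>lborel)"
      if "integrable lborel f1" "integrable lborel f2" "integrable lborel f3"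
      for a1 a2 a3 and f1 f2 f3 :: "'a \<Rightarrow> real"
      using that by simp
    from this[OF iL iR integrable_energy] show ?thesis unfolding energy_def .
  qed
  finally show ?thesis by (simp add: mult.assoc)
qed

end

end

section \<open>Logarithmic weights and dyadic annuli\<close>

text \<open>
  A power of the radius beats one or two logarithms, uniformly on the scale of the domain.
\<close>
lemma log_weight_bounds:
  fixes t :: real
  assumes "0 < t" "t \<le> 1"
  shows "1 \<le> 1 - ln (t / 3)" "t * (1 - ln (t / 3)) \<le> 3" "t * (1 - ln (t / 3))\<^sup>2 \<le> 9"
proof -
  define l where "l = 1 - ln (t / 3)"
  have l: "l = 1 + ln 3 - ln t" using assms by (simp add: l_def ln_div)
  have ln3: "ln (3::real) \<le> 2" using ln_le_minus_one[of "3::real"] by simp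
  have "ln t \<le> 0" "ln (3::real) \<ge> 0" using assms by auto
  then show l1: "1 \<le> 1 - ln (t / 3)" using l l_def by linarith
  have *: "y * (3 - c * ln y) \<le> 3" if "0 < y" "y \<le> 1" "c \<ge> 0" "c \<le> 2" for y c :: real
  proof -
    have "- ln y \<le> 1 / y - 1" using ln_le_minus_one[of "1 / y"] that by (simp add: ln_div)
    then have "y * (- (c * ln y)) \<le> y * (c * (1 / y - 1))"
      using that mult_left_mono[of "- ln y" "1 / y - 1" c] by (intro mult_left_mono) auto
    also have "\<dots> = c * (1 - y)" using that by (simp add: field_simps)
    also have "\<dots> \<le> 2 * (1 - y)" using that by (intro mult_right_mono) auto
    finally have "y * (3 - c * ln y) \<le> 3 * y + 2 * (1 - y)" by (simp add: right_diff_distrib)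
    then show ?thesis using that by simp
  qed
  have "t * l \<le> t * (3 - 1 * ln t)" using assms ln3 l by (intro mult_left_mono) auto
  moreover have "t * (3 - 1 * ln t) \<le> 3" by (rule *) (use assms in auto)
  ultimately have "t * l \<le> 3" by linarith
  then show "t * (1 - ln (t / 3)) \<le> 3" by (simp only: l_def)
  define y where "y = sqrt t"
  have y: "0 < y" "y \<le> 1" "t = y\<^sup>2" using assms by (auto simp: y_def)
  have "l \<le> 3 - 2 * ln y" using ln3 y l by (simp add: ln_realpow)
  then have "y * l \<le> y * (3 - 2 * ln y)" using y by (intro mult_left_mono) auto
  moreover have "y * (3 - 2 * ln y) \<le> 3" by (rule *) (use y in auto)
  ultimately have "y * l \<le> 3" by linarith
  moreover have "y * l \<ge> 0"
    using y l1 unfolding l_def[symmetric] by (intro mult_nonneg_nonneg) auto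
  ultimately have "(y * l)\<^sup>2 \<le> 3\<^sup>2" by (intro power_mono)
  then show "t * (1 - ln (t / 3))\<^sup>2 \<le> 9" by (simp add: power_mult_distrib y l_def)
qed

text \<open>
  Wide enough to contain the support of a cut-off that is bounded below on $R/2 \le |x| \le R$.
\<close>
definition dyadic_annulus :: "real \<Rightarrow> 'a::euclidean_space set" where
  "dyadic_annulus R = {x. R / 4 \<le> norm x \<and> norm x \<le> 2 * R}"

lemma dyadic_annulus_measurable[measurable]: "dyadic_annulus R \<in> sets borel"
  unfolding dyadic_annulus_def by measurable

text \<open>
  The ratio of the outer to the inner radius is $8$, so a point lies in at most four consecutive annuli.
\<close>
lemma dyadic_annuli_overlap:
  fixes x :: "'a::euclidean_space"
  assumes D: "D > 0"
  shows "(\<Sum>k<N. indicator (dyadic_annulus (D / 2 ^ k)) x) \<le> (4::real)"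
proof -
  let ?S = "{k. k < N \<and> x \<in> dyadic_annulus (D / 2 ^ k)}"
  have "card ?S \<le> 4"
  proof (cases "?S = {}")
    case False
    define m where "m = Min ?S"
    have m: "m \<in> ?S" unfolding m_def using False by (intro Min_in) auto
    have "?S \<subseteq> {m..m+3}"
    proof
      fix k assume k: "k \<in> ?S"
      have mk: "m \<le> k" unfolding m_def using k by (intro Min_le) auto
      have "D / 2 ^ m / 4 \<le> 2 * (D / 2 ^ k)"
        using m k by (auto simp: dyadic_annulus_def)
      then have "(2::real) ^ k \<le> 8 * 2 ^ m" using D by (simp add: field_simps)
      also have "\<dots> = 2 ^ (m + 3)" by (simp add: power_add)
      finally have "k \<le> m + 3" by simp
      then show "k \<in> {m..m+3}" using mk by simp
    qed
    then have "card ?S \<le> card {m..m+3}" by (intro card_mono) auto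
    then show ?thesis by simp
  next
    case True
    then show ?thesis by (simp only: card.empty)
  qed
  moreover have "(\<Sum>k<N. indicator (dyadic_annulus (D / 2 ^ k)) x) = (\<Sum>k\<in>?S. (1::real))"
    by (intro sum.mono_neutral_cong_right) (auto simp: indicator_def)
  ultimately show ?thesis by simp
qed

text \<open>
  The square of a positive part is continuously differentiable; a polynomial in $|x|^2/R^2$ that is positive exactly for
  $R/4 < |x| < 2R$ then gives a cut-off with an explicit gradient.
\<close>
definition annular_cutoff :: "real \<Rightarrow> 'a::euclidean_space \<Rightarrow> real" where
  "annular_cutoff R x = (max 0 ((x \<bullet> x / R\<^sup>2 - 1 / 16) * (4 - x \<bullet> x / R\<^sup>2)))\<^sup>2"

definition annular_cutoff_grad :: "real \<Rightarrow> 'a::euclidean_space \<Rightarrow> 'a" where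
  "annular_cutoff_grad R x = (2 * max 0 ((x \<bullet> x / R\<^sup>2 - 1 / 16) * (4 - x \<bullet> x / R\<^sup>2))
     * (65 / 16 - 2 * (x \<bullet> x / R\<^sup>2)) * (2 / R\<^sup>2)) *\<^sub>R x"

lemma DERIV_max_0_square: "((\<lambda>y::real. (max 0 y)\<^sup>2) has_real_derivative 2 * max 0 y) (at y)"
proof -
  consider "y > 0" | "y < 0" | "y = 0" by linarith
  then show ?thesis
  proof cases
    case 1
    have "((\<lambda>y. y\<^sup>2) has_real_derivative 2 * max 0 y) (at y)" using 1 by (auto intro!: derivative_eq_intros)
    then show ?thesis
      by (rule has_field_derivative_transform_within_open[of _ _ _ "{0<..}"]) (use 1 in auto)
  next
    case 2
    have "((\<lambda>y. 0) has_real_derivative 2 * max 0 y) (at y)" using 2 by auto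
    then show ?thesis
      by (rule has_field_derivative_transform_within_open[of _ _ _ "{..<0}"]) (use 2 in auto)
  next
    case 3
    have "((\<lambda>h::real. (max 0 h)\<^sup>2 / h) \<longlongrightarrow> 0) (at 0)"
    proof (rule Lim_null_comparison)
      show "\<forall>\<^sub>F h::real in at 0. norm ((max 0 h)\<^sup>2 / h) \<le> \<bar>h\<bar>"
        by (auto simp: power2_eq_square max_def eventually_at intro!: exI[of _ 1])
      show "((\<lambda>h::real. \<bar>h\<bar>) \<longlongrightarrow> 0) (at 0)" by (auto intro: tendsto_eq_intros)
    qed
    then show ?thesis using 3 by (simp add: DERIV_def)
  qed
qed

lemma C1_on_annular_cutoff:
  assumes "R > 0"
  shows "C1_on A (annular_cutoff R) (annular_cutoff_grad R)"
proof -
  have R2: "\<forall>x\<in>B. R\<^sup>2 \<noteq> 0" for B :: "real set" using assms by simp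
  let ?m = "\<lambda>s. (s / R\<^sup>2 - 1 / 16) * (4 - s / R\<^sup>2)"
  let ?\<phi> = "\<lambda>s. 2 * max 0 (?m s) * (65 / 16 - 2 * (s / R\<^sup>2)) * (1 / R\<^sup>2)"
  have "C1_on A (\<lambda>x. (\<lambda>s. (max 0 (?m s))\<^sup>2) (x \<bullet> x)) (\<lambda>x. ?\<phi> (x \<bullet> x) *\<^sub>R (2 *\<^sub>R x))"
  proof (rule C1_on_comp[OF C1_on_sqnorm])
    fix x :: 'a
    define s where "s = x \<bullet> x"
    have "((\<lambda>s. (s * c - 1 / 16) * (4 - s * c)) has_real_derivative (65 / 16 - 2 * (s * c)) * c) (at s)" for c
      by (auto intro!: derivative_eq_intros simp: algebra_simps)
    from this[of "1 / R\<^sup>2"]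
    have "(?m has_real_derivative (65 / 16 - 2 * (s / R\<^sup>2)) * (1 / R\<^sup>2)) (at s)"
      by simp
    from DERIV_chain2[OF DERIV_max_0_square this]
    show "((\<lambda>s. (max 0 (?m s))\<^sup>2) has_real_derivative ?\<phi> (x \<bullet> x)) (at (x \<bullet> x))"
      by (simp only: s_def mult.assoc)
  next
    show "continuous_on ((\<lambda>x. x \<bullet> x) ` A) ?\<phi>"
      by (intro continuous_intros R2)
  qed
  then show ?thesis
    by (rule C1_on_cong) (auto simp: annular_cutoff_def annular_cutoff_grad_def)
qed

lemma annular_cutoff_outside:
  assumes "R > 0" "x \<notin> dyadic_annulus R"
  shows "annular_cutoff R x = 0" "annular_cutoff_grad R x = 0"
proof -
  define t where "t = x \<bullet> x / R\<^sup>2"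
  have t: "t = (norm x / R)\<^sup>2" by (simp add: t_def dot_square_norm power_divide)
  have "norm x / R < 1 / 4 \<or> norm x / R > 2"
    using assms by (auto simp: dyadic_annulus_def field_simps)
  then have "t < 1 / 16 \<or> t > 4"
  proof
    assume "norm x / R < 1 / 4"
    then have "(norm x / R)\<^sup>2 < (1 / 4)\<^sup>2" using assms by (intro power_strict_mono) auto
    then show ?thesis by (simp add: t power2_eq_square)
  next
    assume "norm x / R > 2"
    then have "(norm x / R)\<^sup>2 > 2\<^sup>2" by (intro power_strict_mono) auto
    then show ?thesis by (simp add: t)
  qed
  then have "(t - 1 / 16) * (4 - t) \<le> 0"
    by (auto simp: mult_le_0_iff)
  then show "annular_cutoff R x = 0" "annular_cutoff_grad R x = 0"
    unfolding annular_cutoff_def annular_cutoff_grad_def t_def[symmetric] by auto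
qed

text \<open>
  Crude constants; only their independence of \<open>R\<close> matters.
\<close>
lemma annular_cutoff_bounds:
  assumes R: "R > 0" and x: "x \<in> dyadic_annulus R"
  shows "0 \<le> annular_cutoff R x" "annular_cutoff R x \<le> 256"
    "norm (annular_cutoff_grad R x) \<le> 2048 / norm x"
proof -
  define t where "t = x \<bullet> x / R\<^sup>2"
  have t: "t = (norm x / R)\<^sup>2" by (simp add: t_def dot_square_norm power_divide)
  have r: "norm x > 0" "norm x / R \<le> 2" using x R by (auto simp: dyadic_annulus_def field_simps)
  have "(norm x / R)\<^sup>2 \<le> 2\<^sup>2" using r R by (intro power_mono) auto
  then have t4: "0 \<le> t" "t \<le> 4" by (auto simp: t)
  define m where "m = max 0 ((t - 1 / 16) * (4 - t))"
  have "(t - 1 / 16) * (4 - t) \<le> 4 * 4" using t4 by (intro mult_mono) auto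
  then have m: "0 \<le> m" "m \<le> 16" by (auto simp: m_def)
  show "0 \<le> annular_cutoff R x" by (simp add: annular_cutoff_def)
  have "m\<^sup>2 \<le> 16\<^sup>2" using m by (intro power_mono) auto
  then show "annular_cutoff R x \<le> 256" by (simp add: annular_cutoff_def m_def t_def)
  have "norm (annular_cutoff_grad R x) = 2 * m * \<bar>65 / 16 - 2 * t\<bar> * (2 * (norm x / R\<^sup>2))"
    unfolding annular_cutoff_grad_def t_def[symmetric] m_def[symmetric]
    using m by (simp add: abs_mult)
  also have "norm x / R\<^sup>2 = t / norm x" using r by (simp add: t power2_eq_square)
  also have "2 * m * \<bar>65 / 16 - 2 * t\<bar> * (2 * (t / norm x)) \<le> 2 * 16 * 8 * (2 * (4 / norm x))"
    using m t4 r by (intro mult_mono divide_right_mono) (auto simp: abs_le_iff)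
  finally show "norm (annular_cutoff_grad R x) \<le> 2048 / norm x" by simp
qed

lemma annular_cutoff_ge:
  assumes R: "R > 0" and x: "R / 2 \<le> norm x" "norm x \<le> R"
  shows "annular_cutoff R x \<ge> 1 / 4"
proof -
  define t where "t = x \<bullet> x / R\<^sup>2"
  have t: "t = (norm x / R)\<^sup>2" by (simp add: t_def dot_square_norm power_divide)
  have "1 / 2 \<le> norm x / R" "norm x / R \<le> 1" using x R by (auto simp: field_simps)
  then have "(1 / 2)\<^sup>2 \<le> (norm x / R)\<^sup>2" "(norm x / R)\<^sup>2 \<le> 1\<^sup>2" using R by (intro power_mono; auto)+
  then have tt: "1 / 4 \<le> t" "t \<le> 1" by (auto simp: t power2_eq_square)
  have "(3 / 16) * 3 \<le> (t - 1 / 16) * (4 - t)" using tt by (intro mult_mono) auto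
  then have "9 / 16 \<le> max 0 ((t - 1 / 16) * (4 - t))" by simp
  then have "(9 / 16)\<^sup>2 \<le> (max 0 ((t - 1 / 16) * (4 - t)))\<^sup>2" by (intro power_mono) auto
  moreover have "1 / 4 \<le> (9 / 16 :: real)\<^sup>2" by (simp add: power2_eq_square)
  ultimately show ?thesis unfolding annular_cutoff_def t_def[symmetric] by linarith
qed

context curved_half_space
begin

text \<open>
  The reciprocal of $X_1(|x|/3D)$, as a function of the point and of the radius.
\<close>
definition log_weight :: "'a \<Rightarrow> real" where "log_weight x = 1 - ln (norm x / (3 * D))"
definition log_weight_at :: "real \<Rightarrow> real" where "log_weight_at R = 1 - ln (R / (3 * D))"

lemma log_weight_eq: "log_weight x = log_weight_at (norm x)" by (simp add: log_weight_def log_weight_at_def)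

lemma log_weight_at_bounds:
  assumes "0 < R" "R \<le> D"
  shows "1 \<le> log_weight_at R" "R * log_weight_at R \<le> 3 * D" "R * (log_weight_at R)\<^sup>2 \<le> 9 * D"
  using log_weight_bounds[of "R / D"] assms D_pos by (auto simp: log_weight_at_def field_simps)

lemma log_weight_at_antimono: "0 < a \<Longrightarrow> a \<le> b \<Longrightarrow> log_weight_at b \<le> log_weight_at a"
  using D_pos by (simp add: log_weight_at_def divide_right_mono)

lemma log_weight_at_quarter: "0 < R \<Longrightarrow> log_weight_at (R / 4) = log_weight_at R + ln 4"
proof -
  assume "0 < R"
  moreover have "R / 4 / (3 * D) = R / (3 * D) / 4" by simp
  ultimately show ?thesis
    using D_pos ln_div[of "R / (3 * D)" 4] unfolding log_weight_at_def by simp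
qed

lemma log_weight_bounds_U:
  assumes "x \<in> U"
  shows "1 \<le> log_weight x" "norm x * log_weight x \<le> 3 * D" "norm x * (log_weight x)\<^sup>2 \<le> 9 * D"
  using log_weight_at_bounds[of "norm x"] U_D[OF assms] by (auto simp: log_weight_eq)

lemma C1_on_log_weight: "C1_on U log_weight (\<lambda>x. (- 1 / (x \<bullet> x)) *\<^sub>R x)"
proof -
  have "C1_on U (\<lambda>x. (\<lambda>s. 1 - ln (s / (3 * D)\<^sup>2) / 2) (x \<bullet> x)) (\<lambda>x. (\<lambda>s. - 1 / (2 * s)) (x \<bullet> x) *\<^sub>R (2 *\<^sub>R x))"
  proof (rule C1_on_comp[OF C1_on_sqnorm])
    have "((\<lambda>s. 1 - ln (s / (3 * D)\<^sup>2) / 2) has_real_derivative (- 1 / (2 * s))) (at s)" if "s > 0" for s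
      using D_pos that by (auto intro!: derivative_eq_intros simp: field_simps)
    then show "((\<lambda>s. 1 - ln (s / (3 * D)\<^sup>2) / 2) has_real_derivative (- 1 / (2 * (x \<bullet> x)))) (at (x \<bullet> x))"
      if "x \<in> U" for x using xx_pos[OF that] by blast
  next
    show "continuous_on ((\<lambda>x. x \<bullet> x) ` U) (\<lambda>s. - 1 / (2 * s))"
      by (intro continuous_intros) (use xx_pos in force)
  qed
  moreover have "ln (x \<bullet> x / (3 * D)\<^sup>2) / 2 = ln (norm x / (3 * D))" for x :: 'a
  proof (cases "x = 0")
    case False
    have "x \<bullet> x / (3 * D)\<^sup>2 = (norm x / (3 * D))\<^sup>2" by (simp add: dot_square_norm power_divide)
    then show ?thesis using False D_pos by (simp add: ln_realpow)
  qed simp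
  ultimately show ?thesis by (intro C1_on_cong[of U _ _ log_weight]) (auto simp: log_weight_def)
qed

lemma C1_on_inverse:
  assumes a: "C1_on U a a'" and nz: "\<And>x. x \<in> U \<Longrightarrow> a x \<noteq> 0"
  shows "C1_on U (\<lambda>x. 1 / a x) (\<lambda>x. (- 1 / (a x)\<^sup>2) *\<^sub>R a' x)"
proof (rule C1_on_comp[OF a, where \<Phi>="\<lambda>t. 1 / t" and \<phi>="\<lambda>t. - 1 / t\<^sup>2"])
  fix x assume "x \<in> U"
  from nz[OF this] show "((\<lambda>t. 1 / t) has_real_derivative - 1 / (a x)\<^sup>2) (at (a x))"
    by (auto intro!: derivative_eq_intros simp: power2_eq_square)
next
  show "continuous_on (a ` U) (\<lambda>t. - 1 / t\<^sup>2)"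
    by (intro continuous_intros) (use nz in auto)
qed

lemma C1_on_inverse_norm: "C1_on U (\<lambda>x. c / norm x) (\<lambda>x. (- c / (norm x * (x \<bullet> x))) *\<^sub>R x)"
proof -
  have "C1_on U (\<lambda>x. (\<lambda>s. c / sqrt s) (x \<bullet> x)) (\<lambda>x. (\<lambda>s. - c / (2 * (sqrt s * s))) (x \<bullet> x) *\<^sub>R (2 *\<^sub>R x))"
  proof (rule C1_on_comp[OF C1_on_sqnorm])
    have "((\<lambda>s. c / sqrt s) has_real_derivative - c / (2 * (sqrt s * s))) (at s)" if "s > 0" for s
      using that by (auto intro!: derivative_eq_intros simp: field_simps)
    then show "((\<lambda>s. c / sqrt s) has_real_derivative - c / (2 * (sqrt (x \<bullet> x) * (x \<bullet> x)))) (at (x \<bullet> x))"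
      if "x \<in> U" for x using xx_pos[OF that] by blast
  next
    show "continuous_on ((\<lambda>x. x \<bullet> x) ` U) (\<lambda>s. - c / (2 * (sqrt s * s)))"
      by (intro continuous_intros) (use xx_pos in force)
  qed
  then show ?thesis by (rule C1_on_cong) (auto simp: norm_eq_sqrt_inner)
qed

end

section \<open>Hardy inequalities outside a ball\<close>

text \<open>
  The number $600\,n^2$ makes the curvature errors in both Hardy inequalities below at most half of the main terms.
\<close>
locale exterior_ball_space = curved_half_space +
  assumes \<kappa>_nonneg: "\<kappa> \<ge> 0" and \<kappa>_small: "600 * n\<^sup>2 * \<kappa> * D \<le> 1" and n3: "n \<ge> 3"
begin

context
  fixes u :: "'a \<Rightarrow> real" and g :: "'a \<Rightarrow> 'a"
  assumes u: "C1c_on U u g"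
begin

lemma energy_nonneg: "energy u g \<ge> 0"
  by (simp add: energy_def)

lemma U_nz: "\<forall>x\<in>U. log_weight x \<noteq> 0" "\<forall>x\<in>U. (log_weight x)\<^sup>2 \<noteq> 0" "\<forall>x\<in>U. x \<bullet> x \<noteq> 0" "\<forall>x\<in>U. norm x \<noteq> 0"
  using log_weight_bounds_U U_D by fastforce+

text \<open>
  Both errors have one factor $|x|$ more than the logarithmic Hardy weight, which beats its logarithms.
\<close>
lemma curvature_error:
  assumes "x \<in> U"
  shows "4 * n * \<kappa> * (1 / log_weight x / norm x) \<le> 1 / 2 * (1 / (log_weight x)\<^sup>2 / (x \<bullet> x))"
    "4 * n\<^sup>2 * \<kappa> / norm x \<le> 1 / 16 * (1 / (log_weight x)\<^sup>2 / (x \<bullet> x))"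
proof -
  define r where "r = norm x"
  define L where "L = log_weight x"
  have r: "r > 0" "x \<bullet> x = r * r" using U_D[OF assms] by (auto simp: r_def dot_square_norm power2_eq_square)
  have L: "L \<ge> 1" "r * L \<le> 3 * D" "r * L\<^sup>2 \<le> 9 * D" using log_weight_bounds_U[OF assms] by (auto simp: L_def r_def)
  have "n * \<kappa> * D \<le> n\<^sup>2 * \<kappa> * D"
    using \<kappa>_nonneg D_pos n3 by (intro mult_right_mono) (auto simp: power2_eq_square)
  moreover have "8 * n * \<kappa> * (r * L) \<le> 8 * n * \<kappa> * (3 * D)" using \<kappa>_nonneg n3 L by (intro mult_left_mono) auto
  moreover have "8 * n * \<kappa> * (3 * D) = 24 * (n * \<kappa> * D)" "600 * (n\<^sup>2 * \<kappa> * D) \<le> 1"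
    using \<kappa>_small by (simp_all add: mult.assoc)
  ultimately have 1: "8 * n * \<kappa> * (r * L) \<le> 1" by linarith
  have "64 * n\<^sup>2 * \<kappa> * (r * L\<^sup>2) \<le> 64 * n\<^sup>2 * \<kappa> * (9 * D)" using \<kappa>_nonneg n3 L by (intro mult_left_mono) auto
  also have "\<dots> \<le> 1"
  proof -
    have "64 * n\<^sup>2 * \<kappa> * (9 * D) = 576 * (n\<^sup>2 * \<kappa> * D)" "600 * (n\<^sup>2 * \<kappa> * D) \<le> 1"
      using \<kappa>_small by (simp_all add: mult.assoc)
    moreover have "n\<^sup>2 * \<kappa> * D \<ge> 0" using \<kappa>_nonneg D_pos by simp
    ultimately show ?thesis by linarith
  qed
  finally have 2: "64 * n\<^sup>2 * \<kappa> * (r * L\<^sup>2) \<le> 1" .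
  have "4 * n * \<kappa> * (1 / L / r) = 1 / 2 * (8 * n * \<kappa> * (r * L)) * (1 / L\<^sup>2 / (r * r))"
    using r L by (simp add: field_simps power2_eq_square)
  also have "\<dots> \<le> 1 / 2 * 1 * (1 / L\<^sup>2 / (r * r))" using 1 by (intro mult_right_mono mult_left_mono) auto
  finally show "4 * n * \<kappa> * (1 / log_weight x / norm x) \<le> 1 / 2 * (1 / (log_weight x)\<^sup>2 / (x \<bullet> x))"
    by (simp add: L_def r_def r(2)[unfolded r_def])
  have "4 * n\<^sup>2 * \<kappa> / r = 1 / 16 * (64 * n\<^sup>2 * \<kappa> * (r * L\<^sup>2)) * (1 / L\<^sup>2 / (r * r))"
    using r L by (simp add: field_simps power2_eq_square)
  also have "\<dots> \<le> 1 / 16 * 1 * (1 / L\<^sup>2 / (r * r))" using 2 by (intro mult_right_mono mult_left_mono) auto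
  finally show "4 * n\<^sup>2 * \<kappa> / norm x \<le> 1 / 16 * (1 / (log_weight x)\<^sup>2 / (x \<bullet> x))"
    by (simp add: L_def r_def r(2)[unfolded r_def])
qed

lemma weighted_mono:
  assumes "continuous_on U a" "continuous_on U b" "\<And>x. x \<in> U \<Longrightarrow> a x \<le> b x"
  shows "(\<integral>x. a x * (u x)\<^sup>2 \<partial>lborel) \<le> (\<integral>x. b x * (u x)\<^sup>2 \<partial>lborel)"
proof (rule integral_mono)
  fix x show "a x * (u x)\<^sup>2 \<le> b x * (u x)\<^sup>2"
    using assms(3)[of x] C1c_on_outside[OF u, of x] by (cases "x \<in> U") (auto intro: mult_right_mono)
qed (use assms in \<open>auto intro: integrable_weight[OF u]\<close>)

text \<open>
  The radial derivative of $1/l$ is $1/l^2$, so $\gamma = 1/l$ satisfies $\gamma^2 \le M h$ with $M = 1$.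
\<close>
lemma log_hardy: "(\<integral>x. 1 / (log_weight x)\<^sup>2 / (x \<bullet> x) * (u x)\<^sup>2 \<partial>lborel) \<le> 8 * energy u g"
proof -
  have c: "continuous_on U log_weight" by (rule C1_on_continuous[OF C1_on_log_weight])
  have g: "C1_on U (\<lambda>x. 1 / log_weight x) (\<lambda>x. (- 1 / (log_weight x)\<^sup>2) *\<^sub>R (- 1 / (x \<bullet> x)) *\<^sub>R x)"
    using log_weight_bounds_U by (intro C1_on_inverse C1_on_log_weight) force
  have "(\<integral>x. 1 / (log_weight x)\<^sup>2 / (x \<bullet> x) * (u x)\<^sup>2 \<partial>lborel)
    \<le> 4 * n * \<kappa> * (\<integral>x. 1 / log_weight x / norm x * (u x)\<^sup>2 \<partial>lborel) + 4 * 1 * energy u g"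
  proof (rule weighted_hardy[OF u \<kappa>_nonneg _ g])
    show "continuous_on U (\<lambda>x. 1 / (log_weight x)\<^sup>2)" by (intro continuous_intros c U_nz)
    show "((- 1 / (log_weight x)\<^sup>2) *\<^sub>R (- 1 / (x \<bullet> x)) *\<^sub>R x) \<bullet> x = 1 / (log_weight x)\<^sup>2" if "x \<in> U" for x
      using U_nz(3) that by simp
    show "1 / log_weight x \<ge> 0" if "x \<in> U" for x using log_weight_bounds_U[OF that] by simp
    show "(1 / log_weight x)\<^sup>2 \<le> 1 * (1 / (log_weight x)\<^sup>2)" for x by (simp add: power_divide)
  qed auto
  also have "4 * n * \<kappa> * (\<integral>x. 1 / log_weight x / norm x * (u x)\<^sup>2 \<partial>lborel)
    = (\<integral>x. 4 * n * \<kappa> * (1 / log_weight x / norm x) * (u x)\<^sup>2 \<partial>lborel)"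
    by (simp only: integral_mult_right_zero[symmetric] mult.assoc)
  also have "\<dots> \<le> (\<integral>x. 1 / 2 * (1 / (log_weight x)\<^sup>2 / (x \<bullet> x)) * (u x)\<^sup>2 \<partial>lborel)"
    by (rule weighted_mono) (intro continuous_intros c U_nz | rule curvature_error)+
  also have "\<dots> = 1 / 2 * (\<integral>x. 1 / (log_weight x)\<^sup>2 / (x \<bullet> x) * (u x)\<^sup>2 \<partial>lborel)"
    by (simp only: integral_mult_right_zero[symmetric] mult.assoc)
  finally show ?thesis by simp
qed

lemma hardy_deficit_ge:
  "(\<integral>x. (norm (g x))\<^sup>2 \<partial>lborel) - n\<^sup>2 / 4 * (\<integral>x. (u x)\<^sup>2 / (norm x)\<^sup>2 \<partial>lborel) \<ge> energy u g / 2"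
proof -
  have c: "continuous_on U log_weight" by (rule C1_on_continuous[OF C1_on_log_weight])
  have "(\<integral>x. (n\<^sup>2 / 4 / (x \<bullet> x) - 1 / 16 * (1 / (log_weight x)\<^sup>2 / (x \<bullet> x))) * (u x)\<^sup>2 \<partial>lborel)
    \<le> (\<integral>x. potential x * (u x)\<^sup>2 \<partial>lborel)"
  proof (rule weighted_mono)
    fix x assume x: "x \<in> U"
    show "n\<^sup>2 / 4 / (x \<bullet> x) - 1 / 16 * (1 / (log_weight x)\<^sup>2 / (x \<bullet> x)) \<le> potential x"
      using potential_bound[OF x] curvature_error(2)[OF x] \<kappa>_nonneg by simp
  qed (intro continuous_intros c U_nz continuous_on_U)+
  moreover have "(\<integral>x. (n\<^sup>2 / 4 / (x \<bullet> x) - 1 / 16 * (1 / (log_weight x)\<^sup>2 / (x \<bullet> x))) * (u x)\<^sup>2 \<partial>lborel)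
    = n\<^sup>2 / 4 * (\<integral>x. (u x)\<^sup>2 / (norm x)\<^sup>2 \<partial>lborel) - 1 / 16 * (\<integral>x. 1 / (log_weight x)\<^sup>2 / (x \<bullet> x) * (u x)\<^sup>2 \<partial>lborel)"
  proof -
    have i1: "integrable lborel (\<lambda>x. 1 / (x \<bullet> x) * (u x)\<^sup>2)" "integrable lborel (\<lambda>x. 1 / (log_weight x)\<^sup>2 / (x \<bullet> x) * (u x)\<^sup>2)"
      by (intro integrable_weight[OF u] continuous_intros c U_nz)+
    have eq: "(\<lambda>x. (n\<^sup>2 / 4 / (x \<bullet> x) - 1 / 16 * (1 / (log_weight x)\<^sup>2 / (x \<bullet> x))) * (u x)\<^sup>2)
      = (\<lambda>x. n\<^sup>2 / 4 * (1 / (x \<bullet> x) * (u x)\<^sup>2) - 1 / 16 * (1 / (log_weight x)\<^sup>2 / (x \<bullet> x) * (u x)\<^sup>2))"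
      by (simp add: fun_eq_iff left_diff_distrib)
    have eq2: "(\<lambda>x. (u x)\<^sup>2 / (norm x)\<^sup>2) = (\<lambda>x. 1 / (x \<bullet> x) * (u x)\<^sup>2)"
      by (simp add: dot_square_norm)
    have "(\<integral>x. (a * f x - b * h x) \<partial>lborel) = a * (\<integral>x. f x \<partial>lborel) - b * (\<integral>x. h x \<partial>lborel)"
      if "integrable lborel f" "integrable lborel h" for a b and f h :: "'a \<Rightarrow> real"
      using that by simp
    from this[OF i1] show ?thesis unfolding eq eq2 .
  qed
  ultimately show ?thesis using ground_state_identity[OF u] log_hardy energy_nonneg by linarith
qed

text \<open>
  The weight is $\gamma = 1/m$ with $m = l/l(R) + R/|x|$. Outside the radius \<open>R\<close> the logarithm dominates \<open>m\<close> and $\gamma$ grows just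
  fast enough for $\gamma^2 \le l(R)\,h$; inside, $\gamma$ decays like $|x|/R$; and near \<open>R\<close> its radial derivative is of order $1$. This
  is why the annulus costs a single factor $l(R)$, where \<open>log_hardy\<close> alone would cost two.
\<close>
lemma annulus_hardy:
  assumes R: "0 < R" "R \<le> D"
  shows "(\<integral>x. indicator (dyadic_annulus R) x * (1 / (x \<bullet> x) * (u x)\<^sup>2) \<partial>lborel) \<le> 1024 * log_weight_at R * energy u g"
proof -
  define m where "m x = 1 / log_weight_at R * log_weight x + R / norm x" for x
  have c: "continuous_on U log_weight" by (rule C1_on_continuous[OF C1_on_log_weight])
  have LR: "log_weight_at R \<ge> 1" by (rule log_weight_at_bounds[OF R])
  have mp: "m x > 0" if "x \<in> U" for x
    unfolding m_def using R LR log_weight_bounds_U[OF that] U_D[OF that] by (intro add_pos_pos) auto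
  have m1: "C1_on U m (\<lambda>x. ((1 / log_weight_at R) *\<^sub>R (- 1 / (x \<bullet> x)) *\<^sub>R x + log_weight x *\<^sub>R 0) + (- R / (norm x * (x \<bullet> x))) *\<^sub>R x)"
    unfolding m_def by (intro C1_on_add C1_on_mult C1_on_const C1_on_log_weight C1_on_inverse_norm)
  have g: "C1_on U (\<lambda>x. 1 / m x) (\<lambda>x. (- 1 / (m x)\<^sup>2) *\<^sub>R
     (((1 / log_weight_at R) *\<^sub>R (- 1 / (x \<bullet> x)) *\<^sub>R x + log_weight x *\<^sub>R 0) + (- R / (norm x * (x \<bullet> x))) *\<^sub>R x))"
    using mp by (intro C1_on_inverse m1) force
  define h where "h x = (1 / log_weight_at R + R / norm x) / (m x)\<^sup>2" for x
  have cm: "continuous_on U m" by (rule C1_on_continuous[OF m1])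
  have mnz: "\<forall>x\<in>U. m x \<noteq> 0" "\<forall>x\<in>U. (m x)\<^sup>2 \<noteq> 0" using mp by force+
  have ch: "continuous_on U h" unfolding h_def
    by (intro continuous_intros cm U_nz mnz)
  have hh: "(\<integral>x. h x / (x \<bullet> x) * (u x)\<^sup>2 \<partial>lborel)
    \<le> 4 * n * \<kappa> * (\<integral>x. 1 / m x / norm x * (u x)\<^sup>2 \<partial>lborel) + 4 * log_weight_at R * energy u g"
  proof (rule weighted_hardy[OF u \<kappa>_nonneg _ g ch])
    show "log_weight_at R > 0" using LR by simp
    fix x assume x: "x \<in> U"
    have r: "norm x > 0" "x \<bullet> x > 0" using U_D[OF x] xx_pos[OF x] by auto
    show "1 / m x \<ge> 0" using mp[OF x] by simp
    have "((- 1 / (m x)\<^sup>2) *\<^sub>R (((1 / log_weight_at R) *\<^sub>R (- 1 / (x \<bullet> x)) *\<^sub>R x + log_weight x *\<^sub>R 0) + (- R / (norm x * (x \<bullet> x))) *\<^sub>R x)) \<bullet> x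
      = (- 1 / (m x)\<^sup>2) * ((1 / log_weight_at R) * (- 1 / (x \<bullet> x) * (x \<bullet> x)) + log_weight x * 0 + (- R / (norm x * (x \<bullet> x))) * (x \<bullet> x))"
      by (simp only: inner_add_left inner_scaleR_left inner_zero_left)
    also have "- 1 / (x \<bullet> x) * (x \<bullet> x) = - 1" using r by simp
    also have "- R / (norm x * (x \<bullet> x)) * (x \<bullet> x) = - R / norm x" using r by simp
    also have "(- 1 / (m x)\<^sup>2) * ((1 / log_weight_at R) * - 1 + log_weight x * 0 + - R / norm x) = h x"
      unfolding h_def by (simp add: add_divide_distrib diff_divide_distrib)
    finally show "((- 1 / (m x)\<^sup>2) *\<^sub>R (((1 / log_weight_at R) *\<^sub>R (- 1 / (x \<bullet> x)) *\<^sub>R x + log_weight x *\<^sub>R 0) + (- R / (norm x * (x \<bullet> x))) *\<^sub>R x)) \<bullet> x = h x" .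
    have "(1 / m x)\<^sup>2 = 1 / (m x)\<^sup>2" by (simp add: power_divide)
    also have "\<dots> \<le> (1 + log_weight_at R * (R / norm x)) / (m x)\<^sup>2" using LR R by (intro divide_right_mono) auto
    also have "\<dots> = log_weight_at R * h x" using LR by (simp add: h_def distrib_left)
    finally show "(1 / m x)\<^sup>2 \<le> log_weight_at R * h x" .
  qed
  have "4 * n * \<kappa> * (\<integral>x. 1 / m x / norm x * (u x)\<^sup>2 \<partial>lborel)
    = (\<integral>x. 4 * n * \<kappa> * (1 / m x / norm x) * (u x)\<^sup>2 \<partial>lborel)"
    by (simp only: integral_mult_right_zero[symmetric] mult.assoc)
  also have "\<dots> \<le> (\<integral>x. log_weight_at R / 2 * (1 / (log_weight x)\<^sup>2 / (x \<bullet> x)) * (u x)\<^sup>2 \<partial>lborel)"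
  proof (rule weighted_mono)
    fix x assume x: "x \<in> U"
    have "1 / m x \<le> log_weight_at R * (1 / log_weight x)"
    proof -
      have "m x \<ge> 1 / log_weight_at R * log_weight x" using R by (simp add: m_def)
      then have "1 / m x \<le> 1 / (1 / log_weight_at R * log_weight x)" using LR log_weight_bounds_U[OF x] by (intro divide_left_mono mult_pos_pos mp[OF x]) auto
      then show ?thesis by simp
    qed
    then have "4 * n * \<kappa> * (1 / m x / norm x) \<le> 4 * n * \<kappa> * (log_weight_at R * (1 / log_weight x) / norm x)"
      using \<kappa>_nonneg n3 by (intro mult_left_mono divide_right_mono) auto
    also have "\<dots> = log_weight_at R * (4 * n * \<kappa> * (1 / log_weight x / norm x))" by simp
    also have "\<dots> \<le> log_weight_at R * (1 / 2 * (1 / (log_weight x)\<^sup>2 / (x \<bullet> x)))"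
      using LR by (intro mult_left_mono curvature_error x) auto
    finally show "4 * n * \<kappa> * (1 / m x / norm x) \<le> log_weight_at R / 2 * (1 / (log_weight x)\<^sup>2 / (x \<bullet> x))" by simp
  qed (intro continuous_intros c cm U_nz mnz)+
  also have "\<dots> = log_weight_at R / 2 * (\<integral>x. 1 / (log_weight x)\<^sup>2 / (x \<bullet> x) * (u x)\<^sup>2 \<partial>lborel)"
    by (simp only: integral_mult_right_zero[symmetric] mult.assoc)
  also have "\<dots> \<le> log_weight_at R / 2 * (8 * energy u g)"
    using LR by (intro mult_left_mono log_hardy) auto
  finally have hI: "(\<integral>x. h x / (x \<bullet> x) * (u x)\<^sup>2 \<partial>lborel) \<le> 8 * log_weight_at R * energy u g" using hh by simp
  have "(\<integral>x. indicator (dyadic_annulus R) x * (1 / (x \<bullet> x) * (u x)\<^sup>2) \<partial>lborel)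
    \<le> (\<integral>x. 128 * (h x / (x \<bullet> x) * (u x)\<^sup>2) \<partial>lborel)"
  proof (rule integral_mono)
    show "integrable lborel (\<lambda>x. indicator (dyadic_annulus R) x * (1 / (x \<bullet> x) * (u x)\<^sup>2))"
    proof -
      have "integrable lborel (\<lambda>x. 1 / (x \<bullet> x) * (u x)\<^sup>2)"
        by (intro integrable_weight[OF u] continuous_intros U_nz)
      from integrable_mult_indicator[OF _ this, of "dyadic_annulus R"] show ?thesis by simp
    qed
    show "integrable lborel (\<lambda>x. 128 * (h x / (x \<bullet> x) * (u x)\<^sup>2))"
      by (intro integrable_mult_right integrable_weight[OF u] continuous_intros ch U_nz)
    fix x
    show "indicator (dyadic_annulus R) x * (1 / (x \<bullet> x) * (u x)\<^sup>2) \<le> 128 * (h x / (x \<bullet> x) * (u x)\<^sup>2)"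
    proof (cases "x \<in> U")
      case False
      then show ?thesis using C1c_on_outside[OF u False] by simp
    next
      case x: True
      have r: "norm x > 0" "x \<bullet> x > 0" using U_D[OF x] xx_pos[OF x] by auto
      have h0: "h x \<ge> 0" using R LR by (simp add: h_def)
      show ?thesis
      proof (cases "x \<in> dyadic_annulus R")
        case False
        then show ?thesis using h0 by simp
      next
        case True
        have rr: "R / 4 \<le> norm x" "norm x \<le> 2 * R" using True by (auto simp: dyadic_annulus_def)
        (* Near the radius R all terms of m are bounded, so h is bounded below. *)
        have "log_weight x \<le> log_weight_at (R / 4)"
          unfolding log_weight_eq by (rule log_weight_at_antimono) (use rr R in auto)
        also have "\<dots> = log_weight_at R + ln 4" by (rule log_weight_at_quarter[OF R(1)])
        also have "ln (4::real) \<le> 3" using ln_le_minus_one[of "4::real"] by simp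
        finally have "log_weight x \<le> 4 * log_weight_at R" using LR by simp
        then have "1 / log_weight_at R * log_weight x \<le> 4" using LR by (simp add: field_simps)
        moreover have "R / norm x \<le> 4" using rr r by (simp add: field_simps)
        ultimately have "m x \<le> 8" by (simp add: m_def)
        then have m8: "(m x)\<^sup>2 \<le> 8\<^sup>2" using mp[OF x] by (intro power_mono) auto
        have "R / norm x \<ge> 1 / 2" using rr r by (simp add: field_simps)
        then have "1 / log_weight_at R + R / norm x \<ge> 1 / 2" using LR by (simp add: add_increasing)
        then have "h x \<ge> (1 / 2) / 8\<^sup>2"
          unfolding h_def using m8 mp[OF x] by (intro frac_le) (linarith | simp)+
        then have "1 \<le> 128 * h x" by simp
        then have "1 * (1 / (x \<bullet> x) * (u x)\<^sup>2) \<le> (128 * h x) * (1 / (x \<bullet> x) * (u x)\<^sup>2)"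
          using r by (intro mult_right_mono) auto
        then show ?thesis using True by simp
      qed
    qed
  qed
  also have "\<dots> = 128 * (\<integral>x. h x / (x \<bullet> x) * (u x)\<^sup>2 \<partial>lborel)" by (simp only: integral_mult_right_zero)
  also have "\<dots> \<le> 128 * (8 * log_weight_at R * energy u g)" using hI by simp
  finally show ?thesis by simp
qed

end

end

section \<open>The weighted Sobolev inequality\<close>

lemma norm_add_square_le: "(norm (a + b :: 'a::real_inner))\<^sup>2 \<le> 2 * (norm a)\<^sup>2 + 2 * (norm b)\<^sup>2"
proof -
  have "0 \<le> (norm (a - b))\<^sup>2" by simp
  then show ?thesis by (simp add: power2_norm_eq_inner inner_add_left inner_add_right
      inner_diff_left inner_diff_right inner_commute)
qed

text \<open>
  The constants depend on the dimension alone: the numbers $256$ and $2048$ bound the cut-off and its gradient, and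
  $2(n-1)/(n-2)$ comes from the Sobolev inequality.
\<close>
definition cutoff_const :: "real \<Rightarrow> real" where "cutoff_const n = 2 * 2048\<^sup>2 + 256\<^sup>2 * n\<^sup>2"
definition local_sobolev_const :: "real \<Rightarrow> real" where "local_sobolev_const n = (2 * (n - 1) / (n - 2))\<^sup>2 * cutoff_const n"

lemma local_sobolev_const_pos: "n \<ge> 3 \<Longrightarrow> local_sobolev_const n > 0"
  by (simp add: local_sobolev_const_def cutoff_const_def add_pos_nonneg)

context exterior_ball_space
begin

lemma cutoff_const_pos: "cutoff_const n > 0" by (simp add: cutoff_const_def add_pos_nonneg)

lemma local_sobolev_const_pos: "local_sobolev_const n > 0" by (rule local_sobolev_const_pos[OF n3])

context
  fixes u :: "'a \<Rightarrow> real" and g :: "'a \<Rightarrow> 'a"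
  assumes u: "C1c_on U u g"
begin

text \<open>
  The second term is what differentiating a cut-off costs; it is not controlled by the first one on a single annulus.
\<close>
definition energy_density :: "'a \<Rightarrow> real" where
  "energy_density x = (norm (g x - u x *\<^sub>R drift x))\<^sup>2 + 1 / (x \<bullet> x) * (u x)\<^sup>2"

lemma energy_density_nonneg: "energy_density x \<ge> 0" by (simp add: energy_density_def)

lemma integrable_annulus:
  assumes "integrable lborel f"
  shows "integrable lborel (\<lambda>x. indicator (dyadic_annulus R) x * (f x :: real))"
  using integrable_mult_indicator[OF _ assms, of "dyadic_annulus R"] by simp

lemma integrable_energy_density: "integrable lborel (\<lambda>x. 1 / (x \<bullet> x) * (u x)\<^sup>2)" "integrable lborel energy_density"
proof -
  show i: "integrable lborel (\<lambda>x. 1 / (x \<bullet> x) * (u x)\<^sup>2)"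
    by (intro integrable_weight[OF u] continuous_intros U_nz[OF u])
  show "integrable lborel energy_density" unfolding energy_density_def
    by (intro Bochner_Integration.integrable_add i integrable_energy[OF u])
qed

text \<open>
  The ground state identity is applied to the cut-off function, not to $u$. This avoids estimating $|\nabla u|^2$ by
  $|\nabla\varphi|^2u^2/\varphi^2$, which is singular where $\varphi$ vanishes.
\<close>
lemma cutoff_energy:
  assumes R: "0 < R"
  shows "(\<integral>x. (norm (annular_cutoff R x *\<^sub>R g x + u x *\<^sub>R annular_cutoff_grad R x))\<^sup>2 \<partial>lborel)
    \<le> cutoff_const n * (\<integral>x. indicator (dyadic_annulus R) x * energy_density x \<partial>lborel)"
proof -
  let ?\<eta> = "annular_cutoff R" and ?\<eta>' = "annular_cutoff_grad R"
  let ?v = "\<lambda>x. ?\<eta> x * u x" and ?h = "\<lambda>x. ?\<eta> x *\<^sub>R g x + u x *\<^sub>R ?\<eta>' x"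
  have v: "C1c_on U ?v ?h" by (intro C1c_on_mult open_U u C1_on_annular_cutoff R)
  have "(\<integral>x. (norm (?h x))\<^sup>2 \<partial>lborel) = energy ?v ?h + (\<integral>x. potential x * (?v x)\<^sup>2 \<partial>lborel)"
    by (rule ground_state_identity[OF v])
  also have "\<dots> = (\<integral>x. (norm (?h x - ?v x *\<^sub>R drift x))\<^sup>2 + potential x * (?v x)\<^sup>2 \<partial>lborel)"
    unfolding energy_def
    by (rule Bochner_Integration.integral_add[OF integrable_energy[OF v] integrable_weight[OF v], symmetric])
      (rule continuous_on_U)
  also have "\<dots> \<le> (\<integral>x. cutoff_const n * (indicator (dyadic_annulus R) x * energy_density x) \<partial>lborel)"
  proof (rule integral_mono)
    show "integrable lborel (\<lambda>x. (norm (?h x - ?v x *\<^sub>R drift x))\<^sup>2 + potential x * (?v x)\<^sup>2)"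
      by (intro Bochner_Integration.integrable_add integrable_energy[OF v] integrable_weight[OF v] continuous_on_U)
    show "integrable lborel (\<lambda>x. cutoff_const n * (indicator (dyadic_annulus R) x * energy_density x))"
      by (intro integrable_mult_right integrable_annulus integrable_energy_density)
    fix x
    show "(norm (?h x - ?v x *\<^sub>R drift x))\<^sup>2 + potential x * (?v x)\<^sup>2
      \<le> cutoff_const n * (indicator (dyadic_annulus R) x * energy_density x)"
    proof (cases "x \<in> U \<and> x \<in> dyadic_annulus R")
      case False
      then have "u x = 0 \<and> g x = 0 \<or> ?\<eta> x = 0 \<and> ?\<eta>' x = 0"
        using C1c_on_outside[OF u, of x] annular_cutoff_outside[OF R, of x] by blast
      then show ?thesis using energy_density_nonneg cutoff_const_pos by auto
    next
      case True
      define p where "p = g x - u x *\<^sub>R drift x"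
      define S where "S = 1 / (x \<bullet> x) * (u x)\<^sup>2"
      have x: "x \<in> U" "x \<in> dyadic_annulus R" using True by auto
      have r: "norm x > 0" using U_D[OF x(1)] by auto
      have S: "S \<ge> 0" "S = (u x)\<^sup>2 / (norm x)\<^sup>2" by (auto simp: S_def dot_square_norm)
      have eta: "0 \<le> ?\<eta> x" "?\<eta> x \<le> 256" "norm (?\<eta>' x) \<le> 2048 / norm x"
        using annular_cutoff_bounds[OF R x(2)] by auto
      have e2: "(?\<eta> x)\<^sup>2 \<le> 256\<^sup>2" using eta by (intro power_mono) auto
      have "?h x - ?v x *\<^sub>R drift x = ?\<eta> x *\<^sub>R p + u x *\<^sub>R ?\<eta>' x"
        by (simp add: p_def algebra_simps)
      then have "(norm (?h x - ?v x *\<^sub>R drift x))\<^sup>2 \<le> 2 * (norm (?\<eta> x *\<^sub>R p))\<^sup>2 + 2 * (norm (u x *\<^sub>R ?\<eta>' x))\<^sup>2"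
        by (simp only: norm_add_square_le)
      moreover have "(norm (?\<eta> x *\<^sub>R p))\<^sup>2 \<le> 256\<^sup>2 * (norm p)\<^sup>2"
        using mult_right_mono[OF e2, of "(norm p)\<^sup>2"] by (simp add: power_mult_distrib)
      moreover have "(norm (u x *\<^sub>R ?\<eta>' x))\<^sup>2 \<le> 2048\<^sup>2 * S"
      proof -
        have "(norm (?\<eta>' x))\<^sup>2 \<le> (2048 / norm x)\<^sup>2" using eta by (intro power_mono) auto
        then have "(u x)\<^sup>2 * (norm (?\<eta>' x))\<^sup>2 \<le> (u x)\<^sup>2 * (2048 / norm x)\<^sup>2" by (intro mult_left_mono) auto
        then show ?thesis unfolding S(2) by (simp add: power_mult_distrib power_divide mult.commute)
      qed
      moreover have "potential x * (?v x)\<^sup>2 \<le> 256\<^sup>2 * n\<^sup>2 * S"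
      proof -
        have log_weight: "log_weight x \<ge> 1" by (rule log_weight_bounds_U[OF x(1)])
        have "1 / (log_weight x)\<^sup>2 / (x \<bullet> x) \<le> 1 / 1 / (x \<bullet> x)"
          using log_weight r by (intro divide_right_mono divide_left_mono) auto
        moreover have "potential x \<le> n\<^sup>2 / 4 / (x \<bullet> x) + 4 * n\<^sup>2 * \<kappa> / norm x"
          using abs_le_D1[OF potential_bound[OF x(1)]] \<kappa>_nonneg by simp
        ultimately have "potential x \<le> n\<^sup>2 / 4 / (x \<bullet> x) + 1 / 16 * (1 / 1 / (x \<bullet> x))"
          using curvature_error(2)[OF u x(1)] by linarith
        also have "\<dots> = (n\<^sup>2 / 4 + 1 / 16) * (1 / (x \<bullet> x))" by (simp add: add_divide_distrib)
        also have "\<dots> \<le> n\<^sup>2 * (1 / (x \<bullet> x))"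
        proof (rule mult_right_mono)
          have "1 \<le> n\<^sup>2" using n3 by (intro one_le_power) auto
          then show "n\<^sup>2 / 4 + 1 / 16 \<le> n\<^sup>2" by simp
        qed simp
        finally have "potential x * (?v x)\<^sup>2 \<le> n\<^sup>2 * (1 / (x \<bullet> x)) * (?v x)\<^sup>2"
          by (rule mult_right_mono) simp
        also have "\<dots> = n\<^sup>2 * S * (?\<eta> x)\<^sup>2" by (simp add: S_def power_mult_distrib)
        also have "\<dots> \<le> n\<^sup>2 * S * 256\<^sup>2" using e2 S by (intro mult_left_mono) auto
        finally show ?thesis by (simp add: mult_ac)
      qed
      moreover have "2 * (256\<^sup>2 * (norm p)\<^sup>2) \<le> cutoff_const n * (norm p)\<^sup>2"
        unfolding mult.assoc[symmetric] by (intro mult_right_mono) (auto simp: cutoff_const_def add_increasing2)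
      moreover have "2 * (2048\<^sup>2 * S) + 256\<^sup>2 * n\<^sup>2 * S = cutoff_const n * S" by (simp add: cutoff_const_def algebra_simps)
      ultimately have "(norm (?h x - ?v x *\<^sub>R drift x))\<^sup>2 + potential x * (?v x)\<^sup>2 \<le> cutoff_const n * (norm p)\<^sup>2 + cutoff_const n * S"
        by linarith
      then show ?thesis using x by (simp add: energy_density_def p_def S_def distrib_left)
    qed
  qed
  finally show ?thesis by simp
qed

lemma annulus_energy:
  assumes R: "0 < R" "R \<le> D"
  shows "(\<integral>x. indicator (dyadic_annulus R) x * energy_density x \<partial>lborel) \<le> 1025 * log_weight_at R * energy u g"
proof -
  have "(\<integral>x. indicator (dyadic_annulus R) x * energy_density x \<partial>lborel) \<le>
    (\<integral>x. (norm (g x - u x *\<^sub>R drift x))\<^sup>2 + indicator (dyadic_annulus R) x * (1 / (x \<bullet> x) * (u x)\<^sup>2) \<partial>lborel)"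
    by (intro integral_mono integrable_annulus integrable_energy_density Bochner_Integration.integrable_add integrable_energy[OF u])
      (auto simp: energy_density_def indicator_def)
  also have "\<dots> = energy u g + (\<integral>x. indicator (dyadic_annulus R) x * (1 / (x \<bullet> x) * (u x)\<^sup>2) \<partial>lborel)"
    unfolding energy_def
    by (rule Bochner_Integration.integral_add[OF integrable_energy[OF u] integrable_annulus[OF integrable_energy_density(1)]])
  also have "\<dots> \<le> 1 * energy u g + 1024 * log_weight_at R * energy u g" using annulus_hardy[OF u R] by simp
  also have "\<dots> \<le> log_weight_at R * energy u g + 1024 * log_weight_at R * energy u g"
    using log_weight_at_bounds(1)[OF R] energy_nonneg[OF u] by (intro add_right_mono mult_right_mono)
  finally show ?thesis by simp
qed

text \<open>
  On an annulus $l_k$ is comparable to $l$, so the logarithmic Hardy inequality bounds all the $u^2/|x|^2$ terms at once.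
\<close>
lemma sum_annuli_energy:
  shows "(\<Sum>k<N. (1 / log_weight_at (D / 2 ^ k))\<^sup>2 * (\<integral>x. indicator (dyadic_annulus (D / 2 ^ k)) x * energy_density x \<partial>lborel))
    \<le> 516 * energy u g"
proof -
  let ?R = "\<lambda>k. D / 2 ^ k"
  let ?I = "\<lambda>k x. indicator (dyadic_annulus (?R k)) x :: real"
  let ?P = "\<lambda>x. (norm (g x - u x *\<^sub>R drift x))\<^sup>2" and ?H = "\<lambda>x. 1 / (log_weight x)\<^sup>2 / (x \<bullet> x) * (u x)\<^sup>2"
  have R: "0 < ?R k" "?R k \<le> D" for k using D_pos by (auto simp: field_simps)
  have c: "continuous_on U log_weight" by (rule C1_on_continuous[OF C1_on_log_weight])
  have iH: "integrable lborel ?H" by (intro integrable_weight[OF u] continuous_intros c U_nz[OF u])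
  have iPH: "integrable lborel (\<lambda>x. ?P x + 16 * ?H x)"
    by (intro Bochner_Integration.integrable_add integrable_mult_right iH integrable_energy[OF u])
  have step: "(1 / log_weight_at (?R k))\<^sup>2 * (?I k x * energy_density x) \<le> ?I k x * (?P x + 16 * ?H x)" for k x
  proof (cases "x \<in> U \<and> x \<in> dyadic_annulus (?R k)")
    case False
    then show ?thesis using C1c_on_outside[OF u, of x] by (auto simp: energy_density_def)
  next
    case True
    then have x: "x \<in> U" "x \<in> dyadic_annulus (?R k)" by auto
    have r: "?R k / 4 \<le> norm x" "norm x > 0" using x U_D by (auto simp: dyadic_annulus_def)
    have LR: "log_weight_at (?R k) \<ge> 1" by (rule log_weight_at_bounds[OF R])
    have L: "log_weight x \<ge> 1" by (rule log_weight_bounds_U[OF x(1)])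
    have "log_weight x \<le> log_weight_at (?R k / 4)"
      unfolding log_weight_eq by (rule log_weight_at_antimono) (use r R[of k] in auto)
    also have "\<dots> = log_weight_at (?R k) + ln 4" by (rule log_weight_at_quarter[OF R(1)])
    also have "ln (4::real) \<le> 3" using ln_le_minus_one[of "4::real"] by simp
    finally have "log_weight x \<le> 4 * log_weight_at (?R k)" using LR by simp
    then have "1 / log_weight_at (?R k) \<le> 4 * (1 / log_weight x)" using L LR by (simp add: field_simps)
    then have "(1 / log_weight_at (?R k))\<^sup>2 \<le> (4 * (1 / log_weight x))\<^sup>2" using LR by (intro power_mono) auto
    then have 1: "(1 / log_weight_at (?R k))\<^sup>2 \<le> 16 * (1 / (log_weight x)\<^sup>2)" by (simp add: power_mult_distrib power_divide)
    have 2: "(1 / log_weight_at (?R k))\<^sup>2 \<le> 1" using LR by (simp add: power_le_one)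
    have "(1 / log_weight_at (?R k))\<^sup>2 * energy_density x = (1 / log_weight_at (?R k))\<^sup>2 * ?P x + (1 / log_weight_at (?R k))\<^sup>2 * (1 / (x \<bullet> x) * (u x)\<^sup>2)"
      by (simp add: energy_density_def distrib_left)
    also have "\<dots> \<le> 1 * ?P x + 16 * (1 / (log_weight x)\<^sup>2) * (1 / (x \<bullet> x) * (u x)\<^sup>2)"
      by (intro add_mono mult_right_mono 1 2) auto
    also have "\<dots> = ?P x + 16 * ?H x" by simp
    finally show ?thesis using x by simp
  qed
  have "(\<Sum>k<N. (1 / log_weight_at (?R k))\<^sup>2 * (\<integral>x. ?I k x * energy_density x \<partial>lborel))
    \<le> (\<Sum>k<N. (\<integral>x. ?I k x * (?P x + 16 * ?H x) \<partial>lborel))"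
  proof (rule sum_mono)
    fix k
    have "(1 / log_weight_at (?R k))\<^sup>2 * (\<integral>x. ?I k x * energy_density x \<partial>lborel) = (\<integral>x. (1 / log_weight_at (?R k))\<^sup>2 * (?I k x * energy_density x) \<partial>lborel)"
      by (simp only: integral_mult_right_zero)
    also have "\<dots> \<le> (\<integral>x. ?I k x * (?P x + 16 * ?H x) \<partial>lborel)"
      by (rule integral_mono[OF integrable_mult_right[OF integrable_annulus[OF integrable_energy_density(2)]] integrable_annulus[OF iPH] step])
    finally show "(1 / log_weight_at (?R k))\<^sup>2 * (\<integral>x. ?I k x * energy_density x \<partial>lborel) \<le> (\<integral>x. ?I k x * (?P x + 16 * ?H x) \<partial>lborel)" .
  qed
  also have "\<dots> = (\<integral>x. (\<Sum>k<N. ?I k x * (?P x + 16 * ?H x)) \<partial>lborel)"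
    by (rule Bochner_Integration.integral_sum[symmetric]) (rule integrable_annulus[OF iPH])
  also have "\<dots> \<le> (\<integral>x. 4 * (?P x + 16 * ?H x) \<partial>lborel)"
  proof (rule integral_mono)
    show "integrable lborel (\<lambda>x. \<Sum>k<N. ?I k x * (?P x + 16 * ?H x))"
      by (intro Bochner_Integration.integrable_sum integrable_annulus iPH)
    show "integrable lborel (\<lambda>x. 4 * (?P x + 16 * ?H x))" by (intro integrable_mult_right iPH)
    fix x
    have "?P x + 16 * ?H x \<ge> 0" by (intro add_nonneg_nonneg mult_nonneg_nonneg) auto
    then show "(\<Sum>k<N. ?I k x * (?P x + 16 * ?H x)) \<le> 4 * (?P x + 16 * ?H x)"
      unfolding sum_distrib_right[symmetric] by (intro mult_right_mono dyadic_annuli_overlap D_pos)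
  qed
  also have "\<dots> = 4 * (energy u g + 16 * (\<integral>x. ?H x \<partial>lborel))"
    unfolding energy_def
    by (simp only: integral_mult_right_zero
      Bochner_Integration.integral_add[OF integrable_energy[OF u] integrable_mult_right[OF iH]])
  also have "\<dots> \<le> 4 * (energy u g + 16 * (8 * energy u g))" using log_hardy[OF u] by simp
  finally show ?thesis by simp
qed

lemma dyadic_index:
  assumes r: "0 < r" "r < D"
  obtains k where "D / 2 ^ k / 2 \<le> r" "r \<le> D / 2 ^ k" "\<And>N. D / 2 ^ N \<le> r \<Longrightarrow> k < N"
proof -
  obtain N0 :: nat where "D / r < 2 ^ N0" using real_arch_pow[of 2 "D / r"] by auto
  then have ex: "D / 2 ^ N0 \<le> r" using r by (simp add: field_simps)
  define j where "j = (LEAST j. D / 2 ^ j \<le> r)"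
  have j: "D / 2 ^ j \<le> r" unfolding j_def using ex by (rule LeastI)
  have min: "j \<le> N" if "D / 2 ^ N \<le> r" for N unfolding j_def using that by (rule Least_le)
  have "j \<noteq> 0" using j r by (cases j) auto
  then obtain k where k: "j = Suc k" using not0_implies_Suc by blast
  have "\<not> D / 2 ^ k \<le> r" using min[of k] k by auto
  then show ?thesis using j min k by (intro that[of k]) (auto simp: Suc_le_eq mult.commute)
qed

text \<open>
  The exponent of $1/l$ is $q/2 + 1$ with $q = 2n/(n-2)$. Local Sobolev inequalities produce $e_k^{q/2}$; of these powers $q/2 - 1$ are
  spent on $e_k \le C\,l_k\cdot\mathrm{energy}$, which leaves $l_k^{-2}e_k$ to be summed.
\<close>
theorem hardy_sobolev_energy:
  "(\<integral>x. (1 / log_weight x) powr ((2 * n - 2) / (n - 2)) * \<bar>u x\<bar> powr (2 * n / (n - 2)) \<partial>lborel) powr ((n - 2) / n)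
    \<le> 16400 * local_sobolev_const n * energy u g"
proof -
  define q where "q = 2 * n / (n - 2)"
  define p where "p = (2 * n - 2) / (n - 2)"
  have q: "q > 1" "q / 2 - 1 > 0" "p > 0" "q / 2 = n / (n - 2)"
    using n3 by (auto simp: q_def p_def field_simps)
  have "p = 2 + 2 / (n - 2)" "q / 2 - 1 = 2 / (n - 2)"
    using n3 by (auto simp: q_def p_def field_simps)
  then have pq: "p - (q / 2 - 1) = 2" by simp
  let ?R = "\<lambda>k. D / 2 ^ k"
  let ?\<eta> = "\<lambda>k. annular_cutoff (?R k)" and ?\<eta>' = "\<lambda>k. annular_cutoff_grad (?R k)"
  have R: "0 < ?R k" "?R k \<le> D" for k using D_pos by (auto simp: field_simps)
  have LR: "log_weight_at (?R k) \<ge> 1" for k by (rule log_weight_at_bounds[OF R])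
  define E where "E = energy u g"
  have E: "E \<ge> 0" unfolding E_def by (rule energy_nonneg[OF u])
  define A where "A k = (\<integral>x. indicator (dyadic_annulus (?R k)) x * energy_density x \<partial>lborel)" for k
  have A: "A k \<ge> 0" "A k \<le> 1025 * log_weight_at (?R k) * E" for k
    unfolding A_def E_def using annulus_energy[OF R] energy_density_nonneg by (auto intro!: integral_nonneg_AE)
  obtain K where K: "compact K" "K \<subseteq> U" "\<And>x. x \<notin> K \<Longrightarrow> u x = 0"
    using u unfolding C1c_on_def by blast
  obtain \<delta> where \<delta>: "\<delta> > 0" "\<And>x. x \<in> K \<Longrightarrow> \<delta> \<le> norm x"
  proof -
    have "closed K" "0 \<notin> K" using K U_D(1) compact_imp_closed by blast+
    then obtain \<delta> where "\<delta> > 0" "ball 0 \<delta> \<subseteq> - K" using open_contains_ball[of "- K"] by auto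
    then show ?thesis by (intro that[of \<delta>]) (auto simp: subset_iff not_less[symmetric])
  qed
  (* The support stays away from the origin, so finitely many annuli cover it. *)
  obtain N :: nat where "D / \<delta> < 2 ^ N" using real_arch_pow[of 2 "D / \<delta>"] by auto
  then have N: "?R N \<le> \<delta>" using \<delta> by (simp add: field_simps)
  have v: "C1c_on U (\<lambda>x. ?\<eta> k x * u x) (\<lambda>x. ?\<eta> k x *\<^sub>R g x + u x *\<^sub>R ?\<eta>' k x)" for k
    by (intro C1c_on_mult open_U u C1_on_annular_cutoff R)
  have iv: "integrable lborel (\<lambda>x. \<bar>?\<eta> k x * u x\<bar> powr q)" for k
    using C1_on_continuous[OF C1c_on_C1[OF C1c_on_abs_powr[OF v open_U q(1)]], of U] q(1)
    by (intro integrable_C1c_on[OF v]) auto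
  have sob: "(\<integral>x. \<bar>?\<eta> k x * u x\<bar> powr q \<partial>lborel) \<le> (local_sobolev_const n * A k) powr (q / 2)" for k
  proof -
    have "(\<integral>x. \<bar>?\<eta> k x * u x\<bar> powr q \<partial>lborel)
      \<le> ((2 * (n - 1) / (n - 2))\<^sup>2 * (\<integral>x. (norm (?\<eta> k x *\<^sub>R g x + u x *\<^sub>R ?\<eta>' k x))\<^sup>2 \<partial>lborel)) powr (n / (n - 2))"
      unfolding q_def n_eq by (rule sobolev_inequality[OF v open_U]) (use n3 n_eq in simp)
    also have "\<dots> \<le> ((2 * (n - 1) / (n - 2))\<^sup>2 * (cutoff_const n * A k)) powr (n / (n - 2))"
      unfolding A_def using n3
      by (intro powr_mono2 mult_left_mono cutoff_energy R mult_nonneg_nonneg integral_nonneg_AE) auto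
    finally show ?thesis by (simp add: local_sobolev_const_def q(4) mult.assoc)
  qed
  (* All but one of the powers of A k are estimated by the bound of the annulus in terms of the total energy. *)
  have X: "(1 / log_weight_at (?R k)) powr p * (local_sobolev_const n * A k) powr (q / 2)
    \<le> (1025 * local_sobolev_const n * E) powr (q / 2 - 1) * local_sobolev_const n * ((1 / log_weight_at (?R k))\<^sup>2 * A k)" for k
  proof -
    have CA: "local_sobolev_const n * A k \<ge> 0" using A local_sobolev_const_pos by simp
    have "(local_sobolev_const n * A k) powr (q / 2) = (local_sobolev_const n * A k) * (local_sobolev_const n * A k) powr (q / 2 - 1)"
      using powr_mult_base[OF CA, of "q / 2 - 1"] by simp
    also have "\<dots> \<le> (local_sobolev_const n * A k) * (1025 * local_sobolev_const n * E * log_weight_at (?R k)) powr (q / 2 - 1)"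
    proof (intro mult_left_mono powr_mono2 CA)
      have "local_sobolev_const n * A k \<le> local_sobolev_const n * (1025 * log_weight_at (?R k) * E)" using A local_sobolev_const_pos by (intro mult_left_mono) auto
      then show "local_sobolev_const n * A k \<le> 1025 * local_sobolev_const n * E * log_weight_at (?R k)" by (simp add: mult_ac)
    qed (use q(2) in linarith)
    also have "(1025 * local_sobolev_const n * E * log_weight_at (?R k)) powr (q / 2 - 1)
      = (1025 * local_sobolev_const n * E) powr (q / 2 - 1) * log_weight_at (?R k) powr (q / 2 - 1)"
      by (rule powr_mult)
    finally have "(1 / log_weight_at (?R k)) powr p * (local_sobolev_const n * A k) powr (q / 2)
      \<le> (1 / log_weight_at (?R k)) powr p * ((local_sobolev_const n * A k) * ((1025 * local_sobolev_const n * E) powr (q / 2 - 1) * log_weight_at (?R k) powr (q / 2 - 1)))"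
      by (intro mult_left_mono) auto
    also have "\<dots> = (1025 * local_sobolev_const n * E) powr (q / 2 - 1) * local_sobolev_const n * (((1 / log_weight_at (?R k)) powr p * log_weight_at (?R k) powr (q / 2 - 1)) * A k)"
      by (simp add: mult_ac)
    also have "(1 / log_weight_at (?R k)) powr p * log_weight_at (?R k) powr (q / 2 - 1) = (1 / log_weight_at (?R k))\<^sup>2"
    proof -
      have "(1 / log_weight_at (?R k)) powr p * log_weight_at (?R k) powr (q / 2 - 1) = log_weight_at (?R k) powr (- p) * log_weight_at (?R k) powr (q / 2 - 1)"
        using LR[of k] by (simp add: powr_divide powr_minus_divide)
      also have "\<dots> = log_weight_at (?R k) powr (- (p - (q / 2 - 1)))" by (simp add: powr_add[symmetric])
      also have "\<dots> = log_weight_at (?R k) powr (- 2)" unfolding pq ..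
      also have "\<dots> = (1 / log_weight_at (?R k))\<^sup>2"
        using LR[of k] by (simp add: powr_minus_divide power_divide powr_numeral)
      finally show ?thesis .
    qed
    finally show ?thesis .
  qed
  have pw: "(1 / log_weight x) powr p * \<bar>u x\<bar> powr q
    \<le> (\<Sum>k<N. 4 powr q * ((1 / log_weight_at (?R k)) powr p * \<bar>?\<eta> k x * u x\<bar> powr q))" for x
  proof (cases "u x = 0")
    case True
    then show ?thesis by simp
  next
    case False
    then have x: "x \<in> U" "\<delta> \<le> norm x" using K \<delta> by blast+
    have r: "0 < norm x" "norm x < D" using U_D[OF x(1)] by auto
    obtain k where k: "?R k / 2 \<le> norm x" "norm x \<le> ?R k" "k < N"
      using dyadic_index[OF r] N x(2) by (metis order_trans)
    have e: "?\<eta> k x \<ge> 1 / 4" by (rule annular_cutoff_ge[OF R(1) k(1,2)])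
    have "\<bar>u x\<bar> \<le> 4 * \<bar>?\<eta> k x * u x\<bar>" using mult_right_mono[OF e, of "\<bar>u x\<bar>"] e by (simp add: abs_mult)
    then have "\<bar>u x\<bar> powr q \<le> (4 * \<bar>?\<eta> k x * u x\<bar>) powr q" using q(1) by (intro powr_mono2) auto
    also have "\<dots> = 4 powr q * \<bar>?\<eta> k x * u x\<bar> powr q" by (rule powr_mult)
    finally have 1: "\<bar>u x\<bar> powr q \<le> 4 powr q * \<bar>?\<eta> k x * u x\<bar> powr q" .
    have "log_weight_at (?R k) \<le> log_weight x" unfolding log_weight_eq by (rule log_weight_at_antimono) (use k r in auto)
    then have "(1 / log_weight x) powr p \<le> (1 / log_weight_at (?R k)) powr p"
      using LR[of k] q(3) by (intro powr_mono2) (auto intro!: divide_left_mono mult_pos_pos)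
    then have "(1 / log_weight x) powr p * \<bar>u x\<bar> powr q \<le> (1 / log_weight_at (?R k)) powr p * (4 powr q * \<bar>?\<eta> k x * u x\<bar> powr q)"
      using 1 by (intro mult_mono) auto
    also have "\<dots> = 4 powr q * ((1 / log_weight_at (?R k)) powr p * \<bar>?\<eta> k x * u x\<bar> powr q)" by simp
    also have "\<dots> \<le> (\<Sum>k<N. 4 powr q * ((1 / log_weight_at (?R k)) powr p * \<bar>?\<eta> k x * u x\<bar> powr q))"
      by (rule member_le_sum) (use k in auto)
    finally show ?thesis .
  qed
  define I where "I = (\<integral>x. (1 / log_weight x) powr p * \<bar>u x\<bar> powr q \<partial>lborel)"
  have "I \<le> (\<integral>x. (\<Sum>k<N. 4 powr q * ((1 / log_weight_at (?R k)) powr p * \<bar>?\<eta> k x * u x\<bar> powr q)) \<partial>lborel)"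
    unfolding I_def
  proof (rule integral_mono[OF _ _ pw])
    have cu: "continuous_on U (\<lambda>x. \<bar>u x\<bar> powr q)"
      by (rule C1_on_continuous[OF C1c_on_C1[OF C1c_on_abs_powr[OF u open_U q(1)]]])
    have cl: "continuous_on U log_weight" by (rule C1_on_continuous[OF C1_on_log_weight])
    have "continuous_on U (\<lambda>x. (1 / log_weight x) powr p)"
      by (intro continuous_on_powr continuous_intros cl U_nz[OF u]) (use U_nz[OF u] in auto)
    then show "integrable lborel (\<lambda>x. (1 / log_weight x) powr p * \<bar>u x\<bar> powr q)"
      by (intro integrable_C1c_on[OF u] continuous_on_mult cu) auto
  qed (intro Bochner_Integration.integrable_sum integrable_mult_right iv)
  also have "\<dots> = (\<Sum>k<N. 4 powr q * ((1 / log_weight_at (?R k)) powr p * (\<integral>x. \<bar>?\<eta> k x * u x\<bar> powr q \<partial>lborel)))"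
    by (subst Bochner_Integration.integral_sum) (auto intro!: integrable_mult_right iv)
  also have "\<dots> \<le> (\<Sum>k<N. 4 powr q * ((1025 * local_sobolev_const n * E) powr (q / 2 - 1) * local_sobolev_const n * ((1 / log_weight_at (?R k))\<^sup>2 * A k)))"
    by (intro sum_mono mult_left_mono order_trans[OF mult_left_mono[OF sob] X]) auto
  also have "\<dots> = 4 powr q * ((1025 * local_sobolev_const n * E) powr (q / 2 - 1) * local_sobolev_const n * (\<Sum>k<N. (1 / log_weight_at (?R k))\<^sup>2 * A k))"
    by (simp only: sum_distrib_left)
  also have "\<dots> \<le> 4 powr q * ((1025 * local_sobolev_const n * E) powr (q / 2 - 1) * local_sobolev_const n * (1025 * E))"
  proof (intro mult_left_mono)
    have "(\<Sum>k<N. (1 / log_weight_at (?R k))\<^sup>2 * A k) \<le> 516 * E" unfolding A_def E_def by (rule sum_annuli_energy)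
    then show "(\<Sum>k<N. (1 / log_weight_at (?R k))\<^sup>2 * A k) \<le> 1025 * E" using E by linarith
  qed (use local_sobolev_const_pos in auto)
  also have "\<dots> = 4 powr q * ((1025 * local_sobolev_const n * E) * (1025 * local_sobolev_const n * E) powr (q / 2 - 1))" by simp
  also have "\<dots> = 4 powr q * (1025 * local_sobolev_const n * E) powr (q / 2)"
    using powr_mult_base[of "1025 * local_sobolev_const n * E" "q / 2 - 1"] local_sobolev_const_pos E by simp
  finally have le: "I \<le> 4 powr q * (1025 * local_sobolev_const n * E) powr (q / 2)" .
  have "I \<ge> 0" unfolding I_def by (intro integral_nonneg_AE) auto
  then have "I powr (2 / q) \<le> (4 powr q * (1025 * local_sobolev_const n * E) powr (q / 2)) powr (2 / q)"
    using le q(1) by (intro powr_mono2) auto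
  also have "\<dots> = (4 powr q) powr (2 / q) * ((1025 * local_sobolev_const n * E) powr (q / 2)) powr (2 / q)"
    by (rule powr_mult)
  also have "(4 powr q) powr (2 / q) = (16::real)"
  proof -
    have "q * (2 / q) = 2" using q(1) by simp
    then show ?thesis unfolding powr_powr by simp
  qed
  also have "((1025 * local_sobolev_const n * E) powr (q / 2)) powr (2 / q) = 1025 * local_sobolev_const n * E"
  proof -
    have "q / 2 * (2 / q) = 1" using q(1) by simp
    then show ?thesis unfolding powr_powr using local_sobolev_const_pos E by simp
  qed
  finally have "I powr (2 / q) \<le> 16400 * local_sobolev_const n * E" by simp
  moreover have "2 / q = (n - 2) / n" using n3 by (simp add: q_def field_simps)
  ultimately show ?thesis by (simp add: I_def E_def q_def p_def)
qed

end

end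

section \<open>Smooth functions on open sets and a bump function\<close>

text \<open>
  Localizing the classes to open sets allows functions to be glued from pieces, and makes singular factors such as powers of the norm available away
  from their singularity.
\<close>
fun Ck_on :: "nat \<Rightarrow> 'a::real_normed_vector set \<Rightarrow> ('a \<Rightarrow> real) \<Rightarrow> bool" where
  "Ck_on 0 U f \<longleftrightarrow> continuous_on U f"
| "Ck_on (Suc k) U f \<longleftrightarrow> (\<forall>x\<in>U. f differentiable (at x)) \<and>
     (\<forall>v. Ck_on k U (\<lambda>x. frechet_derivative f (at x) v))"

lemma Ck_on_UNIV: "Ck_on k UNIV f \<longleftrightarrow> Ck k f"
  by (induction k arbitrary: f) auto

lemma Ck_on_cong:
  assumes "open U" "\<And>x. x \<in> U \<Longrightarrow> f x = g x" "Ck_on k U f"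
  shows "Ck_on k U g"
  using assms(2,3)
proof (induction k arbitrary: f g)
  case 0
  then have "continuous_on U f = continuous_on U g" by (intro continuous_on_cong) auto
  then show ?case using 0 by simp
next
  case (Suc k)
  have der: "(g has_derivative frechet_derivative f (at x)) (at x)" if x: "x \<in> U" for x
  proof (rule has_derivative_transform_within_open[OF _ assms(1) x])
    show "(f has_derivative frechet_derivative f (at x)) (at x)"
      using Suc.prems(2) x by (auto simp: frechet_derivative_works)
  qed (use Suc.prems in auto)
  then have fd: "frechet_derivative g (at x) = frechet_derivative f (at x)" if "x \<in> U" for x
    using frechet_derivative_at[OF der[OF that]] by simp
  have "Ck_on k U (\<lambda>x. frechet_derivative g (at x) v)" for v
    by (rule Suc.IH[of "\<lambda>x. frechet_derivative f (at x) v"]) (use Suc.prems fd in auto)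
  then show ?case using der by (auto simp: differentiable_def)
qed

lemma Ck_on_SucI:
  assumes U: "open U" and der: "\<And>x. x \<in> U \<Longrightarrow> (f has_derivative f' x) (at x)"
    and C: "\<And>v. Ck_on k U (\<lambda>x. f' x v)"
  shows "Ck_on (Suc k) U f"
proof -
  have "f' x = frechet_derivative f (at x)" if "x \<in> U" for x
    by (rule frechet_derivative_at[OF der[OF that]])
  then have "Ck_on k U (\<lambda>x. frechet_derivative f (at x) v)" for v
    by (intro Ck_on_cong[OF U _ C[of v]]) auto
  then show ?thesis using der by (auto simp: differentiable_def)
qed

lemma Ck_on_SucD: "Ck_on (Suc k) U f \<Longrightarrow> x \<in> U \<Longrightarrow> (f has_derivative frechet_derivative f (at x)) (at x)"
  by (auto simp: frechet_derivative_works)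

lemma Ck_on_lower: "Ck_on (Suc k) U f \<Longrightarrow> Ck_on k U f"
proof (induction k arbitrary: f)
  case 0
  then have "isCont f x" if "x \<in> U" for x
    using that differentiable_imp_continuous_within[of f x UNIV] by simp
  then show ?case by (simp add: continuous_at_imp_continuous_on)
next
  case (Suc k)
  have "\<forall>x\<in>U. f differentiable (at x)" "\<And>v. Ck_on (Suc k) U (\<lambda>x. frechet_derivative f (at x) v)"
    using Suc.prems unfolding Ck_on.simps(2)[of "Suc k"] by blast+
  with Suc.IH have "\<forall>v. Ck_on k U (\<lambda>x. frechet_derivative f (at x) v)" by blast
  with \<open>\<forall>x\<in>U. f differentiable (at x)\<close> show ?case by simp
qed

lemma Ck_on_Un:
  assumes "open U" "open V" "Ck_on k U f" "Ck_on k V f"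
  shows "Ck_on k (U \<union> V) f"
  using assms(3,4)
  by (induction k arbitrary: f) (auto intro: continuous_on_open_Un assms(1,2))

lemma Ck_on_const: "Ck_on k U (\<lambda>_. c)"
proof (induction k arbitrary: c)
  case (Suc k)
  have "Ck_on k U (\<lambda>_. frechet_derivative (\<lambda>_::'a. c) (at x) v)" for x v
    by (rule Suc)
  then show ?case using Suc by simp
qed simp

lemma Ck_on_linear:
  assumes "open U" "bounded_linear f"
  shows "Ck_on k U f"
proof (cases k)
  case 0
  then show ?thesis using assms by (simp add: linear_continuous_on)
next
  case (Suc j)
  have "Ck_on (Suc j) U f"
    by (rule Ck_on_SucI[where f'="\<lambda>_. f"])
      (auto intro: assms bounded_linear_imp_has_derivative Ck_on_const)
  then show ?thesis by (simp only: Suc)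
qed

lemma Ck_on_add:
  assumes U: "open U" and "Ck_on k U f" "Ck_on k U g"
  shows "Ck_on k U (\<lambda>x. f x + g x)"
  using assms(2,3)
proof (induction k arbitrary: f g)
  case (Suc k)
  show ?case
  proof (rule Ck_on_SucI[OF U])
    show "((\<lambda>x. f x + g x) has_derivative (\<lambda>v. frechet_derivative f (at x) v + frechet_derivative g (at x) v)) (at x)"
      if "x \<in> U" for x by (intro has_derivative_add Ck_on_SucD[OF Suc.prems(1) that] Ck_on_SucD[OF Suc.prems(2) that])
    show "Ck_on k U (\<lambda>x. frechet_derivative f (at x) v + frechet_derivative g (at x) v)" for v
      by (rule Suc.IH) (use Suc.prems in auto)
  qed
qed (auto intro: continuous_intros)

lemma Ck_on_mult:
  assumes U: "open U" and "Ck_on k U f" "Ck_on k U g"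
  shows "Ck_on k U (\<lambda>x. f x * g x)"
  using assms(2,3)
proof (induction k arbitrary: f g)
  case (Suc k)
  show ?case
  proof (rule Ck_on_SucI[OF U])
    show "((\<lambda>x. f x * g x) has_derivative (\<lambda>v. f x * frechet_derivative g (at x) v + frechet_derivative f (at x) v * g x)) (at x)"
      if "x \<in> U" for x
      by (intro has_derivative_mult Ck_on_SucD[OF Suc.prems(1) that] Ck_on_SucD[OF Suc.prems(2) that])
    show "Ck_on k U (\<lambda>x. f x * frechet_derivative g (at x) v + frechet_derivative f (at x) v * g x)" for v
    proof (intro Ck_on_add[OF U] Suc.IH)
      show "Ck_on k U f" "Ck_on k U g" using Suc.prems Ck_on_lower by blast+
    qed (use Suc.prems in auto)
  qed
qed (auto intro: continuous_intros)

lemma Ck_on_comp: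
  fixes \<Phi> :: "real \<Rightarrow> real"
  assumes U: "open U" and "Ck_on k V \<Phi>" "Ck_on k U f" and sub: "f ` U \<subseteq> V"
  shows "Ck_on k U (\<lambda>x. \<Phi> (f x))"
  using assms(2,3)
proof (induction k arbitrary: \<Phi>)
  case 0
  then have "continuous_on V \<Phi>" "continuous_on U f" by simp_all
  then show ?case unfolding Ck_on.simps by (rule continuous_on_compose2[OF _ _ sub])
next
  case (Suc k)
  let ?\<Phi>' = "\<lambda>t. frechet_derivative \<Phi> (at t) 1"
  show ?case
  proof (rule Ck_on_SucI[OF U])
    fix x assume x: "x \<in> U"
    then have "(\<Phi> has_derivative frechet_derivative \<Phi> (at (f x))) (at (f x))"
      using sub by (intro Ck_on_SucD[OF Suc.prems(1)]) auto
    then have comp: "((\<lambda>x. \<Phi> (f x)) has_derivative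
        (\<lambda>v. frechet_derivative \<Phi> (at (f x)) (frechet_derivative f (at x) v))) (at x)"
      by (rule has_derivative_compose[OF Ck_on_SucD[OF Suc.prems(2) x]])
    have "linear (frechet_derivative \<Phi> (at (f x)))"
      using sub x Suc.prems(1) by (intro linear_frechet_derivative) auto
    then have "frechet_derivative \<Phi> (at (f x)) w = ?\<Phi>' (f x) * w" for w
      using linear_scale[of "frechet_derivative \<Phi> (at (f x))" w 1] by (simp add: mult.commute)
    then have "(\<lambda>v. frechet_derivative \<Phi> (at (f x)) (frechet_derivative f (at x) v))
      = (\<lambda>v. ?\<Phi>' (f x) * frechet_derivative f (at x) v)"
      by (rule ext)
    from comp[unfolded this]
    show "((\<lambda>x. \<Phi> (f x)) has_derivative (\<lambda>v. ?\<Phi>' (f x) * frechet_derivative f (at x) v)) (at x)" .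
  next
    fix v
    have f: "Ck_on k U f" using Suc.prems(2) by (rule Ck_on_lower)
    have "Ck_on k V ?\<Phi>'" using Suc.prems(1) by simp
    from Suc.IH[OF this f] have "Ck_on k U (\<lambda>x. ?\<Phi>' (f x))" .
    then show "Ck_on k U (\<lambda>x. ?\<Phi>' (f x) * frechet_derivative f (at x) v)"
      using Suc.prems(2) by (intro Ck_on_mult[OF U]) auto
  qed
qed

text \<open>
  A sequence of functions, each the derivative of its predecessor, witnesses smoothness of all its members.
\<close>
lemma Ck_on_derivative_sequence:
  fixes f :: "nat \<Rightarrow> real \<Rightarrow> real"
  assumes U: "open U" and der: "\<And>j t. t \<in> U \<Longrightarrow> (f j has_real_derivative f (Suc j) t) (at t)"
  shows "Ck_on k U (f j)"
proof (induction k arbitrary: j)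
  case 0
  have "isCont (f j) t" if "t \<in> U" for t by (rule DERIV_isCont[OF der[OF that]])
  then show ?case by (simp add: continuous_at_imp_continuous_on)
next
  case (Suc k)
  show ?case
  proof (rule Ck_on_SucI[OF U])
    show "(f j has_derivative (\<lambda>v. f (Suc j) t * v)) (at t)" if "t \<in> U" for t
      using der[OF that, of j] by (simp add: has_field_derivative_def)
    show "Ck_on k U (\<lambda>t. f (Suc j) t * v)" for v
      by (intro Ck_on_mult[OF U] Suc Ck_on_const)
  qed
qed

lemma Ck_on_powr: "Ck_on k {0<..} (\<lambda>t. t powr a)"
proof -
  define f where "f j t = (\<Prod>i<j. a - real i) * t powr (a - real j)" for j and t :: real
  have "Ck_on k {0<..} (f 0)"
  proof (rule Ck_on_derivative_sequence)
    fix j and t :: real assume "t \<in> {0<..}"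
    then show "(f j has_real_derivative f (Suc j) t) (at t)"
      unfolding f_def by (auto intro!: derivative_eq_intros simp: algebra_simps)
  qed simp
  moreover have "f 0 = (\<lambda>t. t powr a)" by (simp add: f_def fun_eq_iff)
  ultimately show ?thesis by simp
qed

text \<open>
  The standard smooth function that vanishes on a half line.
\<close>
definition flat_exp :: "real \<Rightarrow> real" where
  "flat_exp t = (if t > 0 then exp (- 1 / t) else 0)"

definition flat_exp' :: "real \<Rightarrow> real" where
  "flat_exp' t = (if t > 0 then exp (- 1 / t) / t\<^sup>2 else 0)"

text \<open>
  Numerators: the $k$-th derivative of $\exp(-1/t)$ is \<open>flat_poly k\<close>, evaluated at $1/t$, times $\exp(-1/t)$.
\<close>
fun flat_poly :: "nat \<Rightarrow> real poly" where
  "flat_poly 0 = 1"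
| "flat_poly (Suc k) = monom 1 2 * (flat_poly k - pderiv (flat_poly k))"

definition flat_deriv :: "nat \<Rightarrow> real \<Rightarrow> real" where
  "flat_deriv k t = (if t > 0 then poly (flat_poly k) (1 / t) * exp (- 1 / t) else 0)"

lemma poly_times_exp_minus_tendsto_0: "((\<lambda>y. poly p y * exp (- y)) \<longlongrightarrow> 0) at_top" for p :: "real poly"
proof -
  have "((\<lambda>y. \<Sum>i\<le>degree p. coeff p i * (y ^ i / exp y)) \<longlongrightarrow> (\<Sum>i\<le>degree p. coeff p i * 0)) at_top"
    by (intro tendsto_intros tendsto_power_div_exp_0)
  then show ?thesis
    by (simp add: poly_altdef sum_distrib_right exp_minus divide_inverse mult.assoc)
qed

lemma DERIV_flat_deriv: "(flat_deriv k has_real_derivative flat_deriv (Suc k) t) (at t)"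
proof -
  consider "t > 0" | "t < 0" | "t = 0" by linarith
  then show ?thesis
  proof cases
    case 1
    have "((\<lambda>t. poly (flat_poly k) (1 / t) * exp (- 1 / t)) has_real_derivative flat_deriv (Suc k) t) (at t)"
      using 1 unfolding flat_deriv_def
      by (auto intro!: derivative_eq_intros DERIV_chain2[OF poly_DERIV]
          simp: poly_monom power2_eq_square field_simps)
    then show ?thesis
      by (rule has_field_derivative_transform_within_open[of _ _ _ "{0<..}"])
        (use 1 in \<open>auto simp: flat_deriv_def\<close>)
  next
    case 2
    have "((\<lambda>t. 0) has_real_derivative flat_deriv (Suc k) t) (at t)"
      using 2 by (simp add: flat_deriv_def)
    then show ?thesis
      by (rule has_field_derivative_transform_within_open[of _ _ _ "{..<0}"])
        (use 2 in \<open>auto simp: flat_deriv_def\<close>)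
  next
    case 3
    have "((\<lambda>h. flat_deriv k h / h) \<longlongrightarrow> 0) (at 0)"
    proof (rule filterlim_split_at)
      show "((\<lambda>h. flat_deriv k h / h) \<longlongrightarrow> 0) (at_left 0)"
        by (rule tendsto_eventually) (auto simp: eventually_at_left_field flat_deriv_def intro!: exI[of _ "-1"])
      have "((\<lambda>h. poly (pCons 0 (flat_poly k)) (inverse h) * exp (- inverse h)) \<longlongrightarrow> 0) (at_right (0::real))"
        by (rule filterlim_compose[OF poly_times_exp_minus_tendsto_0 filterlim_inverse_at_top_right])
      then show "((\<lambda>h. flat_deriv k h / h) \<longlongrightarrow> 0) (at_right 0)"
      proof (rule Lim_transform_eventually)
        show "\<forall>\<^sub>F h in at_right 0. poly (pCons 0 (flat_poly k)) (inverse h) * exp (- inverse h) = flat_deriv k h / h"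
          by (auto simp: eventually_at_right_field flat_deriv_def divide_inverse intro!: exI[of _ 1])
      qed
    qed
    then show ?thesis using 3 by (simp add: DERIV_def flat_deriv_def)
  qed
qed

lemma flat_exp_eq: "flat_exp = flat_deriv 0" "flat_exp' = flat_deriv 1"
  by (auto simp: flat_exp_def flat_exp'_def flat_deriv_def poly_monom fun_eq_iff power_divide)

lemma Ck_on_flat_exp: "Ck_on k UNIV flat_exp"
  unfolding flat_exp_eq by (rule Ck_on_derivative_sequence) (auto intro: DERIV_flat_deriv)

lemma DERIV_flat_exp: "(flat_exp has_real_derivative flat_exp' t) (at t)"
  using DERIV_flat_deriv[of 0 t] by (simp add: flat_exp_eq)

lemma continuous_flat_exp': "continuous_on A flat_exp'"
  unfolding flat_exp_eq by (intro continuous_at_imp_continuous_on ballI DERIV_isCont[OF DERIV_flat_deriv])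

lemma flat_exp_bounds: "0 \<le> flat_exp t" "flat_exp t \<le> 1"
  by (auto simp: flat_exp_def)

lemma flat_exp'_bounds: "0 \<le> flat_exp' t" "flat_exp' t \<le> 2" "t > 0 \<Longrightarrow> flat_exp' t \<le> 1 / t\<^sup>2"
proof -
  show "0 \<le> flat_exp' t" by (simp add: flat_exp'_def)
  show "flat_exp' t \<le> 1 / t\<^sup>2" if "t > 0"
    using that by (auto simp: flat_exp'_def intro!: divide_right_mono)
  show "flat_exp' t \<le> 2"
  proof (cases "t > 0")
    case True
    have "1 + 1 / t + (1 / t)\<^sup>2 / 2 \<le> exp (1 / t)" by (rule exp_lower_Taylor_quadratic) (use True in simp)
    moreover have "1 / t > 0" using True by simp
    ultimately have "(1 / t)\<^sup>2 / 2 \<le> exp (1 / t)" by linarith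
    then have "(1 / t)\<^sup>2 / 2 * exp (- (1 / t)) \<le> exp (1 / t) * exp (- (1 / t))" by (intro mult_right_mono) auto
    also have "\<dots> = 1" by (simp add: exp_add[symmetric])
    finally show ?thesis using True by (simp add: flat_exp'_def power_divide field_simps)
  qed (simp add: flat_exp'_def)
qed

text \<open>
  For the cut-off $t \mapsto$ \<open>flat_exp\<close>$(t/\epsilon - 1)$, the derivative times the distance $t$ to the
  boundary is bounded uniformly in $\epsilon$ and tends to zero as $\epsilon \to 0$ for fixed $t$.
\<close>
lemma flat_exp'_cutoff_bounds:
  assumes "s > 0"
  shows "s * flat_exp' (s - 1) \<le> 4" "s \<ge> 2 \<Longrightarrow> s * flat_exp' (s - 1) \<le> 4 / s"
proof -
  show *: "s * flat_exp' (s - 1) \<le> 4 / s" if "s \<ge> 2" for s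
  proof -
    have "s / 2 \<le> s - 1" using that by simp
    then have "(s / 2)\<^sup>2 \<le> (s - 1)\<^sup>2" using that by (intro power_mono) auto
    have "flat_exp' (s - 1) \<le> 1 / (s - 1)\<^sup>2" using that by (intro flat_exp'_bounds) auto
    also have "\<dots> \<le> 1 / (s / 2)\<^sup>2" using \<open>(s / 2)\<^sup>2 \<le> (s - 1)\<^sup>2\<close> that by (intro divide_left_mono) auto
    finally have "s * flat_exp' (s - 1) \<le> s * (1 / (s / 2)\<^sup>2)" using that by (intro mult_left_mono) auto
    then show ?thesis using that by (simp add: power2_eq_square)
  qed
  show "s * flat_exp' (s - 1) \<le> 4"
  proof (cases "s \<ge> 2")
    case True
    then have "4 / s \<le> 4" by (simp add: field_simps)
    then show ?thesis using *[OF True] by linarith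
  next
    case False
    then have "s * flat_exp' (s - 1) \<le> 2 * 2" using assms flat_exp'_bounds by (intro mult_mono) auto
    then show ?thesis by simp
  qed
qed

text \<open>
  The support is the interval from $1/4$ to $1/2$, so that $|x|^{1/L}$ lies in it exactly when $|x|$ lies between $4^{-L}$ and $2^{-L}$.
\<close>
definition bump :: "real \<Rightarrow> real" where
  "bump t = flat_exp (t - 1 / 4) * flat_exp (1 / 2 - t)"

definition bump' :: "real \<Rightarrow> real" where
  "bump' t = flat_exp' (t - 1 / 4) * flat_exp (1 / 2 - t) - flat_exp (t - 1 / 4) * flat_exp' (1 / 2 - t)"

lemma Ck_on_bump: "Ck_on k UNIV bump"
proof -
  have "Ck_on k UNIV (\<lambda>t::real. t + - (1 / 4))" "Ck_on k UNIV (\<lambda>t::real. 1 / 2 + (-1) * t)"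
    by (intro Ck_on_add Ck_on_mult Ck_on_const Ck_on_linear[of _ "\<lambda>x. x"] bounded_linear_ident open_UNIV)+
  then have "Ck_on k UNIV (\<lambda>t::real. flat_exp (t + - (1 / 4)) * flat_exp (1 / 2 + (-1) * t))"
    by (intro Ck_on_mult Ck_on_comp[OF _ Ck_on_flat_exp]) auto
  then show ?thesis by (simp add: bump_def[abs_def])
qed

lemma DERIV_bump: "(bump has_real_derivative bump' t) (at t)"
proof -
  have 1: "((\<lambda>t. flat_exp (t - 1 / 4)) has_real_derivative flat_exp' (t - 1 / 4) * 1) (at t)"
    by (rule DERIV_chain2[OF DERIV_flat_exp]) (auto intro!: derivative_eq_intros)
  have 2: "((\<lambda>t. flat_exp (1 / 2 - t)) has_real_derivative flat_exp' (1 / 2 - t) * (- 1)) (at t)"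
    by (rule DERIV_chain2[OF DERIV_flat_exp]) (auto intro!: derivative_eq_intros)
  show ?thesis using DERIV_mult[OF 1 2] unfolding bump_def[abs_def] bump'_def
    by (simp add: algebra_simps)
qed

lemma continuous_bump: "continuous_on A bump" "continuous_on A bump'"
proof -
  show "continuous_on A bump"
    by (intro continuous_at_imp_continuous_on ballI DERIV_isCont[OF DERIV_bump])
  have "continuous_on UNIV flat_exp"
    by (intro continuous_at_imp_continuous_on ballI DERIV_isCont[OF DERIV_flat_exp])
  note c = continuous_on_compose2[OF this] continuous_on_compose2[OF continuous_flat_exp'[of UNIV]]
  show "continuous_on A bump'" unfolding bump'_def[abs_def]
    by (intro continuous_intros c) auto
qed

lemma bump_bounds: "0 \<le> bump t" "bump t \<le> 1" "\<bar>bump' t\<bar> \<le> 4"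
proof -
  show "0 \<le> bump t" "bump t \<le> 1"
    unfolding bump_def using flat_exp_bounds by (auto intro!: mult_nonneg_nonneg mult_le_one)
  have "\<bar>flat_exp' (t - 1 / 4) * flat_exp (1 / 2 - t)\<bar> \<le> 2 * 1" "\<bar>flat_exp (t - 1 / 4) * flat_exp' (1 / 2 - t)\<bar> \<le> 1 * 2"
    unfolding abs_mult using flat_exp_bounds flat_exp'_bounds by (intro mult_mono; auto)+
  then show "\<bar>bump' t\<bar> \<le> 4" unfolding bump'_def by linarith
qed

lemma bump_outside: "t \<notin> {1/4<..<1/2} \<Longrightarrow> bump t = 0 \<and> bump' t = 0"
  by (auto simp: bump_def bump'_def flat_exp_def flat_exp'_def)

lemma flat_exp_mono: "s \<le> t \<Longrightarrow> flat_exp s \<le> flat_exp t"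
  by (auto simp: flat_exp_def frac_le)

lemma flat_exp_pos: "t > 0 \<Longrightarrow> flat_exp t > 0"
  by (simp add: flat_exp_def)

section \<open>Test functions spread over logarithmic scales\<close>

lemma Ck_on_sqnorm:
  fixes U :: "'a::euclidean_space set"
  assumes "open U" shows "Ck_on k U (\<lambda>x. x \<bullet> x)"
proof -
  have "Ck_on (Suc k) U (\<lambda>x. x \<bullet> x)"
  proof (rule Ck_on_SucI[OF assms, where f'="\<lambda>x v. 2 * (x \<bullet> v)"])
    show "((\<lambda>x. x \<bullet> x) has_derivative (\<lambda>v. 2 * (x \<bullet> v))) (at x)" for x :: 'a
      by (auto intro!: derivative_eq_intros ext simp: inner_commute)
    show "Ck_on k U (\<lambda>x. 2 * (x \<bullet> v))" for v :: 'a
      by (rule Ck_on_linear[OF assms]) (intro bounded_linear_const_mult bounded_linear_inner_left)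
  qed
  then show ?thesis by (rule Ck_on_lower)
qed

lemma two_powr_quarter_bounds: "1 / 4 < (2::real) powr (- 7 / 4)" "(2::real) powr (- 5 / 4) < 1 / 2"
proof -
  have "(2::real) powr (- 2) < 2 powr (- 7 / 4)" by (rule powr_less_mono) auto
  then show "1 / 4 < (2::real) powr (- 7 / 4)" by (simp add: powr_minus_divide)
  have "(2::real) powr (- 5 / 4) < 2 powr (- 1)" by (rule powr_less_mono) auto
  then show "(2::real) powr (- 5 / 4) < 1 / 2" by (simp add: powr_minus_divide)
qed

text \<open>
  A spherical shell made of \<open>L\<close> dyadic annuli.
\<close>
definition shell :: "nat \<Rightarrow> 'a::euclidean_space set" where
  "shell L = {x. (1 / 4) ^ L \<le> norm x \<and> norm x \<le> (1 / 2) ^ L}"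

lemma shell_measurable[measurable]: "shell L \<in> sets borel"
  unfolding shell_def by measurable

lemma compact_shell: "compact (shell L :: 'a::euclidean_space set)"
proof -
  have "shell L = cball 0 ((1 / 2) ^ L) \<inter> {x::'a. (1 / 4) ^ L \<le> norm x}" by (auto simp: shell_def)
  then show ?thesis by (auto intro!: compact_Int_closed closed_Collect_le continuous_intros)
qed

lemma shell_nonzero: "x \<in> shell L \<Longrightarrow> norm x > 0"
proof -
  assume "x \<in> shell L"
  then have "(1 / 4) ^ L \<le> norm x" by (simp add: shell_def)
  moreover have "(0::real) < (1 / 4) ^ L" by simp
  ultimately show ?thesis by linarith
qed

text \<open>
  Curvature contributes a multiple of $2^{-L}$ on each of \<open>L\<close> dyadic annuli; this bound keeps the total within $O(1/L)$.
\<close>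
lemma half_power_le: "L \<ge> 1 \<Longrightarrow> (1 / 2 :: real) ^ L \<le> 2 / (real L)\<^sup>2"
proof -
  assume "L \<ge> 1"
  have "L\<^sup>2 \<le> 2 * 2 ^ L"
  proof (induction L)
    case (Suc L)
    show ?case
    proof (cases "L \<ge> 3")
      case True
      then have "3 * L \<le> L * L" by (intro mult_right_mono) auto
      then have "2 * L + 1 \<le> L * L" using True by linarith
      then have "(Suc L)\<^sup>2 \<le> 2 * L\<^sup>2" by (simp add: power2_eq_square)
      then show ?thesis using Suc by simp
    next
      case False
      then have "L = 0 \<or> L = 1 \<or> L = 2" by auto
      then show ?thesis by (auto simp: power2_eq_square)
    qed
  qed simp
  then have "real (L\<^sup>2) \<le> real (2 * 2 ^ L)" by (rule of_nat_mono)
  then have "(real L)\<^sup>2 \<le> 2 * 2 ^ L" by simp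
  then show ?thesis using \<open>L \<ge> 1\<close> by (simp add: field_simps power_one_over)
qed

locale test_space = curved_half_space +
  assumes n3: "n \<ge> 3"
begin

text \<open>
  This is $|x|^{1/L}$, written with $|x|^2$ because that is differentiable.
\<close>
definition radial_root :: "nat \<Rightarrow> 'a \<Rightarrow> real" where "radial_root L x = (x \<bullet> x) powr (1 / (2 * real L))"
definition log_profile :: "nat \<Rightarrow> 'a \<Rightarrow> real" where "log_profile L x = bump (radial_root L x)"
definition log_profile_grad :: "nat \<Rightarrow> 'a \<Rightarrow> 'a" where
  "log_profile_grad L x = (bump' (radial_root L x) * (radial_root L x / (real L * (x \<bullet> x)))) *\<^sub>R x"
text \<open>
  Cuts off the layer $d \le \epsilon$ next to the boundary.
\<close>
definition layer_cutoff :: "real \<Rightarrow> 'a \<Rightarrow> real" where "layer_cutoff \<epsilon> x = flat_exp (d x / \<epsilon> - 1)"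
definition layer_cutoff_grad :: "real \<Rightarrow> 'a \<Rightarrow> 'a" where
  "layer_cutoff_grad \<epsilon> x = (flat_exp' (d x / \<epsilon> - 1) / \<epsilon>) *\<^sub>R (e + \<kappa> *\<^sub>R x)"
definition ground_state :: "'a \<Rightarrow> real" where "ground_state x = F x * (x \<bullet> x) powr (- n / 4)"
text \<open>
  Ground state times a profile that varies on the logarithmic scale $\ln|x| \sim L$.
\<close>
definition test_fun :: "nat \<Rightarrow> real \<Rightarrow> 'a \<Rightarrow> real" where
  "test_fun L \<epsilon> x = ground_state x * (log_profile L x * layer_cutoff \<epsilon> x)"
definition test_fun_grad :: "nat \<Rightarrow> real \<Rightarrow> 'a \<Rightarrow> 'a" where
  "test_fun_grad L \<epsilon> x = ground_state x *\<^sub>R (log_profile L x *\<^sub>R layer_cutoff_grad \<epsilon> x + layer_cutoff \<epsilon> x *\<^sub>R log_profile_grad L x) + (log_profile L x * layer_cutoff \<epsilon> x) *\<^sub>R (ground_state x *\<^sub>R drift x)"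
definition hardy_density :: "'a \<Rightarrow> real" where "hardy_density x = (x \<bullet> x) powr (- n / 2)"
text \<open>
  The integral of $|x|^{-n}$ over the shell, that is, up to a constant its logarithmic thickness.
\<close>
definition shell_mass :: "nat \<Rightarrow> real" where "shell_mass L = (\<integral>x. indicator (shell L) x * hardy_density x \<partial>lborel)"

lemma radial_root_power:
  assumes "L > 0" shows "radial_root L x ^ L = norm x"
proof (cases "x = 0")
  case False
  then have "(x \<bullet> x) powr (1 / (2 * real L)) > 0" by simp
  then have "radial_root L x ^ L = ((x \<bullet> x) powr (1 / (2 * real L))) powr real L"
    unfolding radial_root_def by (rule powr_realpow[symmetric])
  also have "\<dots> = (x \<bullet> x) powr (1 / 2)" using assms by (simp add: powr_powr)
  also have "\<dots> = norm x" by (simp add: powr_half_sqrt norm_eq_sqrt_inner)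
  finally show ?thesis .
qed (use assms in \<open>simp add: radial_root_def\<close>)

lemma radial_root_nonneg: "radial_root L x \<ge> 0" by (simp add: radial_root_def)

lemma log_profile_outside:
  assumes "L > 0" "x \<notin> shell L"
  shows "log_profile L x = 0" "log_profile_grad L x = 0"
proof -
  have "radial_root L x \<notin> {1/4<..<1/2}"
  proof
    assume r: "radial_root L x \<in> {1/4<..<1/2}"
    then have "(1 / 4) ^ L \<le> radial_root L x ^ L" "radial_root L x ^ L \<le> (1 / 2) ^ L"
      by (auto intro!: power_mono)
    then show False using assms by (simp add: radial_root_power shell_def)
  qed
  from bump_outside[OF this] show "log_profile L x = 0" "log_profile_grad L x = 0" by (auto simp: log_profile_def log_profile_grad_def)
qed

lemma layer_cutoff_outside:
  assumes "\<epsilon> > 0" "d x \<le> \<epsilon>"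
  shows "layer_cutoff \<epsilon> x = 0" "layer_cutoff_grad \<epsilon> x = 0"
proof -
  have "d x / \<epsilon> - 1 \<le> 0" using assms by simp
  then show "layer_cutoff \<epsilon> x = 0" "layer_cutoff_grad \<epsilon> x = 0" by (auto simp: layer_cutoff_def layer_cutoff_grad_def flat_exp_def flat_exp'_def)
qed

lemma C1_on_powr_sqnorm: "C1_on U (\<lambda>x. (x \<bullet> x) powr a) (\<lambda>x. (2 * a * (x \<bullet> x) powr a / (x \<bullet> x)) *\<^sub>R x)"
proof -
  have "C1_on U (\<lambda>x. (\<lambda>s. s powr a) (x \<bullet> x)) (\<lambda>x. (\<lambda>s. a * s powr (a - 1)) (x \<bullet> x) *\<^sub>R (2 *\<^sub>R x))"
  proof (rule C1_on_comp[OF C1_on_sqnorm])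
    have "((\<lambda>s. s powr a) has_real_derivative a * s powr (a - 1)) (at s)" if "s > 0" for s :: real
      using that by (auto intro!: derivative_eq_intros)
    then show "((\<lambda>s. s powr a) has_real_derivative a * (x \<bullet> x) powr (a - 1)) (at (x \<bullet> x))" if "x \<in> U" for x
      using xx_pos[OF that] by blast
    show "continuous_on ((\<lambda>x. x \<bullet> x) ` U) (\<lambda>s. a * s powr (a - 1))"
      by (intro continuous_intros) (use xx_pos in force)
  qed
  then show ?thesis
    by (rule C1_on_cong) (use xx_pos in \<open>auto simp: powr_diff\<close>)
qed

lemma C1_on_ground_state: "C1_on U ground_state (\<lambda>x. ground_state x *\<^sub>R drift x)"
proof -
  have "C1_on U (\<lambda>x. (\<lambda>t. t - n / 4 * \<kappa> * t\<^sup>2) (d x)) (\<lambda>x. (\<lambda>t. 1 - n / 2 * \<kappa> * t) (d x) *\<^sub>R (e + \<kappa> *\<^sub>R x))"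
    by (rule C1_on_comp[OF C1_on_d]) (auto intro!: derivative_eq_intros continuous_intros)
  then have "C1_on U F (\<lambda>x. F1 x *\<^sub>R (e + \<kappa> *\<^sub>R x))"
    by (rule C1_on_cong) (auto simp: F_def F1_def)
  from C1_on_mult[OF this C1_on_powr_sqnorm[of "- n / 4"]]
  show ?thesis
  proof (rule C1_on_cong)
    fix x assume x: "x \<in> U"
    have "F x \<noteq> 0" using F_bounds(2)[OF x] by simp
    then show "F x *\<^sub>R (2 * (- n / 4) * (x \<bullet> x) powr (- n / 4) / (x \<bullet> x)) *\<^sub>R x +
      (x \<bullet> x) powr (- n / 4) *\<^sub>R F1 x *\<^sub>R (e + \<kappa> *\<^sub>R x) = ground_state x *\<^sub>R drift x"
      unfolding ground_state_def drift_def scaleR_diff_right scaleR_scaleR by simp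
  qed (simp add: ground_state_def)
qed

lemma C1_on_log_profile:
  assumes "L > 0" shows "C1_on U (log_profile L) (log_profile_grad L)"
proof -
  have "C1_on U (\<lambda>x. bump (radial_root L x)) (\<lambda>x. bump' (radial_root L x) *\<^sub>R ((2 * (1 / (2 * real L)) * (x \<bullet> x) powr (1 / (2 * real L)) / (x \<bullet> x)) *\<^sub>R x))"
    unfolding radial_root_def by (rule C1_on_comp[OF C1_on_powr_sqnorm DERIV_bump continuous_bump(2)])
  then show ?thesis by (rule C1_on_cong) (auto simp: log_profile_def log_profile_grad_def radial_root_def)
qed

lemma C1_on_layer_cutoff:
  assumes "\<epsilon> > 0" shows "C1_on U (layer_cutoff \<epsilon>) (layer_cutoff_grad \<epsilon>)"
proof -
  have "C1_on U (\<lambda>x. (\<lambda>t. flat_exp (t / \<epsilon> - 1)) (d x)) (\<lambda>x. (\<lambda>t. flat_exp' (t / \<epsilon> - 1) / \<epsilon>) (d x) *\<^sub>R (e + \<kappa> *\<^sub>R x))"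
  proof (rule C1_on_comp[OF C1_on_d])
    fix x
    have "((\<lambda>t. flat_exp (t / \<epsilon> - 1)) has_real_derivative flat_exp' (d x / \<epsilon> - 1) * (1 / \<epsilon>)) (at (d x))"
      by (rule DERIV_chain2[OF DERIV_flat_exp]) (use assms in \<open>auto intro!: derivative_eq_intros\<close>)
    then show "((\<lambda>t. flat_exp (t / \<epsilon> - 1)) has_real_derivative flat_exp' (d x / \<epsilon> - 1) / \<epsilon>) (at (d x))" by simp
  next
    show "continuous_on (d ` U) (\<lambda>t. flat_exp' (t / \<epsilon> - 1) / \<epsilon>)"
      by (intro continuous_intros continuous_on_compose2[OF continuous_flat_exp'[of UNIV]]) (use assms in auto)
  qed
  then show ?thesis by (rule C1_on_cong) (auto simp: layer_cutoff_def layer_cutoff_grad_def)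
qed

lemma test_support:
  assumes L: "L > 0" "(1 / 2) ^ L < D" and eps: "\<epsilon> > 0"
  defines "K \<equiv> shell L \<inter> {x. \<epsilon> \<le> d x}"
  shows "compact K" "K \<subseteq> U" "\<And>x. x \<notin> K \<Longrightarrow> test_fun L \<epsilon> x = 0" "\<And>x. x \<notin> K \<Longrightarrow> test_fun_grad L \<epsilon> x = 0"
proof -
  have "closed {x. \<epsilon> \<le> d x}" by (intro closed_Collect_le continuous_intros continuous_on_d)
  then show "compact K" unfolding K_def by (intro compact_Int_closed compact_shell)
  show "K \<subseteq> U"
  proof
    fix x assume x: "x \<in> K"
    then have "norm x > 0" using shell_nonzero by (auto simp: K_def)
    then show "x \<in> U" using x L eps by (auto simp: K_def U_def shell_def)
  qed
  fix x assume x: "x \<notin> K"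
  then have "x \<notin> shell L \<or> d x \<le> \<epsilon>" by (auto simp: K_def)
  then show "test_fun L \<epsilon> x = 0" "test_fun_grad L \<epsilon> x = 0"
    using log_profile_outside[OF L(1), of x] layer_cutoff_outside[OF eps, of x] by (auto simp: test_fun_def test_fun_grad_def)
qed

lemma C1c_on_test:
  assumes L: "L > 0" "(1 / 2) ^ L < D" and eps: "\<epsilon> > 0"
  shows "C1c_on U (test_fun L \<epsilon>) (test_fun_grad L \<epsilon>)"
proof (rule C1c_onI[OF open_U test_support[OF assms]])
  have "C1_on U (\<lambda>x. ground_state x * (log_profile L x * layer_cutoff \<epsilon> x)) (\<lambda>x. ground_state x *\<^sub>R (log_profile L x *\<^sub>R layer_cutoff_grad \<epsilon> x + layer_cutoff \<epsilon> x *\<^sub>R log_profile_grad L x)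
    + (log_profile L x * layer_cutoff \<epsilon> x) *\<^sub>R (ground_state x *\<^sub>R drift x))"
    by (intro C1_on_mult C1_on_ground_state C1_on_log_profile C1_on_layer_cutoff L eps)
  then show "C1_on U (test_fun L \<epsilon>) (test_fun_grad L \<epsilon>)"
    by (rule C1_on_cong) (auto simp: test_fun_def test_fun_grad_def)
qed

text \<open>
  Away from the origin every factor is smooth, and near the origin the function vanishes.
\<close>
lemma Ck_test:
  assumes L: "L > 0"
  shows "Ck_on k UNIV (test_fun L \<epsilon>)"
proof -
  let ?U = "- {0} :: 'a set" and ?V = "ball 0 ((1 / 4) ^ L) :: 'a set"
  have U: "open ?U" by auto
  have s: "Ck_on k ?U (\<lambda>x. x \<bullet> x)" by (rule Ck_on_sqnorm[OF U])
  have "Ck_on k ?U (\<lambda>x. x \<bullet> e + \<kappa> / 2 * (x \<bullet> x))"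
    by (intro Ck_on_add Ck_on_mult Ck_on_const Ck_on_linear s U bounded_linear_inner_left)
  then have d: "Ck_on k ?U d" by (simp add: d_def[abs_def])
  have "Ck_on k ?U (\<lambda>x. d x + (- (n / 4 * \<kappa>)) * (d x * d x))"
    by (intro Ck_on_add Ck_on_mult Ck_on_const d U)
  then have F: "Ck_on k ?U F" by (simp add: F_def[abs_def] power2_eq_square)
  have P: "Ck_on k ?U (\<lambda>x. (x \<bullet> x) powr a)" for a
    by (rule Ck_on_comp[OF U Ck_on_powr s]) auto
  have B: "Ck_on k ?U (\<lambda>x. bump ((x \<bullet> x) powr (1 / (2 * real L))))"
    by (rule Ck_on_comp[OF U Ck_on_bump P]) auto
  have "Ck_on k ?U (\<lambda>x. d x * (1 / \<epsilon>) + - 1)"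
    by (intro Ck_on_add Ck_on_mult Ck_on_const d U)
  from Ck_on_comp[OF U Ck_on_flat_exp this]
  have "Ck_on k ?U (\<lambda>x. flat_exp (d x * (1 / \<epsilon>) + - 1))" by simp
  then have C: "Ck_on k ?U (layer_cutoff \<epsilon>)" by (simp add: layer_cutoff_def[abs_def])
  have "Ck_on k ?U (\<lambda>x. (F x * (x \<bullet> x) powr (- n / 4)) * (bump ((x \<bullet> x) powr (1 / (2 * real L))) * layer_cutoff \<epsilon> x))"
    by (intro Ck_on_mult U F P B C)
  then have 1: "Ck_on k ?U (test_fun L \<epsilon>)" by (simp add: test_fun_def[abs_def] ground_state_def log_profile_def radial_root_def)
  have 2: "Ck_on k ?V (test_fun L \<epsilon>)"
  proof (rule Ck_on_cong[OF open_ball _ Ck_on_const[of k ?V 0]])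
    fix x assume "x \<in> ?V"
    then have "x \<notin> shell L" by (auto simp: shell_def)
    then show "0 = test_fun L \<epsilon> x" using log_profile_outside[OF L] by (simp add: test_fun_def)
  qed
  have "?U \<union> ?V = UNIV" by auto
  then show ?thesis using Ck_on_Un[OF U open_ball 1 2] by simp
qed

lemma integrable_hardy_density: "integrable lborel (\<lambda>x. indicator (shell L) x * hardy_density x)"
proof -
  have "continuous_on (shell L) hardy_density" unfolding hardy_density_def
    by (intro continuous_intros) (use shell_nonzero in auto)
  from borel_integrable_compact[OF compact_shell this] show ?thesis by simp
qed

lemma hardy_density_eq: "hardy_density x = norm x powr (- n)"
proof (cases "x = 0")
  case False
  have eq: "x \<bullet> x = norm x powr 2" using False by (simp add: dot_square_norm)
  have "2 * (- n / 2) = - n" by simp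
  then show ?thesis unfolding hardy_density_def eq powr_powr by simp
qed (simp add: hardy_density_def)

lemma hardy_density_nonneg: "hardy_density x \<ge> 0" by (simp add: hardy_density_def)

lemma shell_mass_nonneg: "shell_mass L \<ge> 0" unfolding shell_mass_def by (intro integral_nonneg_AE) (auto simp: hardy_density_def)

lemma half_powr_eq: "((1 / 2) ^ k) powr a = 2 powr (- (real k * a))" for a :: real
proof -
  have "(1 / 2 :: real) ^ k = 2 powr (- real k)"
    by (simp add: powr_minus_divide powr_realpow power_one_over)
  then show ?thesis by (simp add: powr_powr)
qed

text \<open>
  Every dyadic annulus contributes the same amount, by scaling.
\<close>
lemma shell_mass_le:
  assumes L: "L \<ge> 1"
  shows "shell_mass L \<le> real L * (2 powr n * unit_ball_vol n)"
proof -
  define a where "a k = 2 powr (real (Suc k) * n)" for k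
  have ind: "integrable lborel (\<lambda>x. indicator (cball (0::'a) r) x :: real)" for r
    using emeasure_bounded_finite[OF bounded_cball[of "0::'a" r]] by (intro integrable_real_indicator) auto
  have "shell_mass L \<le> (\<integral>x. (\<Sum>k\<in>{L..<2*L}. a k * indicator (cball (0::'a) ((1/2)^k)) x) \<partial>lborel)"
    unfolding shell_mass_def
  proof (rule integral_mono[OF integrable_hardy_density])
    show "integrable lborel (\<lambda>x. \<Sum>k\<in>{L..<2*L}. a k * indicator (cball (0::'a) ((1/2)^k)) x)"
      by (intro Bochner_Integration.integrable_sum integrable_mult_right ind)
    fix x :: 'a
    show "indicator (shell L) x * hardy_density x \<le> (\<Sum>k\<in>{L..<2*L}. a k * indicator (cball (0::'a) ((1/2)^k)) x)"
    proof (cases "x \<in> shell L")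
      case True
      then have r: "(1/2) ^ (2 * L) \<le> norm x" "norm x \<le> (1/2) ^ L"
        by (auto simp: shell_def power_mult power2_eq_square)
      define j where "j = (LEAST j. (1/2) ^ j \<le> norm x)"
      have j: "(1/2) ^ j \<le> norm x" unfolding j_def by (rule LeastI[of _ "2 * L"]) (rule r(1))
      have j2: "j \<le> 2 * L" unfolding j_def by (rule Least_le) (rule r(1))
      have "(1/2::real) ^ j \<le> (1/2) ^ L" using j r by linarith
      then have jL: "L \<le> j" by (simp add: power_decreasing_iff)
      obtain k where k: "L \<le> k" "k < 2 * L" "(1/2) ^ Suc k \<le> norm x" "norm x \<le> (1/2) ^ k"
      proof (cases "j = L")
        case True
        have "(1/2) ^ Suc L \<le> (1/2::real) ^ L" by (intro power_decreasing) auto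
        then show ?thesis using that[of L] j r L True by auto
      next
        case False
        then obtain i where i: "j = Suc i" "L \<le> i" using jL by (cases j) auto
        have "\<not> (1/2) ^ i \<le> norm x"
          using not_less_Least[of i "\<lambda>j. (1/2) ^ j \<le> norm x"] i by (simp add: j_def)
        then show ?thesis using that[of i] i j j2 by auto
      qed
      have "hardy_density x \<le> ((1/2) ^ Suc k) powr (- n)"
        unfolding hardy_density_eq using k(3) n3 by (intro powr_mono2') auto
      also have "\<dots> = a k" unfolding half_powr_eq a_def by simp
      finally have "indicator (shell L) x * hardy_density x \<le> a k * indicator (cball (0::'a) ((1/2)^k)) x"
        using True k by simp
      also have "\<dots> \<le> (\<Sum>k\<in>{L..<2*L}. a k * indicator (cball (0::'a) ((1/2)^k)) x)"
        by (rule member_le_sum[of k]) (use k in \<open>auto simp: a_def\<close>)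
      finally show ?thesis .
    qed (auto simp: a_def intro!: sum_nonneg)
  qed
  also have "\<dots> = (\<Sum>k\<in>{L..<2*L}. a k * measure lborel (cball (0::'a) ((1/2)^k)))"
    by (subst Bochner_Integration.integral_sum) (auto intro!: integrable_mult_right ind)
  also have "\<dots> = (\<Sum>k\<in>{L..<2*L}. 2 powr n * unit_ball_vol n)"
  proof (rule sum.cong[OF refl])
    fix k
    have "measure lborel (cball (0::'a) ((1/2)^k)) = unit_ball_vol n * ((1/2)^k) ^ DIM('a)"
      using content_cball[of "(1/2)^k" "0::'a"] by (simp add: n_eq)
    also have "((1/2)^k) ^ DIM('a) = ((1/2::real)^k) powr n"
      unfolding n_eq by (rule powr_realpow[symmetric]) simp
    also have "\<dots> = 2 powr (- (real k * n))" by (rule half_powr_eq)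
    finally show "a k * measure lborel (cball (0::'a) ((1/2)^k)) = 2 powr n * unit_ball_vol n"
      by (simp add: a_def powr_add[symmetric] algebra_simps)
  qed
  finally show ?thesis by simp
qed

lemma F_le: "x \<in> U \<Longrightarrow> F x \<le> 3 / 2 * d x"
proof -
  assume x: "x \<in> U"
  have d: "d x > 0" "n * \<bar>\<kappa>\<bar> * d x \<le> 2" using U_D[OF x] d_le[OF x] by auto
  have "\<bar>n * \<kappa> * d x\<bar> \<le> 2" using d n_ge1 by (simp add: abs_mult)
  then have "1 - n * \<kappa> * d x / 4 \<le> 3 / 2" by linarith
  then have "d x * (1 - n * \<kappa> * d x / 4) \<le> d x * (3 / 2)" using d by (intro mult_left_mono) auto
  moreover have "F x = d x * (1 - n * \<kappa> * d x / 4)" by (simp add: F_def power2_eq_square algebra_simps)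
  ultimately show ?thesis by simp
qed

lemma ground_state_square: "(ground_state x)\<^sup>2 = (F x)\<^sup>2 * hardy_density x"
  by (simp add: ground_state_def hardy_density_def power_mult_distrib power2_eq_square[of "_ powr _"] powr_add[symmetric])

lemma ground_state_square_le: "x \<in> U \<Longrightarrow> (ground_state x)\<^sup>2 \<le> 9 * (norm x)\<^sup>2 * hardy_density x"
proof -
  assume x: "x \<in> U"
  have "F x \<le> 3 * norm x" using F_le[OF x] d_le[OF x] by linarith
  then have "(F x)\<^sup>2 \<le> (3 * norm x)\<^sup>2" using F_bounds(2)[OF x] by (intro power_mono) auto
  then have "(F x)\<^sup>2 * hardy_density x \<le> (3 * norm x)\<^sup>2 * hardy_density x" by (rule mult_right_mono) (rule hardy_density_nonneg)
  then show ?thesis by (simp add: ground_state_square power_mult_distrib)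
qed

text \<open>
  Times $|x|^{-n}$ and a constant, this bounds the energy density of the boundary cut-off.
\<close>
definition layer :: "real \<Rightarrow> 'a \<Rightarrow> real" where
  "layer \<epsilon> x = (if d x > 0 then (d x / \<epsilon> * flat_exp' (d x / \<epsilon> - 1))\<^sup>2 else 0)"

lemma layer_bounds: "\<epsilon> > 0 \<Longrightarrow> 0 \<le> layer \<epsilon> x" "\<epsilon> > 0 \<Longrightarrow> layer \<epsilon> x \<le> 16"
proof -
  assume e: "\<epsilon> > 0"
  show "layer \<epsilon> x \<le> 16"
  proof (cases "d x > 0")
    case True
    then have "d x / \<epsilon> * flat_exp' (d x / \<epsilon> - 1) \<le> 4" using e by (intro flat_exp'_cutoff_bounds) auto
    then have "(d x / \<epsilon> * flat_exp' (d x / \<epsilon> - 1))\<^sup>2 \<le> 4\<^sup>2"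
      using True e flat_exp'_bounds(1) by (intro power_mono) auto
    then show ?thesis by (simp add: layer_def)
  qed (simp add: layer_def)
qed (simp add: layer_def)

lemma log_profile_grad_bound:
  assumes L: "L > 0" and x: "norm x > 0"
  shows "norm (log_profile_grad L x) \<le> 2 / (real L * norm x)"
proof (cases "radial_root L x \<in> {1/4<..<1/2}")
  case False
  then show ?thesis using bump_outside by (simp add: log_profile_grad_def)
next
  case True
  have "norm (log_profile_grad L x) = \<bar>bump' (radial_root L x)\<bar> * (radial_root L x / (real L * norm x))"
    using x radial_root_nonneg[of L x] by (simp add: log_profile_grad_def abs_mult dot_square_norm power2_eq_square)
  also have "\<dots> \<le> 4 * ((1 / 2) / (real L * norm x))"
    using True bump_bounds(3) x by (intro mult_mono divide_right_mono) auto
  finally show ?thesis by simp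
qed

text \<open>
  The profile has gradient $O(1/(L|x|))$ and $\varphi^2 \le 9|x|^{2-n}$, which gives the first term; the second one comes from
  the boundary cut-off.
\<close>
lemma test_energy_pointwise:
  assumes L: "L > 0" "(1 / 2) ^ L < D" and eps: "\<epsilon> > 0"
  shows "(norm (test_fun_grad L \<epsilon> x - test_fun L \<epsilon> x *\<^sub>R drift x))\<^sup>2
    \<le> 72 / (real L)\<^sup>2 * (indicator (shell L) x * hardy_density x) + 18 * (indicator (shell L) x * hardy_density x * layer \<epsilon> x)"
proof (cases "x \<in> U \<and> x \<in> shell L")
  case False
  then have "test_fun_grad L \<epsilon> x = 0 \<and> test_fun L \<epsilon> x = 0"
    using test_support(3,4)[OF assms, of x] test_support(2)[OF assms] by blast
  then show ?thesis using hardy_density_nonneg layer_bounds[OF eps] by simp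
next
  case True
  then have x: "x \<in> U" "x \<in> shell L" by auto
  have r: "norm x > 0" "d x > 0" using U_D[OF x(1)] by auto
  have "test_fun_grad L \<epsilon> x - test_fun L \<epsilon> x *\<^sub>R drift x = ground_state x *\<^sub>R (log_profile L x *\<^sub>R layer_cutoff_grad \<epsilon> x + layer_cutoff \<epsilon> x *\<^sub>R log_profile_grad L x)"
    by (simp add: test_fun_grad_def test_fun_def mult_ac)
  then have "(norm (test_fun_grad L \<epsilon> x - test_fun L \<epsilon> x *\<^sub>R drift x))\<^sup>2 = (ground_state x)\<^sup>2 * (norm (log_profile L x *\<^sub>R layer_cutoff_grad \<epsilon> x + layer_cutoff \<epsilon> x *\<^sub>R log_profile_grad L x))\<^sup>2"
    by (simp add: power_mult_distrib)
  also have "\<dots> \<le> (ground_state x)\<^sup>2 * (2 * (norm (log_profile L x *\<^sub>R layer_cutoff_grad \<epsilon> x))\<^sup>2 + 2 * (norm (layer_cutoff \<epsilon> x *\<^sub>R log_profile_grad L x))\<^sup>2)"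
    by (intro mult_left_mono norm_add_square_le) auto
  also have "\<dots> = 2 * ((ground_state x)\<^sup>2 * (norm (log_profile L x *\<^sub>R layer_cutoff_grad \<epsilon> x))\<^sup>2) + 2 * ((ground_state x)\<^sup>2 * (norm (layer_cutoff \<epsilon> x *\<^sub>R log_profile_grad L x))\<^sup>2)"
    by (simp add: algebra_simps)
  also have "(ground_state x)\<^sup>2 * (norm (log_profile L x *\<^sub>R layer_cutoff_grad \<epsilon> x))\<^sup>2 \<le> 9 * (hardy_density x * layer \<epsilon> x)"
  proof -
    have "(norm (log_profile L x *\<^sub>R layer_cutoff_grad \<epsilon> x)) \<le> 1 * (flat_exp' (d x / \<epsilon> - 1) / \<epsilon> * 2)"
    proof -
      have "\<bar>\<kappa>\<bar> * norm x \<le> n * (\<bar>\<kappa>\<bar> * norm x)" using mult_right_mono[OF n_ge1, of "\<bar>\<kappa>\<bar> * norm x"] by simp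
      then have "\<bar>\<kappa>\<bar> * norm x \<le> 1" using U_D(3)[OF x(1)] by (simp add: mult.assoc)
      then have "norm (e + \<kappa> *\<^sub>R x) \<le> 2" using norm_triangle_ineq[of e "\<kappa> *\<^sub>R x"] norm_e by simp
      then show ?thesis unfolding norm_scaleR layer_cutoff_grad_def log_profile_def
        using bump_bounds flat_exp'_bounds(1) eps by (intro mult_mono) auto
    qed
    then have "(norm (log_profile L x *\<^sub>R layer_cutoff_grad \<epsilon> x))\<^sup>2 \<le> (flat_exp' (d x / \<epsilon> - 1) / \<epsilon> * 2)\<^sup>2"
      by (intro power_mono) auto
    moreover have "(ground_state x)\<^sup>2 \<le> (3 / 2 * d x)\<^sup>2 * hardy_density x"
      unfolding ground_state_square using F_le[OF x(1)] F_bounds(2)[OF x(1)] hardy_density_nonneg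
      by (intro mult_right_mono power_mono) auto
    ultimately have "(ground_state x)\<^sup>2 * (norm (log_profile L x *\<^sub>R layer_cutoff_grad \<epsilon> x))\<^sup>2
      \<le> ((3 / 2 * d x)\<^sup>2 * hardy_density x) * (flat_exp' (d x / \<epsilon> - 1) / \<epsilon> * 2)\<^sup>2"
      using hardy_density_nonneg by (intro mult_mono) auto
    also have "\<dots> = 9 * (hardy_density x * layer \<epsilon> x)"
      using r by (simp add: layer_def power_mult_distrib power_divide)
    finally show ?thesis .
  qed
  also have "(ground_state x)\<^sup>2 * (norm (layer_cutoff \<epsilon> x *\<^sub>R log_profile_grad L x))\<^sup>2 \<le> 36 / (real L)\<^sup>2 * hardy_density x"
  proof -
    have "norm (layer_cutoff \<epsilon> x *\<^sub>R log_profile_grad L x) \<le> 1 * (2 / (real L * norm x))"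
      unfolding norm_scaleR using log_profile_grad_bound[OF L(1) r(1)] flat_exp_bounds
      by (intro mult_mono) (auto simp: layer_cutoff_def)
    then have "(norm (layer_cutoff \<epsilon> x *\<^sub>R log_profile_grad L x))\<^sup>2 \<le> (2 / (real L * norm x))\<^sup>2"
      by (intro power_mono) auto
    then have "(ground_state x)\<^sup>2 * (norm (layer_cutoff \<epsilon> x *\<^sub>R log_profile_grad L x))\<^sup>2 \<le> (9 * (norm x)\<^sup>2 * hardy_density x) * (2 / (real L * norm x))\<^sup>2"
      using ground_state_square_le[OF x(1)] hardy_density_nonneg by (intro mult_mono) auto
    also have "\<dots> = 36 / (real L)\<^sup>2 * hardy_density x" using r by (simp add: power_mult_distrib power_divide)
    finally show ?thesis .
  qed
  finally show ?thesis using x by simp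
qed

text \<open>
  Dominated convergence: \<open>layer\<close> is bounded, and at a fixed point it tends to zero with $\epsilon$.
\<close>
lemma layer_vanishes:
  "(\<lambda>j. \<integral>x. indicator (shell L) x * hardy_density x * layer (1 / real (Suc j)) x \<partial>lborel) \<longlonglongrightarrow> 0"
proof -
  have dm[measurable]: "d \<in> borel_measurable borel"
    by (intro borel_measurable_continuous_onI continuous_on_d)
  have fm[measurable]: "flat_exp' \<in> borel_measurable borel"
    by (intro borel_measurable_continuous_onI continuous_flat_exp')
  have "(\<lambda>j. \<integral>x. indicator (shell L) x * hardy_density x * layer (1 / real (Suc j)) x \<partial>lborel) \<longlonglongrightarrow> (\<integral>x. 0 \<partial>(lborel :: 'a measure))"
  proof (rule integral_dominated_convergence[where w="\<lambda>x. indicator (shell L) x * hardy_density x * 16"])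
    show "integrable lborel (\<lambda>x. indicator (shell L) x * hardy_density x * 16)"
      by (intro integrable_mult_left integrable_hardy_density)
    show "(\<lambda>x. indicator (shell L) x * hardy_density x * layer (1 / real (Suc j)) x) \<in> borel_measurable lborel" for j
    proof -
      have "(\<lambda>x. indicator (shell L) x * hardy_density x) \<in> borel_measurable lborel" using integrable_hardy_density by auto
      moreover have "(\<lambda>x. layer (1 / real (Suc j)) x) \<in> borel_measurable lborel" unfolding layer_def by measurable
      ultimately show ?thesis by (rule borel_measurable_times)
    qed
    show "AE x in lborel. norm (indicator (shell L) x * hardy_density x * layer (1 / real (Suc j)) x) \<le> indicator (shell L) x * hardy_density x * 16" for j
    proof (rule AE_I2)
      fix x :: 'a
      have l: "0 \<le> layer (1 / real (Suc j)) x" "layer (1 / real (Suc j)) x \<le> 16" by (rule layer_bounds, simp)+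
      then show "norm (indicator (shell L) x * hardy_density x * layer (1 / real (Suc j)) x) \<le> indicator (shell L) x * hardy_density x * 16"
        using hardy_density_nonneg[of x] by (auto simp: abs_mult intro!: mult_left_mono)
    qed
    show "AE x in lborel. (\<lambda>j. indicator (shell L) x * hardy_density x * layer (1 / real (Suc j)) x) \<longlonglongrightarrow> 0"
    proof (rule AE_I2)
      fix x :: 'a
      have "(\<lambda>j. layer (1 / real (Suc j)) x) \<longlonglongrightarrow> 0"
      proof (cases "d x > 0")
        case True
        have top: "filterlim (\<lambda>j. d x * real (Suc j)) at_top sequentially"
          by (intro filterlim_tendsto_pos_mult_at_top[OF tendsto_const True]
              filterlim_compose[OF filterlim_real_sequentially filterlim_Suc])
        show ?thesis
        proof (rule Lim_null_comparison)
          have "\<forall>\<^sub>F j in sequentially. d x * real (Suc j) \<ge> 2"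
            using top unfolding filterlim_at_top by blast
          then show "\<forall>\<^sub>F j in sequentially. norm (layer (1 / real (Suc j)) x) \<le> (4 / (d x * real (Suc j)))\<^sup>2"
          proof eventually_elim
            case (elim j)
            define s where "s = d x * real (Suc j)"
            have s: "s \<ge> 2" using elim by (simp add: s_def)
            have "0 \<le> s * flat_exp' (s - 1)" "s * flat_exp' (s - 1) \<le> 4 / s"
              using s flat_exp'_bounds(1) flat_exp'_cutoff_bounds(2)[of s] by auto
            then have "(s * flat_exp' (s - 1))\<^sup>2 \<le> (4 / s)\<^sup>2" by (intro power_mono)
            then show ?case using True by (simp add: layer_def s_def del: of_nat_Suc)
          qed
          have "((\<lambda>j. (4 / (d x * real (Suc j)))\<^sup>2) \<longlongrightarrow> 0\<^sup>2) sequentially"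
            by (intro tendsto_power tendsto_divide_0[OF tendsto_const] filterlim_at_top_imp_at_infinity top)
          then show "((\<lambda>j. (4 / (d x * real (Suc j)))\<^sup>2) \<longlongrightarrow> 0) sequentially" by simp
        qed
      qed (simp add: layer_def)
      then show "(\<lambda>j. indicator (shell L) x * hardy_density x * layer (1 / real (Suc j)) x) \<longlonglongrightarrow> 0"
        by (rule tendsto_mult_right_zero)
    qed
  qed simp
  then show ?thesis by simp
qed

lemma small_energy:
  assumes L: "L > 0" "(1 / 2) ^ L < D" and \<delta>: "\<delta> > 0" and \<epsilon>0: "\<epsilon>0 > 0"
  obtains \<epsilon> where "0 < \<epsilon>" "\<epsilon> \<le> \<epsilon>0" "energy (test_fun L \<epsilon>) (test_fun_grad L \<epsilon>) \<le> 72 / (real L)\<^sup>2 * shell_mass L + \<delta>"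
proof -
  let ?T = "\<lambda>j. \<integral>x. indicator (shell L) x * hardy_density x * layer (1 / real (Suc j)) x \<partial>lborel"
  have "\<forall>\<^sub>F j in sequentially. ?T j < \<delta> / 18"
    using order_tendstoD(2)[OF layer_vanishes, of "\<delta> / 18"] \<delta> by simp
  moreover have "\<forall>\<^sub>F j in sequentially. inverse (real (Suc j)) < \<epsilon>0"
    by (rule order_tendstoD(2)[OF LIMSEQ_inverse_real_of_nat \<epsilon>0])
  ultimately have "\<forall>\<^sub>F j in sequentially. ?T j < \<delta> / 18 \<and> inverse (real (Suc j)) < \<epsilon>0"
    by (rule eventually_conj)
  then obtain j where j: "?T j < \<delta> / 18" "inverse (real (Suc j)) < \<epsilon>0"
    by (auto simp: eventually_sequentially)
  define \<epsilon> where "\<epsilon> = 1 / real (Suc j)"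
  have e: "0 < \<epsilon>" "\<epsilon> \<le> \<epsilon>0" using j by (auto simp: \<epsilon>_def inverse_eq_divide)
  have dm[measurable]: "d \<in> borel_measurable borel"
    by (intro borel_measurable_continuous_onI continuous_on_d)
  have fm[measurable]: "flat_exp' \<in> borel_measurable borel"
    by (intro borel_measurable_continuous_onI continuous_flat_exp')
  have iT: "integrable lborel (\<lambda>x. indicator (shell L) x * hardy_density x * layer \<epsilon> x)"
  proof (rule Bochner_Integration.integrable_bound)
    show "integrable lborel (\<lambda>x. indicator (shell L) x * hardy_density x * 16)"
      by (intro integrable_mult_left integrable_hardy_density)
    have "(\<lambda>x. indicator (shell L) x * hardy_density x) \<in> borel_measurable lborel" using integrable_hardy_density by auto
    moreover have "(\<lambda>x. layer \<epsilon> x) \<in> borel_measurable lborel" unfolding layer_def by measurable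
    ultimately show "(\<lambda>x. indicator (shell L) x * hardy_density x * layer \<epsilon> x) \<in> borel_measurable lborel"
      by (rule borel_measurable_times)
    show "AE x in lborel. norm (indicator (shell L) x * hardy_density x * layer \<epsilon> x) \<le> norm (indicator (shell L) x * hardy_density x * 16)"
      using layer_bounds[OF e(1)] hardy_density_nonneg by (intro AE_I2) (auto simp: abs_mult intro!: mult_left_mono)
  qed
  have "energy (test_fun L \<epsilon>) (test_fun_grad L \<epsilon>)
    \<le> (\<integral>x. 72 / (real L)\<^sup>2 * (indicator (shell L) x * hardy_density x) + 18 * (indicator (shell L) x * hardy_density x * layer \<epsilon> x) \<partial>lborel)"
    unfolding energy_def
    by (intro integral_mono test_energy_pointwise L e integrable_energy[OF C1c_on_test[OF L e(1)]]
        Bochner_Integration.integrable_add integrable_mult_right integrable_hardy_density iT)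
  also have "\<dots> = 72 / (real L)\<^sup>2 * shell_mass L + 18 * (\<integral>x. indicator (shell L) x * hardy_density x * layer \<epsilon> x \<partial>lborel)"
    unfolding shell_mass_def
    by (simp only: integral_mult_right_zero Bochner_Integration.integral_add[OF integrable_mult_right[OF integrable_hardy_density] integrable_mult_right[OF iT]])
  also have "\<dots> \<le> 72 / (real L)\<^sup>2 * shell_mass L + \<delta>" using j(1) unfolding \<epsilon>_def by linarith
  finally show ?thesis using that e by blast
qed

text \<open>
  The curvature term is $O(|x|^{1-n})$, one power better than the energy density, and $|x| \le 2^{-L}$ on the support.
\<close>
lemma test_curvature_error:
  assumes L: "L > 0" "(1 / 2) ^ L < D" and eps: "\<epsilon> > 0"
  shows "(\<integral>x. potential x * (test_fun L \<epsilon> x)\<^sup>2 \<partial>lborel)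
    \<le> n\<^sup>2 / 4 * (\<integral>x. (test_fun L \<epsilon> x)\<^sup>2 / (norm x)\<^sup>2 \<partial>lborel) + 36 * n\<^sup>2 * \<bar>\<kappa>\<bar> * (1 / 2) ^ L * shell_mass L"
proof -
  note u = C1c_on_test[OF assms]
  have "(\<integral>x. potential x * (test_fun L \<epsilon> x)\<^sup>2 \<partial>lborel)
    \<le> (\<integral>x. n\<^sup>2 / 4 * (1 / (x \<bullet> x) * (test_fun L \<epsilon> x)\<^sup>2) + 36 * n\<^sup>2 * \<bar>\<kappa>\<bar> * (1 / 2) ^ L * (indicator (shell L) x * hardy_density x) \<partial>lborel)"
  proof (rule integral_mono)
    show "integrable lborel (\<lambda>x. potential x * (test_fun L \<epsilon> x)\<^sup>2)"
      by (intro integrable_weight[OF u] continuous_on_U)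
    have "\<forall>x\<in>U. x \<bullet> x \<noteq> 0" using U_D(1) by auto
    then show "integrable lborel (\<lambda>x. n\<^sup>2 / 4 * (1 / (x \<bullet> x) * (test_fun L \<epsilon> x)\<^sup>2) + 36 * n\<^sup>2 * \<bar>\<kappa>\<bar> * (1 / 2) ^ L * (indicator (shell L) x * hardy_density x))"
      by (intro Bochner_Integration.integrable_add integrable_mult_right integrable_weight[OF u] integrable_hardy_density continuous_intros)
    fix x
    show "potential x * (test_fun L \<epsilon> x)\<^sup>2 \<le> n\<^sup>2 / 4 * (1 / (x \<bullet> x) * (test_fun L \<epsilon> x)\<^sup>2) + 36 * n\<^sup>2 * \<bar>\<kappa>\<bar> * (1 / 2) ^ L * (indicator (shell L) x * hardy_density x)"
    proof (cases "x \<in> U \<and> x \<in> shell L")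
      case False
      then have "test_fun L \<epsilon> x = 0"
        using test_support(3)[OF assms, of x] test_support(2)[OF assms] by blast
      then show ?thesis using hardy_density_nonneg by simp
    next
      case True
      then have x: "x \<in> U" "x \<in> shell L" by auto
      have r: "norm x > 0" "norm x \<le> (1 / 2) ^ L" using U_D[OF x(1)] x(2) by (auto simp: shell_def)
      have "(log_profile L x * layer_cutoff \<epsilon> x) \<le> 1" "0 \<le> log_profile L x * layer_cutoff \<epsilon> x"
        unfolding log_profile_def layer_cutoff_def using bump_bounds flat_exp_bounds by (auto intro!: mult_le_one mult_nonneg_nonneg)
      then have "(log_profile L x * layer_cutoff \<epsilon> x)\<^sup>2 \<le> 1" by (simp add: power_le_one)
      then have "(test_fun L \<epsilon> x)\<^sup>2 \<le> (ground_state x)\<^sup>2"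
        using mult_left_mono[of "(log_profile L x * layer_cutoff \<epsilon> x)\<^sup>2" 1 "(ground_state x)\<^sup>2"] unfolding test_fun_def by (simp add: power_mult_distrib)
      then have t: "(test_fun L \<epsilon> x)\<^sup>2 \<le> 9 * (norm x)\<^sup>2 * hardy_density x" using ground_state_square_le[OF x(1)] by linarith
      have "potential x * (test_fun L \<epsilon> x)\<^sup>2 \<le> (n\<^sup>2 / 4 / (x \<bullet> x) + 4 * n\<^sup>2 * \<bar>\<kappa>\<bar> / norm x) * (test_fun L \<epsilon> x)\<^sup>2"
        using abs_le_D1[OF potential_bound[OF x(1)]] by (intro mult_right_mono) auto
      also have "\<dots> = n\<^sup>2 / 4 * (1 / (x \<bullet> x) * (test_fun L \<epsilon> x)\<^sup>2) + 4 * n\<^sup>2 * \<bar>\<kappa>\<bar> / norm x * (test_fun L \<epsilon> x)\<^sup>2"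
        by (simp add: distrib_right)
      also have "4 * n\<^sup>2 * \<bar>\<kappa>\<bar> / norm x * (test_fun L \<epsilon> x)\<^sup>2 \<le> 4 * n\<^sup>2 * \<bar>\<kappa>\<bar> / norm x * (9 * (norm x)\<^sup>2 * hardy_density x)"
        using t r by (intro mult_left_mono) auto
      also have "\<dots> = 36 * n\<^sup>2 * \<bar>\<kappa>\<bar> * norm x * hardy_density x" using r by (simp add: power2_eq_square)
      also have "\<dots> \<le> 36 * n\<^sup>2 * \<bar>\<kappa>\<bar> * (1 / 2) ^ L * hardy_density x"
        using r hardy_density_nonneg by (intro mult_right_mono mult_left_mono) auto
      finally show ?thesis using x by simp
    qed
  qed
  also have "\<dots> = n\<^sup>2 / 4 * (\<integral>x. 1 / (x \<bullet> x) * (test_fun L \<epsilon> x)\<^sup>2 \<partial>lborel) + 36 * n\<^sup>2 * \<bar>\<kappa>\<bar> * (1 / 2) ^ L * shell_mass L"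
  proof -
    have "\<forall>x\<in>U. x \<bullet> x \<noteq> 0" using U_D(1) by auto
    then have i: "integrable lborel (\<lambda>x. 1 / (x \<bullet> x) * (test_fun L \<epsilon> x)\<^sup>2)"
      by (intro integrable_weight[OF u] continuous_intros)
    show ?thesis unfolding shell_mass_def
      by (simp only: integral_mult_right_zero Bochner_Integration.integral_add[OF integrable_mult_right[OF i] integrable_mult_right[OF integrable_hardy_density]])
  qed
  also have "(\<lambda>x. 1 / (x \<bullet> x) * (test_fun L \<epsilon> x)\<^sup>2) = (\<lambda>x. (test_fun L \<epsilon> x)\<^sup>2 / (norm x)\<^sup>2)"
    by (simp add: dot_square_norm)
  finally show ?thesis .
qed

text \<open>
  The \<open>L\<close> dyadic annuli carry energy $O(1/L^2)$ each. The boundary layer is chosen so thin that it adds at most $1/L$.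
\<close>
lemma deficit_upper:
  obtains C where "C > 0" "\<And>L \<epsilon>0. L \<ge> 1 \<Longrightarrow> (1 / 2) ^ L < D \<Longrightarrow> \<epsilon>0 > 0 \<Longrightarrow> \<exists>\<epsilon>. 0 < \<epsilon> \<and> \<epsilon> \<le> \<epsilon>0 \<and>
    (\<integral>x. (norm (test_fun_grad L \<epsilon> x))\<^sup>2 \<partial>lborel) - n\<^sup>2 / 4 * (\<integral>x. (test_fun L \<epsilon> x)\<^sup>2 / (norm x)\<^sup>2 \<partial>lborel) \<le> C / real L"
proof -
  define B where "B = 2 powr n * unit_ball_vol n"
  have B: "B \<ge> 0" using n3 by (simp add: B_def unit_ball_vol_nonneg)
  define C where "C = 72 * B + 72 * n\<^sup>2 * \<bar>\<kappa>\<bar> * B + 1"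
  have "C > 0" using B by (auto simp: C_def intro!: add_nonneg_pos add_nonneg_nonneg)
  moreover have "\<exists>\<epsilon>. 0 < \<epsilon> \<and> \<epsilon> \<le> \<epsilon>0 \<and>
    (\<integral>x. (norm (test_fun_grad L \<epsilon> x))\<^sup>2 \<partial>lborel) - n\<^sup>2 / 4 * (\<integral>x. (test_fun L \<epsilon> x)\<^sup>2 / (norm x)\<^sup>2 \<partial>lborel) \<le> C / real L"
    if L: "L \<ge> 1" "(1 / 2) ^ L < D" and \<epsilon>0: "\<epsilon>0 > 0" for L \<epsilon>0
  proof -
    have L0: "L > 0" using L by simp
    have "1 / real L > 0" using L by simp
    from small_energy[OF L0 L(2) this \<epsilon>0] obtain \<epsilon> where e: "0 < \<epsilon>" "\<epsilon> \<le> \<epsilon>0"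
      "energy (test_fun L \<epsilon>) (test_fun_grad L \<epsilon>) \<le> 72 / (real L)\<^sup>2 * shell_mass L + 1 / real L" .
    have JB: "shell_mass L \<le> real L * B" using shell_mass_le[OF L(1)] by (simp add: B_def)
    have 1: "72 / (real L)\<^sup>2 * shell_mass L \<le> 72 / (real L)\<^sup>2 * (real L * B)" using JB by (intro mult_left_mono) auto
    have "36 * n\<^sup>2 * \<bar>\<kappa>\<bar> * (1 / 2) ^ L * shell_mass L \<le> 36 * n\<^sup>2 * \<bar>\<kappa>\<bar> * (2 / (real L)\<^sup>2) * (real L * B)"
      using JB shell_mass_nonneg half_power_le[OF L(1)] by (intro mult_mono mult_left_mono) auto
    then have "(\<integral>x. (norm (test_fun_grad L \<epsilon> x))\<^sup>2 \<partial>lborel) - n\<^sup>2 / 4 * (\<integral>x. (test_fun L \<epsilon> x)\<^sup>2 / (norm x)\<^sup>2 \<partial>lborel)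
      \<le> 72 / (real L)\<^sup>2 * (real L * B) + 1 / real L + 36 * n\<^sup>2 * \<bar>\<kappa>\<bar> * (2 / (real L)\<^sup>2) * (real L * B)"
      using ground_state_identity[OF C1c_on_test[OF L0 L(2) e(1)]] test_curvature_error[OF L0 L(2) e(1)] e(3) 1 by linarith
    also have "\<dots> = C / real L" using L by (simp add: C_def field_simps power2_eq_square)
    finally show ?thesis using e by blast
  qed
  ultimately show ?thesis using that by blast
qed

end

section \<open>Failure of smaller exponents\<close>

context test_space
begin

text \<open>
  A ball of radius comparable to its distance $\frac34 2^{-k}$ from the origin, well inside the cone around the normal \<open>e\<close>.
\<close>
definition probe_ball :: "nat \<Rightarrow> 'a set" where
  "probe_ball k = ball ((3 / 4 * (1 / 2) ^ k) *\<^sub>R e) ((1 / 2) ^ k / 8)"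

lemma probe_ball_bounds:
  assumes "x \<in> probe_ball k"
  shows "5 / 8 * (1 / 2) ^ k < norm x" "norm x < 7 / 8 * (1 / 2) ^ k" "5 / 8 * (1 / 2) ^ k \<le> x \<bullet> e"
proof -
  define R :: real where "R = (1 / 2) ^ k"
  have R: "R > 0" by (simp add: R_def)
  define y where "y = x - (3 / 4 * R) *\<^sub>R e"
  have y: "norm y < R / 8" using assms by (simp add: probe_ball_def y_def R_def dist_norm norm_minus_commute)
  have x: "x = (3 / 4 * R) *\<^sub>R e + y" by (simp add: y_def)
  have ne: "norm ((3 / 4 * R) *\<^sub>R e) = 3 / 4 * R" using R norm_e by simp
  have "norm x \<le> norm ((3 / 4 * R) *\<^sub>R e) + norm y" unfolding x by (rule norm_triangle_ineq)
  then have "norm x \<le> 3 / 4 * R + norm y" unfolding ne .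
  then show "norm x < 7 / 8 * (1 / 2) ^ k" using y by (simp add: R_def[symmetric])
  have "norm (x - y) \<le> norm x + norm y" by (rule norm_triangle_ineq4)
  moreover have "x - y = (3 / 4 * R) *\<^sub>R e" by (simp add: y_def)
  ultimately have "3 / 4 * R \<le> norm x + norm y" using ne by simp
  then show "5 / 8 * (1 / 2) ^ k < norm x" using y by (simp add: R_def[symmetric])
  have "e \<bullet> e = 1" using norm_e by (simp add: norm_eq_1)
  then have "x \<bullet> e = 3 / 4 * R + y \<bullet> e" by (simp add: x inner_add_left)
  moreover have "\<bar>y \<bullet> e\<bar> \<le> norm y" using Cauchy_Schwarz_ineq2[of y e] norm_e by simp
  ultimately show "5 / 8 * (1 / 2) ^ k \<le> x \<bullet> e" using y by (simp add: R_def[symmetric])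
qed

lemma probe_ball_disjoint: "x \<in> probe_ball j \<Longrightarrow> x \<in> probe_ball k \<Longrightarrow> j = k"
proof -
  have *: False if "x \<in> probe_ball j" "x \<in> probe_ball k" "j < k" for j k
  proof -
    have "(1 / 2 :: real) ^ k \<le> (1 / 2) ^ Suc j" using that(3) by (intro power_decreasing) auto
    then have "(1 / 2 :: real) ^ k \<le> 1 / 2 * (1 / 2) ^ j" by simp
    moreover have "(0::real) < (1 / 2) ^ j" by simp
    ultimately show False using probe_ball_bounds[OF that(1)] probe_ball_bounds[OF that(2)] by linarith
  qed
  assume "x \<in> probe_ball j" "x \<in> probe_ball k"
  then show "j = k" using *[of j k] *[of k j] by (meson nat_neq_iff)
qed

lemma sum_probe_indicators: "(\<Sum>k\<in>A. indicator (probe_ball k) x) \<le> (1::real)" if "finite A"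
proof (cases "\<exists>k\<in>A. x \<in> probe_ball k")
  case True
  then obtain k where k: "k \<in> A" "x \<in> probe_ball k" by blast
  have "(\<Sum>k\<in>A. indicator (probe_ball k) x) = (indicator (probe_ball k) x :: real) + (\<Sum>k\<in>A-{k}. indicator (probe_ball k) x)"
    using that k by (intro sum.remove)
  also have "(\<Sum>k\<in>A-{k}. indicator (probe_ball k) x) = (0::real)"
    using probe_ball_disjoint[OF k(2)] by (intro sum.neutral) (auto simp: indicator_def)
  finally show ?thesis using k by simp
next
  case False
  then have "(\<Sum>k\<in>A. indicator (probe_ball k) x) = (0::real)"
    by (intro sum.neutral) (auto simp: indicator_def)
  then show ?thesis by simp
qed

text \<open>
  A lower bound of the bump on the interval $[2^{-7/4}, 2^{-5/4}]$, which $|x|^{1/4M}$ reaches for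
  $2^{-7M} \le |x| \le 2^{-5M}$.
\<close>
definition beta :: real where
  "beta = flat_exp (2 powr (- 7 / 4) - 1 / 4) * flat_exp (1 / 2 - 2 powr (- 5 / 4))"

lemma beta_pos: "beta > 0"
  unfolding beta_def using two_powr_quarter_bounds by (intro mult_pos_pos flat_exp_pos) auto

text \<open>
  Deep inside the support neither the bump nor the boundary cut-off is small, and the ground state has its natural size
  $|x|^{1-n/2}$.
\<close>
lemma test_lower_bound:
  assumes M: "M \<ge> 1" "(1 / 2) ^ (4 * M) < D" and k: "5 * M \<le> k" "k < 7 * M"
    and eps: "0 < \<epsilon>" "\<epsilon> \<le> (1 / 4) ^ (4 * M) / 8" and x: "x \<in> probe_ball k"
  shows "x \<in> U" "x \<in> shell (4 * M)"
    "test_fun (4 * M) \<epsilon> x \<ge> beta * exp (- 1) / 8 * ((1 / 2) ^ k) powr (1 - n / 2)"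
proof -
  define R :: real where "R = (1 / 2) ^ k"
  have R: "R > 0" by (simp add: R_def)
  define r where "r = norm x"
  have r: "5 / 8 * R < r" "r < 7 / 8 * R" "5 / 8 * R \<le> x \<bullet> e" "r > 0"
    using probe_ball_bounds[OF x] R by (auto simp: R_def r_def)
  have Rup: "R \<le> (1 / 2) ^ (5 * M)" unfolding R_def using k by (intro power_decreasing) auto
  have "(1 / 2 :: real) ^ (7 * M) \<le> (1 / 2) ^ Suc k" using k by (intro power_decreasing) auto
  then have Rlo: "(1 / 2) ^ (7 * M) \<le> R / 2" by (simp add: R_def)
  have P1: "(1 / 2 :: real) ^ (5 * M) \<le> (1 / 2) ^ (4 * M)" by (intro power_decreasing) auto
  have P2: "(1 / 2 :: real) ^ (8 * M) \<le> (1 / 2) ^ (7 * M)" by (intro power_decreasing) auto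
  have q4: "(1 / 4 :: real) ^ (4 * M) = (1 / 2) ^ (8 * M)"
    using power_mult[of "1 / 2 :: real" 2 "4 * M"] by (simp add: power2_eq_square)
  have rD: "r < D" using r Rup P1 M R by linarith
  have rs: "(1 / 2) ^ (7 * M) \<le> r" "r \<le> (1 / 2) ^ (5 * M)" using r Rup Rlo R by linarith+
  have "(1 / 4) ^ (4 * M) \<le> norm x" "norm x \<le> (1 / 2) ^ (4 * M)"
    unfolding q4 r_def[symmetric] using rs P1 P2 by linarith+
  then show sh: "x \<in> shell (4 * M)" by (simp add: shell_def)
  have "3 * (\<bar>\<kappa>\<bar> * r) \<le> n * (\<bar>\<kappa>\<bar> * r)" using n3 r by (intro mult_right_mono) auto
  also have "\<dots> \<le> n * (\<bar>\<kappa>\<bar> * D)" using rD n3 by (intro mult_left_mono) auto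
  finally have kr: "\<bar>\<kappa>\<bar> * r \<le> 1 / 3" using D_small by (simp add: mult.assoc)
  have "\<bar>\<kappa> / 2 * (x \<bullet> x)\<bar> = (\<bar>\<kappa>\<bar> * r) * r / 2" by (simp add: abs_mult dot_square_norm power2_eq_square r_def)
  also have "\<dots> \<le> 1 / 3 * r / 2" using kr r by (intro divide_right_mono mult_right_mono) auto
  finally have "\<kappa> / 2 * (x \<bullet> x) \<ge> - (r / 6)" by linarith
  then have dx: "d x \<ge> R / 4" using r R unfolding d_def by linarith
  then show U: "x \<in> U" using r rD R by (auto simp: U_def r_def)
  have Fx: "F x \<ge> R / 8" using F_bounds(1)[OF U] dx by linarith
  have "\<epsilon> \<le> R / 8" using eps(2) Rlo P2 R unfolding q4 by linarith
  then have "2 \<le> d x / \<epsilon>" using dx eps(1) by (simp add: field_simps)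
  then have "flat_exp 1 \<le> layer_cutoff \<epsilon> x" unfolding layer_cutoff_def by (intro flat_exp_mono) auto
  then have layer_cutoff: "exp (- 1) \<le> layer_cutoff \<epsilon> x" by (simp add: flat_exp_def)
  have radial_root: "radial_root (4 * M) x = r powr (1 / real (4 * M))"
  proof -
    have "x \<bullet> x = r powr 2" using r by (simp add: dot_square_norm r_def[symmetric])
    moreover have "2 * (1 / (2 * real (4 * M))) = 1 / real (4 * M)" by simp
    ultimately show ?thesis unfolding radial_root_def by (simp only: powr_powr)
  qed
  have "2 powr (- 7 / 4) = ((1 / 2) ^ (7 * M)) powr (1 / real (4 * M))"
    unfolding half_powr_eq using M by simp
  also have "\<dots> \<le> radial_root (4 * M) x" unfolding radial_root using rs by (intro powr_mono2) auto
  finally have rho1: "2 powr (- 7 / 4) \<le> radial_root (4 * M) x" .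
  have "radial_root (4 * M) x \<le> ((1 / 2) ^ (5 * M)) powr (1 / real (4 * M))"
    unfolding radial_root using rs r by (intro powr_mono2) auto
  also have "\<dots> = 2 powr (- 5 / 4)" unfolding half_powr_eq using M by simp
  finally have rho2: "radial_root (4 * M) x \<le> 2 powr (- 5 / 4)" .
  have log_profile: "beta \<le> log_profile (4 * M) x"
    unfolding beta_def log_profile_def bump_def
    by (intro mult_mono flat_exp_mono flat_exp_bounds) (use rho1 rho2 in auto)
  have "R powr (- n / 2) \<le> r powr (- n / 2)" using r R n3 by (intro powr_mono2') auto
  moreover have "r powr (- n / 2) = (x \<bullet> x) powr (- n / 4)"
  proof -
    have "x \<bullet> x = r powr 2" using r by (simp add: dot_square_norm r_def[symmetric])
    moreover have "2 * (- n / 4) = - n / 2" by simp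
    ultimately show ?thesis by (simp only: powr_powr)
  qed
  moreover have phi0: "ground_state x \<ge> 0" using F_bounds(2)[OF U] by (simp add: ground_state_def)
  ultimately have "R / 8 * R powr (- n / 2) \<le> ground_state x"
    unfolding ground_state_def using Fx R by (intro mult_mono) auto
  then have "(R / 8 * R powr (- n / 2)) * (beta * exp (- 1)) \<le> ground_state x * (log_profile (4 * M) x * layer_cutoff \<epsilon> x)"
    using log_profile layer_cutoff beta_pos R phi0 by (intro mult_mono) (auto intro: order_trans[OF _ layer_cutoff] simp: log_profile_def bump_bounds)
  moreover have "(R / 8 * R powr (- n / 2)) * (beta * exp (- 1)) = beta * exp (- 1) / 8 * R powr (1 - n / 2)"
  proof -
    have "R * R powr (- n / 2) = R powr (1 - n / 2)" using powr_mult_base[of R "- n / 2"] R by simp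
    then show ?thesis by (simp add: mult_ac)
  qed
  ultimately have "beta * exp (- 1) / 8 * R powr (1 - n / 2) \<le> test_fun (4 * M) \<epsilon> x"
    unfolding test_fun_def by linarith
  then show "test_fun (4 * M) \<epsilon> x \<ge> beta * exp (- 1) / 8 * ((1 / 2) ^ k) powr (1 - n / 2)"
    unfolding R_def .
qed

text \<open>
  Each of $2M = L/2$ disjoint probe balls contributes the same amount, because $q(1 - n/2) = -n$ makes $|\varphi|^q\,dx$ scale
  invariant; the logarithmic weight is comparable to $L^{-p}$ on all of them.
\<close>
lemma sobolev_mass_lower:
  fixes p :: real
  assumes DS: "D \<le> S"
  obtains c M0 where "c > 0" "M0 \<ge> 1"
    "\<And>M \<epsilon>. M \<ge> M0 \<Longrightarrow> (1 / 2) ^ (4 * M) < D \<Longrightarrow> 0 < \<epsilon> \<Longrightarrow> \<epsilon> \<le> (1 / 4) ^ (4 * M) / 8 \<Longrightarrow>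
      c * real (4 * M) powr (1 - p)
        \<le> (\<integral>x. (1 / (1 - ln (norm x / (3 * S)))) powr p * \<bar>test_fun (4 * M) \<epsilon> x\<bar> powr (2 * n / (n - 2)) \<partial>lborel)"
proof -
  define q where "q = 2 * n / (n - 2)"
  have q: "q > 0" "(1 - n / 2) * q = - n" "q > 1" using n3 by (auto simp: q_def field_simps)
  have S: "S > 0" using DS D_pos by linarith
  define b where "b = beta * exp (- 1) / 8"
  have b: "b > 0" using beta_pos by (simp add: b_def)
  define cp where "cp = (2::real) powr (- \<bar>p\<bar>)"
  have cp: "cp > 0" by (simp add: cp_def)
  define vol where "vol = unit_ball_vol n * (1 / 8) powr n"
  have vol: "vol > 0" using n3 by (simp add: vol_def)
  define c where "c = cp * b powr q * vol / 2"
  have c: "c > 0" using cp b vol by (simp add: c_def)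
  (* From here on 1 + ln (3 S) is at most L/6 in absolute value, so the weight lies between L/2 and 2 L. *)
  obtain M0 :: nat where M0: "6 * \<bar>1 + ln (3 * S)\<bar> \<le> real M0" using real_arch_simple by blast
  show ?thesis
  proof (rule that[of c "Suc M0"])
    show "c > 0" "Suc M0 \<ge> 1" using c by auto
    fix M and \<epsilon> :: real
    assume M: "Suc M0 \<le> M" and MD: "(1 / 2) ^ (4 * M) < D" and e: "0 < \<epsilon>" "\<epsilon> \<le> (1 / 4) ^ (4 * M) / 8"
    define L where "L = real (4 * M)"
    have L: "L > 0" "\<bar>1 + ln (3 * S)\<bar> \<le> L / 6" using M M0 by (auto simp: L_def)
    have L0: "4 * M > 0" "M \<ge> 1" using M by auto
    note u = C1c_on_test[OF L0(1) MD e(1)]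
    define f where "f x = (1 / (1 - ln (norm x / (3 * S)))) powr p * \<bar>test_fun (4 * M) \<epsilon> x\<bar> powr q" for x
    have f0: "f x \<ge> 0" for x by (simp add: f_def)
    have lS: "1 - ln (norm x / (3 * S)) \<ge> 1" if "x \<in> U" for x
    proof -
      have "norm x \<le> 3 * S" using U_D(4)[OF that] DS S by linarith
      then have "norm x / (3 * S) \<le> 1" using S by simp
      then have "ln (norm x / (3 * S)) \<le> 0" using U_D(1)[OF that] S by simp
      then show ?thesis by simp
    qed
    have fint: "integrable lborel f"
    proof -
      have cu: "continuous_on U (\<lambda>x. \<bar>test_fun (4 * M) \<epsilon> x\<bar> powr q)"
        by (rule C1_on_continuous[OF C1c_on_C1[OF C1c_on_abs_powr[OF u open_U q(3)]]])
      have nz: "\<forall>x\<in>U. norm x / (3 * S) \<noteq> 0" "\<forall>x\<in>U. 1 - ln (norm x / (3 * S)) \<noteq> 0" "\<forall>x\<in>U. (3 * S) \<noteq> 0"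
        using U_D(1) S lS by fastforce+
      have "continuous_on U (\<lambda>x. (1 / (1 - ln (norm x / (3 * S)))) powr p)"
        by (intro continuous_on_powr continuous_intros nz) (use nz in auto)
      then show ?thesis unfolding f_def
        by (intro integrable_C1c_on[OF u] continuous_on_mult cu) auto
    qed
    have flow: "cp * L powr (- p) * (b powr q * ((1 / 2) ^ k) powr (- n)) \<le> f x"
      if k: "k \<in> {5 * M..<7 * M}" and x: "x \<in> probe_ball k" for k x
    proof -
      have k': "5 * M \<le> k" "k < 7 * M" using k by auto
      note T = test_lower_bound[OF L0(2) MD k' e x]
      have sh: "(1 / 4) ^ (4 * M) \<le> norm x" "norm x \<le> (1 / 2) ^ (4 * M)" using T(2) by (auto simp: shell_def)
      have np: "norm x > 0" using U_D(1)[OF T(1)] by simp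
      define l where "l = 1 - ln (norm x / (3 * S))"
      have l: "l = 1 + ln (3 * S) - ln (norm x)" using np S by (simp add: l_def ln_div)
      have "ln (norm x) \<le> ln ((1 / 2) ^ (4 * M))" using sh np by simp
      also have "\<dots> = - (L * ln 2)" by (simp add: ln_realpow L_def ln_div)
      finally have n1: "ln (norm x) \<le> - (L * ln 2)" .
      have "- (2 * (L * ln 2)) = ln ((1 / 4) ^ (4 * M))"
      proof -
        have "ln (4::real) = 2 * ln 2" using ln_realpow[of "2::real" 2] by simp
        then show ?thesis by (simp add: ln_realpow L_def ln_div)
      qed
      also have "\<dots> \<le> ln (norm x)" using sh np by (subst ln_le_cancel_iff) auto
      finally have n2: "- (2 * (L * ln 2)) \<le> ln (norm x)" .
      have "L * ln 2 \<ge> L * (2 / 3)" "L * ln 2 \<le> L * (25 / 36)"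
        using L(1) ln2_ge_two_thirds ln2_le_25_over_36 by (intro mult_left_mono; simp)+
      then have lb: "L / 2 \<le> l" "l \<le> 2 * L" using L n1 n2 unfolding l by linarith+
      have "cp * L powr (- p) \<le> (1 / l) powr p"
      proof (cases "p \<ge> 0")
        case True
        have "cp * L powr (- p) = (1 / (2 * L)) powr p"
          using True L by (simp add: cp_def powr_minus powr_mult powr_divide field_simps)
        also have "\<dots> \<le> (1 / l) powr p"
          using True L lb by (intro powr_mono2 divide_left_mono) auto
        finally show ?thesis .
      next
        case False
        have "cp * L powr (- p) = (2 / L) powr p"
          using False L by (simp add: cp_def powr_minus powr_divide field_simps)
        also have "\<dots> \<le> (1 / l) powr p"
          using False L lb by (intro powr_mono2') (auto simp: field_simps)
        finally show ?thesis .
      qed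
      moreover have "b powr q * ((1 / 2) ^ k) powr (- n) \<le> \<bar>test_fun (4 * M) \<epsilon> x\<bar> powr q"
      proof -
        have "b powr q * ((1 / 2) ^ k) powr (- n) = (b * ((1 / 2) ^ k) powr (1 - n / 2)) powr q"
          unfolding powr_mult powr_powr q(2) ..
        also have "\<dots> \<le> \<bar>test_fun (4 * M) \<epsilon> x\<bar> powr q"
          using T(3) b q by (intro powr_mono2) (auto simp: b_def)
        finally show ?thesis .
      qed
      ultimately show ?thesis unfolding f_def l_def[symmetric] using cp
        by (intro mult_mono) auto
    qed
    have mb: "measure lborel (probe_ball k) = vol * ((1 / 2) ^ k) powr n" for k
    proof -
      have "measure lborel (probe_ball k) = unit_ball_vol n * ((1 / 2) ^ k / 8) ^ DIM('a)"
        unfolding probe_ball_def using content_ball[of "(1 / 2) ^ k / 8" "(3 / 4 * (1 / 2) ^ k) *\<^sub>R e"]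
        by (simp add: n_eq)
      also have "((1 / 2) ^ k / 8) ^ DIM('a) = ((1 / 2) ^ k * (1 / 8) :: real) powr n"
        unfolding n_eq by (subst powr_realpow) auto
      also have "\<dots> = ((1 / 2) ^ k) powr n * (1 / 8) powr n" by (rule powr_mult)
      finally show ?thesis by (simp add: vol_def)
    qed
    have pint: "integrable lborel (\<lambda>x. indicator (probe_ball k) x :: real)" for k
      using emeasure_bounded_finite[of "probe_ball k"]
      by (intro integrable_real_indicator) (auto simp: probe_ball_def)
    have "(\<integral>x. (\<Sum>k\<in>{5 * M..<7 * M}. (cp * L powr (- p) * (b powr q * ((1 / 2) ^ k) powr (- n))) * indicator (probe_ball k) x) \<partial>lborel)
      \<le> (\<integral>x. f x \<partial>lborel)"
    proof (rule integral_mono[OF _ fint])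
      show "integrable lborel (\<lambda>x. \<Sum>k\<in>{5 * M..<7 * M}. (cp * L powr (- p) * (b powr q * ((1 / 2) ^ k) powr (- n))) * indicator (probe_ball k) x)"
        by (intro Bochner_Integration.integrable_sum integrable_mult_right pint)
      fix x
      have "(\<Sum>k\<in>{5 * M..<7 * M}. (cp * L powr (- p) * (b powr q * ((1 / 2) ^ k) powr (- n))) * indicator (probe_ball k) x)
        \<le> (\<Sum>k\<in>{5 * M..<7 * M}. f x * indicator (probe_ball k) x)"
      proof (rule sum_mono)
        fix k assume "k \<in> {5 * M..<7 * M}"
        then show "(cp * L powr (- p) * (b powr q * ((1 / 2) ^ k) powr (- n))) * indicator (probe_ball k) x \<le> f x * indicator (probe_ball k) x"
          using flow[of k x] by (cases "x \<in> probe_ball k") auto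
      qed
      also have "\<dots> = f x * (\<Sum>k\<in>{5 * M..<7 * M}. indicator (probe_ball k) x)" by (simp add: sum_distrib_left)
      also have "\<dots> \<le> f x * 1" by (intro mult_left_mono sum_probe_indicators f0) auto
      finally show "(\<Sum>k\<in>{5 * M..<7 * M}. (cp * L powr (- p) * (b powr q * ((1 / 2) ^ k) powr (- n))) * indicator (probe_ball k) x) \<le> f x"
        by simp
    qed
    moreover have "(\<integral>x. (\<Sum>k\<in>{5 * M..<7 * M}. (cp * L powr (- p) * (b powr q * ((1 / 2) ^ k) powr (- n))) * indicator (probe_ball k) x) \<partial>lborel)
      = (\<Sum>k\<in>{5 * M..<7 * M}. (cp * L powr (- p) * (b powr q * ((1 / 2) ^ k) powr (- n))) * measure lborel (probe_ball k))"
      by (subst Bochner_Integration.integral_sum) (auto intro!: integrable_mult_right pint)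
    moreover have "\<dots> = (\<Sum>k\<in>{5 * M..<7 * M}. cp * b powr q * vol * L powr (- p))"
    proof (rule sum.cong[OF refl])
      fix k
      have "((1 / 2 :: real) ^ k) powr (- n) * ((1 / 2) ^ k) powr n = 1" by (simp add: powr_add[symmetric])
      then show "(cp * L powr (- p) * (b powr q * ((1 / 2) ^ k) powr (- n))) * measure lborel (probe_ball k) = cp * b powr q * vol * L powr (- p)"
        unfolding mb by (simp add: mult_ac)
    qed
    moreover have "\<dots> = c * L powr (1 - p)"
    proof -
      have "L powr (1 - p) = L * L powr (- p)" using powr_mult_base[of L "- p"] L by simp
      moreover have "real (7 * M - 5 * M) = L / 2" by (simp add: L_def)
      ultimately show ?thesis by (simp add: c_def)
    qed
    ultimately show "c * real (4 * M) powr (1 - p)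
        \<le> (\<integral>x. (1 / (1 - ln (norm x / (3 * S)))) powr p * \<bar>test_fun (4 * M) \<epsilon> x\<bar> powr (2 * n / (n - 2)) \<partial>lborel)"
      by (simp add: f_def[abs_def] L_def q_def)
  qed
qed

text \<open>
  The deficit is $O(1/L)$ and the right-hand side is at least a constant times $L^{(1-p)(n-2)/n}$; the exponent
  $\theta = 1 + (1-p)(n-2)/n$ of their ratio is positive exactly for $p < (2n-2)/(n-2)$.
\<close>
theorem subcritical_exponent_fails:
  fixes p :: real
  assumes DS: "D \<le> S" and p: "p < (2 * n - 2) / (n - 2)" and C': "C' > 0"
  obtains L \<epsilon> where "L > 0" "(1 / 2) ^ L < D" "\<epsilon> > 0"
    "(\<integral>x. (norm (test_fun_grad L \<epsilon> x))\<^sup>2 \<partial>lborel) - n\<^sup>2 / 4 * (\<integral>x. (test_fun L \<epsilon> x)\<^sup>2 / (norm x)\<^sup>2 \<partial>lborel)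
      < C' * (\<integral>x. (1 / (1 - ln (norm x / (3 * S)))) powr p * \<bar>test_fun L \<epsilon> x\<bar> powr (2 * n / (n - 2)) \<partial>lborel) powr ((n - 2) / n)"
proof -
  obtain C where C: "C > 0" "\<And>L \<epsilon>0. L \<ge> 1 \<Longrightarrow> (1 / 2) ^ L < D \<Longrightarrow> \<epsilon>0 > 0 \<Longrightarrow> \<exists>\<epsilon>. 0 < \<epsilon> \<and> \<epsilon> \<le> \<epsilon>0 \<and>
    (\<integral>x. (norm (test_fun_grad L \<epsilon> x))\<^sup>2 \<partial>lborel) - n\<^sup>2 / 4 * (\<integral>x. (test_fun L \<epsilon> x)\<^sup>2 / (norm x)\<^sup>2 \<partial>lborel) \<le> C / real L"
    using deficit_upper by blast
  obtain c M0 where c: "c > 0" "M0 \<ge> 1"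
    "\<And>M \<epsilon>. M \<ge> M0 \<Longrightarrow> (1 / 2) ^ (4 * M) < D \<Longrightarrow> 0 < \<epsilon> \<Longrightarrow> \<epsilon> \<le> (1 / 4) ^ (4 * M) / 8 \<Longrightarrow>
      c * real (4 * M) powr (1 - p)
        \<le> (\<integral>x. (1 / (1 - ln (norm x / (3 * S)))) powr p * \<bar>test_fun (4 * M) \<epsilon> x\<bar> powr (2 * n / (n - 2)) \<partial>lborel)"
    using sobolev_mass_lower[OF DS, of p] by blast
  define a where "a = (n - 2) / n"
  have a: "a > 0" using n3 by (simp add: a_def)
  define \<theta> where "\<theta> = 1 + (1 - p) * a"
  have \<theta>: "\<theta> > 0"
  proof -
    have "p * a < (2 * n - 2) / (n - 2) * a" using p a by (rule mult_strict_right_mono)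
    also have "\<dots> = (2 * n - 2) / n" using n3 by (simp add: a_def)
    finally have "\<theta> > 1 + a - (2 * n - 2) / n" by (simp add: \<theta>_def algebra_simps)
    also have "1 + a - (2 * n - 2) / n = 0" using n3 by (simp add: a_def field_simps)
    finally show ?thesis .
  qed
  define Z where "Z = C / (C' * c powr a)"
  have Z: "Z > 0" using C C' c by (simp add: Z_def)
  obtain M1 :: nat where M1: "Z powr (1 / \<theta>) < real M1" using reals_Archimedean2 by blast
  obtain M2 :: nat where M2: "(1 / 2) ^ M2 < D" using real_arch_pow_inv[of D "1 / 2"] D_pos by auto
  define M where "M = max M0 (max M1 M2)"
  have M: "M \<ge> M0" "M \<ge> M1" "M \<ge> M2" "4 * M \<ge> 1" using c(2) by (auto simp: M_def)
  define L where "L = 4 * M"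
  have "(1 / 2 :: real) ^ L \<le> (1 / 2) ^ M2" using M by (intro power_decreasing) (auto simp: L_def)
  then have LD: "(1 / 2) ^ L < D" using M2 by linarith
  have e0: "(1 / 4 :: real) ^ (4 * M) / 8 > 0" by simp
  obtain \<epsilon> where e: "0 < \<epsilon>" "\<epsilon> \<le> (1 / 4) ^ (4 * M) / 8"
    "(\<integral>x. (norm (test_fun_grad L \<epsilon> x))\<^sup>2 \<partial>lborel) - n\<^sup>2 / 4 * (\<integral>x. (test_fun L \<epsilon> x)\<^sup>2 / (norm x)\<^sup>2 \<partial>lborel) \<le> C / real L"
    using C(2)[OF M(4) LD[unfolded L_def] e0] unfolding L_def by blast
  define I where "I = (\<integral>x. (1 / (1 - ln (norm x / (3 * S)))) powr p * \<bar>test_fun L \<epsilon> x\<bar> powr (2 * n / (n - 2)) \<partial>lborel)"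
  have I: "c * real L powr (1 - p) \<le> I"
    unfolding I_def L_def by (rule c(3)[OF M(1) LD[unfolded L_def] e(1,2)])
  have Lp: "real L > 0" using M by (simp add: L_def)
  have "C / real L < C' * I powr a"
  proof -
    have "Z powr (1 / \<theta>) < real L" using M1 M by (simp add: L_def)
    then have "(Z powr (1 / \<theta>)) powr \<theta> < real L powr \<theta>" using \<theta> by (intro powr_less_mono2) auto
    then have "Z < real L powr \<theta>" using \<theta> Z by (simp add: powr_powr)
    then have "C < C' * c powr a * real L powr \<theta>"
      using C' c by (simp add: Z_def field_simps)
    also have "real L powr \<theta> = real L * real L powr ((1 - p) * a)"
      unfolding \<theta>_def using powr_mult_base[of "real L" "(1 - p) * a"] Lp by simp
    finally have "C / real L < C' * (c powr a * real L powr ((1 - p) * a))"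
      using Lp by (simp add: field_simps)
    also have "c powr a * real L powr ((1 - p) * a) = (c * real L powr (1 - p)) powr a"
      unfolding powr_mult powr_powr ..
    also have "C' * (c * real L powr (1 - p)) powr a \<le> C' * I powr a"
      using I a c C' by (intro mult_left_mono powr_mono2) auto
    finally show ?thesis .
  qed
  then show ?thesis
    using e that[of L \<epsilon>] LD Lp unfolding I_def a_def by auto
qed

end

section \<open>Bounded domains with a boundary singularity\<close>

lemma C1c_on_mono: "C1c_on U f g \<Longrightarrow> U \<subseteq> V \<Longrightarrow> C1c_on V f g"
  unfolding C1c_on_def by blast

lemma gradient_inner:
  fixes u :: "real ^ 'n \<Rightarrow> real"
  assumes "u differentiable (at x)"
  shows "gradient u x \<bullet> h = frechet_derivative u (at x) h"
proof -
  have lin: "linear (frechet_derivative u (at x))" by (rule linear_frechet_derivative[OF assms])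
  have "h = (\<Sum>i\<in>UNIV. (h $ i) *\<^sub>R axis i 1)"
    using basis_expansion[of h] by (simp add: scalar_mult_eq_scaleR)
  then have "frechet_derivative u (at x) h = frechet_derivative u (at x) (\<Sum>i\<in>UNIV. (h $ i) *\<^sub>R axis i 1)" by simp
  also have "\<dots> = (\<Sum>i\<in>UNIV. (h $ i) * frechet_derivative u (at x) (axis i 1))"
    by (simp add: linear_sum[OF lin] linear_scale[OF lin])
  finally show ?thesis by (simp add: gradient_def inner_vec_def mult.commute)
qed

lemma gradient_eq:
  fixes u :: "real ^ 'n \<Rightarrow> real"
  assumes "C1_on UNIV u g"
  shows "gradient u = g"
proof
  fix x
  have "(\<lambda>h. g x \<bullet> h) = frechet_derivative u (at x)"
    by (rule frechet_derivative_at) (use assms in \<open>auto simp: C1_on_def\<close>)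
  then have "frechet_derivative u (at x) (axis i 1) = g x $ i" for i
    by (metis cart_eq_inner_axis)
  then show "gradient u x = g x" by (simp add: gradient_def vec_eq_iff)
qed

text \<open>
  Connects the coordinate gradient with the class in which the estimates are proved.
\<close>
lemma Cc_infty_imp_C1c_on:
  fixes u :: "real ^ 'n \<Rightarrow> real"
  assumes "open \<Omega>" "u \<in> Cc_infty \<Omega>"
  shows "C1c_on \<Omega> u (gradient u)"
proof -
  define K where "K = closure {x. u x \<noteq> 0}"
  have K: "compact K" "K \<subseteq> \<Omega>" and C: "Ck (Suc 0) u"
    using assms(2) unfolding Cc_infty_def K_def by blast+
  have diff: "u differentiable (at x)" for x using C by simp
  have cont: "continuous_on UNIV (\<lambda>x. frechet_derivative u (at x) v)" for v using C by simp
  have out: "u x = 0" if "x \<notin> K" for x using that closure_subset[of "{x. u x \<noteq> 0}"] by (auto simp: K_def)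
  have der: "(u has_derivative (\<lambda>h. gradient u x \<bullet> h)) (at x)" for x
    unfolding gradient_inner[OF diff] using diff frechet_derivative_works by blast
  have "continuous_on UNIV (gradient u)"
    unfolding gradient_def by (intro continuous_on_vec_lambda cont)
  then have C1: "C1_on UNIV u (gradient u)" using der by (simp add: C1_on_def)
  have "gradient u x = 0" if x: "x \<notin> K" for x
  proof -
    have "((\<lambda>_. 0) has_derivative (\<lambda>h. gradient u x \<bullet> h)) (at x)"
      by (rule has_derivative_transform_within_open[OF der, of "- K"])
        (use x K compact_imp_closed out in auto)
    then have "(\<lambda>h. gradient u x \<bullet> h) = (\<lambda>_. 0)"
      using has_derivative_unique has_derivative_const by blast
    then have "gradient u x \<bullet> gradient u x = 0" by metis
    then show ?thesis by simp
  qed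
  then show ?thesis using C1 K out unfolding C1c_on_def by blast
qed

lemma set_integral_vanishing_outside:
  fixes f :: "'a::euclidean_space \<Rightarrow> real"
  assumes "\<And>x. x \<notin> A \<Longrightarrow> f x = 0"
  shows "(LINT x:A|lborel. f x) = (\<integral>x. f x \<partial>lborel)"
  unfolding set_lebesgue_integral_def
  by (intro Bochner_Integration.integral_cong) (use assms in \<open>auto simp: indicator_def\<close>)

lemma hardy_sobolev_ineq_iff:
  fixes u :: "real ^ 'n \<Rightarrow> real"
  assumes u: "C1c_on \<Omega> u g" and n: "CARD('n) \<ge> 3"
  defines "n \<equiv> real CARD('n)" and "D \<equiv> sup_norm_on \<Omega>"
  shows "hardy_sobolev_ineq \<Omega> p C u \<longleftrightarrow>
    C * (\<integral>x. (1 / (1 - ln (norm x / (3 * D)))) powr p * \<bar>u x\<bar> powr (2 * n / (n - 2)) \<partial>lborel) powr ((n - 2) / n)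
    \<le> (\<integral>x. (norm (g x))\<^sup>2 \<partial>lborel) - n\<^sup>2 / 4 * (\<integral>x. (u x)\<^sup>2 / (norm x)\<^sup>2 \<partial>lborel)"
proof -
  have out: "u x = 0" "g x = 0" if "x \<notin> \<Omega>" for x using C1c_on_outside[OF u that] by auto
  have g: "gradient u = g" by (rule gradient_eq[OF C1c_on_C1[OF u]])
  have "(LINT x:\<Omega>|lborel. (norm (g x))\<^sup>2) = (\<integral>x. (norm (g x))\<^sup>2 \<partial>lborel)"
    "(LINT x:\<Omega>|lborel. (u x)\<^sup>2 / (norm x)\<^sup>2) = (\<integral>x. (u x)\<^sup>2 / (norm x)\<^sup>2 \<partial>lborel)"
    "(LINT x:\<Omega>|lborel. X1 (norm x / (3 * D)) powr p * \<bar>u x\<bar> powr (2 * n / (n - 2)))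
      = (\<integral>x. X1 (norm x / (3 * D)) powr p * \<bar>u x\<bar> powr (2 * n / (n - 2)) \<partial>lborel)"
    by (rule set_integral_vanishing_outside; simp add: out)+
  then show ?thesis
    unfolding hardy_sobolev_ineq_def Let_def g n_def[symmetric] D_def[symmetric]
    by (simp only: X1_def) linarith
qed

text \<open>
  The supremum is not attained on an open set, so the domain lies in an open ball on which the logarithmic weight is regular.
\<close>
lemma bounded_domain_norm_less:
  fixes \<Omega> :: "'a::euclidean_space set"
  assumes "bounded_domain \<Omega>" "0 \<in> frontier \<Omega>"
  shows "0 \<notin> \<Omega>" "\<And>x. x \<in> \<Omega> \<Longrightarrow> norm x < sup_norm_on \<Omega>" "sup_norm_on \<Omega> > 0"
proof -
  have op: "open \<Omega>" and bd: "bounded \<Omega>" and ne: "\<Omega> \<noteq> {}" using assms(1) by (auto simp: bounded_domain_def)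
  show z: "0 \<notin> \<Omega>" using assms(2) op by (simp add: frontier_def interior_open)
  have bdd: "bdd_above (norm ` \<Omega>)" using bd by (auto simp: bounded_iff bdd_above_def)
  show less: "norm x < sup_norm_on \<Omega>" if x: "x \<in> \<Omega>" for x
  proof -
    have x0: "norm x > 0" using x z by auto
    obtain \<delta> where \<delta>: "\<delta> > 0" "ball x \<delta> \<subseteq> \<Omega>" using op x by (auto simp: open_contains_ball)
    define y where "y = x + (\<delta> / 2 / norm x) *\<^sub>R x"
    have "dist x y = \<delta> / 2" using \<delta> x0 by (simp add: y_def dist_norm)
    then have "y \<in> \<Omega>" using \<delta> by (auto simp: subset_iff)
    then have "norm y \<le> sup_norm_on \<Omega>" unfolding sup_norm_on_def by (rule cSUP_upper[OF _ bdd])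
    moreover have "y = (1 + \<delta> / 2 / norm x) *\<^sub>R x" by (simp add: y_def scaleR_left_distrib)
    then have "norm y = (1 + \<delta> / 2 / norm x) * norm x" using \<delta> x0 by simp
    then have "norm y = norm x + \<delta> / 2" using x0 by (simp add: distrib_right)
    ultimately show ?thesis using \<delta> by simp
  qed
  obtain x where "x \<in> \<Omega>" using ne by blast
  then show "sup_norm_on \<Omega> > 0" using less[of x] norm_ge_zero[of x] by linarith
qed

text \<open>
  Openness excludes the bounding sphere as well as the ball, so the defining function of the ball is strictly positive.
\<close>
lemma exterior_ball_bound:
  fixes \<Omega> :: "'a::euclidean_space set"
  assumes "open \<Omega>" "0 < \<rho>" "ball (- \<rho> *\<^sub>R e) \<rho> \<subseteq> - closure \<Omega>" "norm e = 1" "x \<in> \<Omega>"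
  shows "0 < x \<bullet> e + (1 / \<rho>) / 2 * (x \<bullet> x)"
proof -
  have "\<Omega> \<inter> ball (- \<rho> *\<^sub>R e) \<rho> = {}" using assms(3) closure_subset[of \<Omega>] by blast
  then have "\<Omega> \<inter> closure (ball (- \<rho> *\<^sub>R e) \<rho>) = {}"
    using open_Int_closure_eq_empty[OF assms(1)] by blast
  then have "x \<notin> cball (- \<rho> *\<^sub>R e) \<rho>" using assms(2,5) by auto
  then have "norm (x + \<rho> *\<^sub>R e) > \<rho>" by (simp add: dist_norm norm_minus_commute)
  then have "\<rho>\<^sup>2 < (norm (x + \<rho> *\<^sub>R e))\<^sup>2" using assms(2) by (intro power_strict_mono) auto
  also have "\<dots> = x \<bullet> x + 2 * \<rho> * (x \<bullet> e) + \<rho>\<^sup>2"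
  proof -
    have "e \<bullet> e = 1" using assms(4) by (simp add: norm_eq_1)
    then show ?thesis unfolding power2_norm_eq_inner
      by (simp add: inner_add_left inner_add_right inner_commute power2_eq_square algebra_simps)
  qed
  finally have "0 < x \<bullet> x + 2 * \<rho> * (x \<bullet> e)" by simp
  then have "0 < (x \<bullet> x + 2 * \<rho> * (x \<bullet> e)) / (2 * \<rho>)" using assms(2) by simp
  also have "\<dots> = x \<bullet> e + (1 / \<rho>) / 2 * (x \<bullet> x)" using assms(2) by (simp add: field_simps)
  finally show ?thesis .
qed

definition hardy_sobolev_const :: "real \<Rightarrow> real" where
  "hardy_sobolev_const n = 1 / (32800 * local_sobolev_const n)"

text \<open>
  The exterior ball of radius $\rho$ places the domain in the curved half space with $\kappa = 1/\rho$.
\<close>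
lemma hardy_sobolev_exterior_ball:
  fixes \<Omega> :: "(real ^ 'n) set"
  assumes n3: "CARD('n) \<ge> 3" and dom: "bounded_domain \<Omega>" "0 \<in> frontier \<Omega>"
    and ext: "0 < \<rho>" "ball (- \<rho> *\<^sub>R e) \<rho> \<subseteq> - closure \<Omega>" "norm e = 1"
    and \<rho>: "\<rho> \<ge> 600 * (real CARD('n))\<^sup>2 * sup_norm_on \<Omega>" and u: "u \<in> Cc_infty \<Omega>"
  shows "hardy_sobolev_ineq \<Omega> ((2 * real CARD('n) - 2) / (real CARD('n) - 2)) (hardy_sobolev_const (real CARD('n))) u"
proof -
  define n where "n = real CARD('n)"
  define D where "D = sup_norm_on \<Omega>"
  have op: "open \<Omega>" using dom by (simp add: bounded_domain_def)
  have D: "D > 0" "\<And>x. x \<in> \<Omega> \<Longrightarrow> norm x < D" "0 \<notin> \<Omega>"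
    using bounded_domain_norm_less[OF dom] by (auto simp: D_def)
  have n: "n \<ge> 3" using n3 by (simp add: n_def)
  have small: "600 * n\<^sup>2 * (1 / \<rho>) * D \<le> 1" using \<rho> ext(1) by (simp add: n_def D_def field_simps)
  have "n * (1 / \<rho>) * D \<le> 600 * n\<^sup>2 * (1 / \<rho>) * D"
    using n D ext(1) by (intro mult_right_mono) (auto simp: power2_eq_square)
  then have "n * (1 / \<rho>) * D \<le> 1" using small by linarith
  moreover have "\<bar>1 / \<rho>\<bar> = 1 / \<rho>" using ext(1) by simp
  ultimately have small': "n * \<bar>1 / \<rho>\<bar> * D \<le> 1" by (simp only:)
  interpret E: exterior_ball_space e "1 / \<rho>" n D
    by unfold_locales (use D n ext small small' in \<open>auto simp: n_def\<close>)
  have "\<Omega> \<subseteq> E.U"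
  proof
    fix x assume x: "x \<in> \<Omega>"
    have "E.d x > 0" unfolding E.d_def by (rule exterior_ball_bound[OF op ext x])
    then show "x \<in> E.U" using D x by (auto simp: E.U_def)
  qed
  then have v: "C1c_on E.U u (gradient u)"
    by (rule C1c_on_mono[OF Cc_infty_imp_C1c_on[OF op u]])
  define I where "I = (\<integral>x. (1 / (1 - ln (norm x / (3 * D)))) powr ((2 * n - 2) / (n - 2)) * \<bar>u x\<bar> powr (2 * n / (n - 2)) \<partial>lborel) powr ((n - 2) / n)"
  have "I \<le> 16400 * local_sobolev_const n * E.energy u (gradient u)"
    unfolding I_def using E.hardy_sobolev_energy[OF v] by (simp add: E.log_weight_def)
  moreover have local_sobolev_const: "local_sobolev_const n > 0" by (rule E.local_sobolev_const_pos)
  ultimately have "hardy_sobolev_const n * I \<le> E.energy u (gradient u) / 2"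
    by (simp add: hardy_sobolev_const_def field_simps)
  also have "\<dots> \<le> (\<integral>x. (norm (gradient u x))\<^sup>2 \<partial>lborel) - n\<^sup>2 / 4 * (\<integral>x. (u x)\<^sup>2 / (norm x)\<^sup>2 \<partial>lborel)"
    by (rule E.hardy_deficit_ge[OF v])
  finally show ?thesis
    unfolding hardy_sobolev_ineq_iff[OF Cc_infty_imp_C1c_on[OF op u] n3] I_def n_def D_def .
qed

text \<open>
  An interior ball of radius $r$ is the set $d > 0$ for $\kappa = -1/r$ and the normal pointing to its centre, so the test functions
  are supported in it.
\<close>
lemma hardy_sobolev_subcritical_fails:
  fixes \<Omega> :: "(real ^ 'n) set"
  assumes n3: "CARD('n) \<ge> 3" and dom: "bounded_domain \<Omega>" "0 \<in> frontier \<Omega>"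
    and int: "interior_ball_at_0 \<Omega>"
    and p: "p < (2 * real CARD('n) - 2) / (real CARD('n) - 2)" and C: "C > 0"
  shows "\<exists>u\<in>Cc_infty \<Omega>. \<not> hardy_sobolev_ineq \<Omega> p C u"
proof -
  define n where "n = real CARD('n)"
  define S where "S = sup_norm_on \<Omega>"
  have S: "S > 0" using bounded_domain_norm_less[OF dom] by (auto simp: S_def)
  have n: "n \<ge> 3" using n3 by (simp add: n_def)
  obtain c r where r: "0 < r" "ball c r \<subseteq> \<Omega>" "0 \<in> frontier (ball c r)"
    using int by (auto simp: interior_ball_at_0_def)
  then have c: "norm c = r" by (simp add: frontier_ball dist_norm)
  define e where "e = (1 / r) *\<^sub>R c"
  have e: "norm e = 1" "c = r *\<^sub>R e" using c r by (auto simp: e_def)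
  define D where "D = min S (r / n)"
  have D: "D > 0" "D \<le> S" "n * \<bar>- 1 / r\<bar> * D \<le> 1"
    using S r n by (auto simp: D_def min_def field_simps)
  interpret T: test_space e "- 1 / r" n D
    by unfold_locales (use D n e in \<open>auto simp: n_def\<close>)
  have U: "T.U \<subseteq> \<Omega>"
  proof
    fix x assume x: "x \<in> T.U"
    have "0 < x \<bullet> e + (- 1 / r) / 2 * (x \<bullet> x)" using T.U_D(2)[OF x] unfolding T.d_def .
    then have "0 < 2 * r * (x \<bullet> e + (- 1 / r) / 2 * (x \<bullet> x))" using r(1) by simp
    also have "\<dots> = 2 * r * (x \<bullet> e) - x \<bullet> x" using r(1) by (simp add: field_simps)
    finally have pos: "0 < 2 * r * (x \<bullet> e) - x \<bullet> x" .
    have "e \<bullet> e = 1" using e(1) by (simp add: norm_eq_1)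
    then have "(norm (x - c))\<^sup>2 = x \<bullet> x - 2 * r * (x \<bullet> e) + r\<^sup>2"
      unfolding power2_norm_eq_inner e(2)
      by (simp add: inner_diff_left inner_diff_right inner_commute power2_eq_square algebra_simps)
    with pos have "(norm (x - c))\<^sup>2 < r\<^sup>2" by simp
    then have "norm (x - c) < r" by (rule power2_less_imp_less) (use r(1) in simp)
    then show "x \<in> \<Omega>" using r(2) by (auto simp: dist_norm norm_minus_commute)
  qed
  obtain L \<epsilon> where L: "L > 0" "(1 / 2) ^ L < D" "\<epsilon> > 0"
    and less: "(\<integral>x. (norm (T.test_fun_grad L \<epsilon> x))\<^sup>2 \<partial>lborel) - n\<^sup>2 / 4 * (\<integral>x. (T.test_fun L \<epsilon> x)\<^sup>2 / (norm x)\<^sup>2 \<partial>lborel)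
      < C * (\<integral>x. (1 / (1 - ln (norm x / (3 * S)))) powr p * \<bar>T.test_fun L \<epsilon> x\<bar> powr (2 * n / (n - 2)) \<partial>lborel) powr ((n - 2) / n)"
    using T.subcritical_exponent_fails[OF D(2) p[folded n_def] C] by blast
  have C1: "C1c_on \<Omega> (T.test_fun L \<epsilon>) (T.test_fun_grad L \<epsilon>)"
    by (rule C1c_on_mono[OF T.C1c_on_test[OF L] U])
  have "T.test_fun L \<epsilon> \<in> Cc_infty \<Omega>"
  proof -
    obtain K where K: "compact K" "K \<subseteq> \<Omega>" "\<And>x. x \<notin> K \<Longrightarrow> T.test_fun L \<epsilon> x = 0"
      using C1 unfolding C1c_on_def by blast
    have sub: "closure {x. T.test_fun L \<epsilon> x \<noteq> 0} \<subseteq> K"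
      using K compact_imp_closed by (intro closure_minimal) auto
    then have "K \<inter> closure {x. T.test_fun L \<epsilon> x \<noteq> 0} = closure {x. T.test_fun L \<epsilon> x \<noteq> 0}"
      by (rule Int_absorb1)
    then have "compact (closure {x. T.test_fun L \<epsilon> x \<noteq> 0})"
      using compact_Int_closed[OF K(1) closed_closure] by metis
    with sub show ?thesis
      using K(2) T.Ck_test[OF L(1)] unfolding Cc_infty_def Ck_on_UNIV by blast
  qed
  moreover have "\<not> hardy_sobolev_ineq \<Omega> p C (T.test_fun L \<epsilon>)"
    using less hardy_sobolev_ineq_iff[OF C1 n3, of p C]
    unfolding n_def[symmetric] S_def[symmetric] by linarith
  ultimately show ?thesis by blast
qed

(* The index k singles out the coordinate called x_n, so that axis k 1 is e_n; the constants
   do not depend on it. *)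
theorem theorem2:
  assumes "CARD('n::finite) \<ge> 3"
  shows "\<exists>\<sigma> > 0. \<exists>C > 0. \<forall>(k::'n) (\<Omega> :: (real ^ 'n) set) \<rho>.
    bounded_domain \<Omega> \<longrightarrow> 0 \<in> frontier \<Omega> \<longrightarrow>
    0 < \<rho> \<longrightarrow> ball (- \<rho> *\<^sub>R axis k 1) \<rho> \<subseteq> - closure \<Omega> \<longrightarrow>
    \<rho> \<ge> sup_norm_on \<Omega> / \<sigma> \<longrightarrow>
      (\<forall>u \<in> Cc_infty \<Omega>.
        hardy_sobolev_ineq \<Omega> ((2 * real CARD('n) - 2) / (real CARD('n) - 2)) C u) \<and>
      (interior_ball_at_0 \<Omega> \<longrightarrow>
        (\<forall>p < (2 * real CARD('n) - 2) / (real CARD('n) - 2).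
          \<not> (\<exists>C' > 0. \<forall>u \<in> Cc_infty \<Omega>. hardy_sobolev_ineq \<Omega> p C' u)))"
proof -
  define n where "n = real CARD('n)"
  define \<sigma> where "\<sigma> = 1 / (600 * n\<^sup>2)"
  have n: "n \<ge> 3" using assms by (simp add: n_def)
  have \<sigma>: "\<sigma> > 0" using n by (simp add: \<sigma>_def)
  have C: "hardy_sobolev_const n > 0"
    unfolding hardy_sobolev_const_def using local_sobolev_const_pos[OF n] by simp
  show ?thesis
  proof (rule exI[of _ \<sigma>], rule conjI[OF \<sigma>], rule exI[of _ "hardy_sobolev_const n"], rule conjI[OF C],
      intro allI impI conjI ballI)
    fix k :: 'n and \<Omega> :: "(real ^ 'n) set" and \<rho> u
    assume dom: "bounded_domain \<Omega>" "0 \<in> frontier \<Omega>"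
      and ext: "0 < \<rho>" "ball (- \<rho> *\<^sub>R axis k 1) \<rho> \<subseteq> - closure \<Omega>"
      and \<rho>: "sup_norm_on \<Omega> / \<sigma> \<le> \<rho>" and u: "u \<in> Cc_infty \<Omega>"
    have "600 * (real CARD('n))\<^sup>2 * sup_norm_on \<Omega> \<le> \<rho>"
      using \<rho> by (simp add: \<sigma>_def n_def mult.commute)
    then show "hardy_sobolev_ineq \<Omega> ((2 * real CARD('n) - 2) / (real CARD('n) - 2)) (hardy_sobolev_const n) u"
      unfolding n_def using hardy_sobolev_exterior_ball[OF assms dom ext norm_axis_1 _ u] by blast
  next
    fix k :: 'n and \<Omega> :: "(real ^ 'n) set" and \<rho> p
    assume dom: "bounded_domain \<Omega>" "0 \<in> frontier \<Omega>" and int: "interior_ball_at_0 \<Omega>"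
      and p: "p < (2 * real CARD('n) - 2) / (real CARD('n) - 2)"
    show "\<not> (\<exists>C' > 0. \<forall>u \<in> Cc_infty \<Omega>. hardy_sobolev_ineq \<Omega> p C' u)"
      using hardy_sobolev_subcritical_fails[OF assms dom int p] by blast
  qed
qed

end
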